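(* There is a fixed constant $g_0>0$ such that for every fixed $g>g_0$ there is a sequence of positive-spectrum quartic kernels $k=bP_{4,d}$ (with dimensions $d$ and sample sizes $n\to\infty$) satisfying $$n^3\delta^2\to 0,\qquad n^4\tau^2\to 0,\qquad nh/d\to g,\qquad \operatorname{TV}\bigl(P_k,G(n,1/2)\bigr)\to 1.$$
   Context: $P_{4,d}$ is the degree-four zonal spherical harmonic polynomial on $S^{d-1}$ normalized by $P_{4,d}(1)=1$; for $d\ge 3$, $P_{4,d}(t)=\dfrac{(d+2)(d+4)t^4-6(d+2)t^2+3}{(d-1)(d+1)}$. A positive-spectrum quartic kernel is $k=bP_{4,d}$ with $b\in(0,1)$ a fixed constant (all nonzero eigenvalues of its integral operator are positive). With $\mu_d$ the uniform probability measure on $S^{d-1}$, let $(Tf)(x)=\int k(\langle x,y\rangle)f(y)\,d\mu_d(y)$ on $L^2(\mu_d)$, and $h=\operatorname{tr}T^2$, $\delta=\operatorname{tr}T^3$, $\tau=\operatorname{tr}T^4$ (operator traces, eigenvalues counted with multiplicity). $P_k$ is the law of the random simple graph on $\{1,\dots,n\}$ obtained from independent uniform points $X_1,\dots,X_n\in S^{d-1}$ by including each edge $\{i,j\}$ conditionally independently with probability $(1+k(\langle X_i,X_j\rangle))/2$. $G(n,1/2)$ is the Erdős–Rényi law. $\operatorname{TV}(P,Q)=\sup_B|P(B)-Q(B)|$. *)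

theory Defs
  imports "HOL-Probability.Probability"
begin

text \<open>
  The dimension varies along a sequence, so \<open>\<real>\<^sup>d\<close> is modelled by the (extensional) functions on
  \<open>{..<d}\<close>, i.e. by the space of the product measure over \<open>{..<d}\<close>.
\<close>

definition inner_d :: "nat \<Rightarrow> (nat \<Rightarrow> real) \<Rightarrow> (nat \<Rightarrow> real) \<Rightarrow> real" where
  "inner_d d x y = (\<Sum>i<d. x i * y i)"

definition unit_ball_d :: "nat \<Rightarrow> (nat \<Rightarrow> real) set" where
  "unit_ball_d d = {x \<in> space (PiM {..<d} (\<lambda>_. lborel :: real measure)). inner_d d x x \<le> 1}"

definition normalize_d :: "nat \<Rightarrow> (nat \<Rightarrow> real) \<Rightarrow> (nat \<Rightarrow> real)" where
  "normalize_d d x = (\<lambda>i\<in>{..<d}. x i / sqrt (inner_d d x x))"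

text \<open>
  The normalized surface measure of the unit sphere, as the cone measure: the measure of \<open>A\<close> is the
  fraction of the volume of the unit ball lying in the cone over \<open>A\<close>.  It is a probability measure on
  the ambient space, concentrated on the sphere (the origin, which does not normalize to a unit
  vector, is a null set).
\<close>

definition unif_sphere :: "nat \<Rightarrow> (nat \<Rightarrow> real) measure" where
  "unif_sphere d =
     distr (uniform_measure (PiM {..<d} (\<lambda>_. lborel)) (unit_ball_d d))
           (PiM {..<d} (\<lambda>_. borel)) (normalize_d d)"

text \<open>
  The zonal spherical harmonic of degree four on the sphere in \<open>\<real>\<^sup>d\<close> (a Gegenbauer polynomial with
  parameter \<open>(d - 2) / 2\<close>), normalized to take the value 1 at 1; meaningful for \<open>d \<ge> 3\<close>.
\<close>

definition P4 :: "nat \<Rightarrow> real \<Rightarrow> real" where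
  "P4 d t = ((real d + 2) * (real d + 4) * t ^ 4 - 6 * (real d + 2) * t\<^sup>2 + 3)
            / ((real d - 1) * (real d + 1))"

definition kernel_op :: "nat \<Rightarrow> (real \<Rightarrow> real) \<Rightarrow> ((nat \<Rightarrow> real) \<Rightarrow> real) \<Rightarrow> (nat \<Rightarrow> real) \<Rightarrow> real" where
  "kernel_op d k f = (\<lambda>x. \<integral>y. k (inner_d d x y) * f y \<partial>unif_sphere d)"

text \<open>
  Operators on the real space \<open>L\<^sup>2(M)\<close> are given by their action on representatives; the eigenvalue
  equation is understood almost everywhere.
\<close>

definition eigenfunctions ::
  "'a measure \<Rightarrow> (('a \<Rightarrow> real) \<Rightarrow> 'a \<Rightarrow> real) \<Rightarrow> real \<Rightarrow> ('a \<Rightarrow> real) set" where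
  "eigenfunctions M A \<nu> =
     {f \<in> borel_measurable M. integrable M (\<lambda>x. (f x)\<^sup>2) \<and> (AE x in M. A f x = \<nu> * f x)}"

text \<open>
  The dimension of the eigenspace as a subspace of \<open>L\<^sup>2(M)\<close>, i.e. the largest size of an orthonormal
  family in it.  The supremum in \<^typ>\<open>nat\<close> is meaningful for finite-dimensional eigenspaces,
  hence for all nonzero eigenvalues of a compact operator.
\<close>

definition eigen_mult ::
  "'a measure \<Rightarrow> (('a \<Rightarrow> real) \<Rightarrow> 'a \<Rightarrow> real) \<Rightarrow> real \<Rightarrow> nat" where
  "eigen_mult M A \<nu> =
     Sup {r. \<exists>e :: nat \<Rightarrow> 'a \<Rightarrow> real.
             (\<forall>i<r. e i \<in> eigenfunctions M A \<nu>) \<and>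
             (\<forall>i<r. \<forall>j<r. (\<integral>x. e i x * e j x \<partial>M) = (if i = j then 1 else 0))}"

text \<open>
  For self-adjoint trace-class operators (all eigenvalues are then real): the sum of the eigenvalues,
  counted with multiplicity.
\<close>

definition op_trace :: "'a measure \<Rightarrow> (('a \<Rightarrow> real) \<Rightarrow> 'a \<Rightarrow> real) \<Rightarrow> real" where
  "op_trace M A = (\<Sum>\<^sub>\<infinity>\<nu>\<in>{\<nu>. \<nu> \<noteq> 0}. real (eigen_mult M A \<nu>) * \<nu>)"

definition tr_pow :: "nat \<Rightarrow> (real \<Rightarrow> real) \<Rightarrow> nat \<Rightarrow> real" where
  "tr_pow d k r = op_trace (unif_sphere d) (kernel_op d k ^^ r)"

text \<open>
  A simple graph on \<open>{1..n}\<close> is the set of its edges, the edge \<open>{i, j}\<close> being represented by the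
  pair \<open>(i, j)\<close> with \<open>i < j\<close>.
\<close>

definition vertex_pairs :: "nat \<Rightarrow> (nat \<times> nat) set" where
  "vertex_pairs n = {(i, j). 1 \<le> i \<and> i < j \<and> j \<le> n}"

definition indep_edges :: "nat \<Rightarrow> (nat \<times> nat \<Rightarrow> real) \<Rightarrow> (nat \<times> nat) set pmf" where
  "indep_edges n p =
     map_pmf (\<lambda>\<omega>. {e \<in> vertex_pairs n. \<omega> e})
       (Pi_pmf (vertex_pairs n) False (\<lambda>e. bernoulli_pmf (p e)))"

definition erdos_renyi_half :: "nat \<Rightarrow> (nat \<times> nat) set measure" where
  "erdos_renyi_half n = measure_pmf (indep_edges n (\<lambda>_. 1 / 2))"

definition kernel_graph :: "nat \<Rightarrow> nat \<Rightarrow> (real \<Rightarrow> real) \<Rightarrow> (nat \<times> nat) set measure" where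
  "kernel_graph n d k =
     PiM {1..n} (\<lambda>_. unif_sphere d) \<bind>
       (\<lambda>X. measure_pmf (indep_edges n (\<lambda>(i, j). (1 + k (inner_d d (X i) (X j))) / 2)))"

definition TV :: "'a measure \<Rightarrow> 'a measure \<Rightarrow> real" where
  "TV P Q = (SUP B\<in>sets P. \<bar>measure P B - measure Q B\<bar>)"

end

theory Submission
  imports Defs "HOL-Real_Asymp.Real_Asymp"
begin

text \<open>
  Why the theorem holds.  With \<open>N = d (d - 1) (d + 1) (d + 6) / 24\<close>, the dimension of the space of
  quartic harmonics, the zonal polynomial reproduces itself:
  \<open>\<integral> P4 \<langle>x, u\<rangle> P4 \<langle>u, z\<rangle> d\<mu>(u) = P4 \<langle>x, z\<rangle> / N\<close> (\<open>P4_reproducing\<close>).  Hence \<open>N P4\<close> is the kernel of an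
  orthogonal projection, whose rank is its constant diagonal value \<open>N\<close>, the only nonzero eigenvalue of
  \<open>T\<close> is \<open>b / N\<close>, and \<open>tr T^r = N (b / N)^r\<close> (\<open>tr_pow_P4\<close>).  Taking \<open>n\<close> to be \<open>g d N / b^2\<close> rounded up
  makes \<open>n h / d\<close> tend to \<open>g\<close>, while \<open>n^3 \<delta>^2\<close> and \<open>n^4 \<tau>^2\<close> behave like \<open>g^3 d^3 / N\<close> and
  \<open>g^4 d^4 / N^2\<close>, which vanish because \<open>N\<close> grows like \<open>d^4\<close>.

  The graph is detected information-theoretically: the \<open>n\<close> hidden points carry an entropy of order
  \<open>n d\<close>, and the edges carry information of order \<open>n^2 h\<close>, which is about \<open>g n d\<close>.  The test is the
  likelihood ratio \<open>L(A)\<close>, the average over independent uniform points \<open>y\<close> of the product of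
  \<open>1 + \<sigma>(i, j) k(y i, y j)\<close> over all pairs, where \<open>\<sigma> = 1\<close> on the edges of \<open>A\<close> and \<open>-1\<close> elsewhere.
  Under \<open>G(n, 1/2)\<close> it has mean one, so it exceeds \<open>s\<close> with probability at most \<open>1 / s\<close>.  If \<open>A\<close> was
  generated from hidden points \<open>X\<close>, then \<open>L(A)\<close> is exponentially large, because the average over \<open>y\<close>
  sees the points near \<open>X\<close>.  Nearness is expressed by the probability density
  \<open>q(x, y) = \<langle>x, y\<rangle>^(2 m) / c\<close> with \<open>m = 50 d\<close> instead of a net or a spherical cap: by the
  Funk--Hecke formula (\<open>Hecke_P4\<close>), averaging a quartic harmonic against \<open>q\<close> multiplies it by a factor
  \<open>\<rho> \<ge> 19/20\<close>, and passing from the uniform measure to the product of the \<open>q(X i, _)\<close> costs at most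
  a factor \<open>c^(-n) \<le> 2^(51 d n)\<close>.  Jensen's inequality then bounds \<open>ln L(A)\<close> from below by a sum over
  pairs, minus this cost (\<open>likelihood_lower_bound\<close>).  Each pair contributes \<open>(\<rho>^2 - 3/4) h \<ge> h / 8\<close>
  on average, the fluctuations of different pairs are uncorrelated, and Chebyshev's inequality
  (\<open>TV_lower_bound\<close>) shows that the sum beats the cost as soon as \<open>g\<close> exceeds an absolute constant.

  The reproducing property and the Funk--Hecke formula both come from the single identity
  \<open>E \<langle>U, a\<rangle>^(2 M) = c |a|^(2 M)\<close> for a uniform point \<open>U\<close> of the sphere (\<open>sphere_moment_linear\<close>),
  applied to \<open>a = x + s z\<close> and read off coefficientwise in \<open>s\<close>.  It is inherited from a Gaussian vector,
  whose direction is uniform and independent of its length.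
\<close>

section \<open>The uniform measure on the sphere in polar coordinates\<close>

lemma finite_PiM_density:
  fixes M :: "'i \<Rightarrow> 'a measure"
  assumes I: "finite I"
    and sf: "\<And>i. sigma_finite_measure (M i)"
    and sf': "\<And>i. sigma_finite_measure (density (M i) (f i))"
    and f: "\<And>i. f i \<in> borel_measurable (M i)"
  shows "PiM I (\<lambda>i. density (M i) (f i)) = density (PiM I M) (\<lambda>x. \<Prod>i\<in>I. f i (x i))"
proof -
  interpret product_sigma_finite M using sf by unfold_locales (auto simp: sigma_finite_measure_def)
  interpret D: product_sigma_finite "\<lambda>i. density (M i) (f i)" using sf' by unfold_locales (auto simp: sigma_finite_measure_def)
  note f[measurable]
  have meas: "(\<lambda>x. \<Prod>i\<in>I. f i (x i)) \<in> borel_measurable (PiM I M)"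
    by (intro borel_measurable_prod_ennreal) measurable
  show ?thesis
  proof (rule D.PiM_eqI[symmetric, OF I])
    show "sets (density (PiM I M) (\<lambda>x. \<Prod>i\<in>I. f i (x i))) = sets (PiM I (\<lambda>i. density (M i) (f i)))"
      by (simp cong: sets_PiM_cong)
  next
    fix A assume A: "\<And>i. i \<in> I \<Longrightarrow> A i \<in> sets (density (M i) (f i))"
    then have A'[measurable]: "i \<in> I \<Longrightarrow> A i \<in> sets (M i)" for i by simp
    have "emeasure (density (PiM I M) (\<lambda>x. \<Prod>i\<in>I. f i (x i))) (Pi\<^sub>E I A)
        = (\<integral>\<^sup>+x. (\<Prod>i\<in>I. f i (x i)) * indicator (Pi\<^sub>E I A) x \<partial>PiM I M)"
      using meas I A' by (intro emeasure_density) (auto intro!: sets_PiM_I_finite)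
    also have "\<dots> = (\<integral>\<^sup>+x. (\<Prod>i\<in>I. f i (x i) * indicator (A i) (x i)) \<partial>PiM I M)"
    proof (intro nn_integral_cong)
      fix x assume x: "x \<in> space (PiM I M)"
      have "indicator (Pi\<^sub>E I A) x = (\<Prod>i\<in>I. indicator (A i) (x i) :: ennreal)"
      proof (cases "x \<in> Pi\<^sub>E I A")
        case True
        then show ?thesis by (auto simp: PiE_def Pi_def)
      next
        case False
        with x obtain i where "i \<in> I" "x i \<notin> A i" by (auto simp: space_PiM PiE_def Pi_def)
        with False I show ?thesis by (auto intro!: prod_zero[symmetric] bexI[of _ i])
      qed
      then show "(\<Prod>i\<in>I. f i (x i)) * indicator (Pi\<^sub>E I A) x = (\<Prod>i\<in>I. f i (x i) * indicator (A i) (x i))"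
        by (simp add: prod.distrib)
    qed
    also have "\<dots> = (\<Prod>i\<in>I. \<integral>\<^sup>+x. f i x * indicator (A i) x \<partial>M i)"
      using I by (intro product_nn_integral_prod) auto
    also have "\<dots> = (\<Prod>i\<in>I. emeasure (density (M i) (f i)) (A i))"
      using A' by (intro prod.cong refl) (simp add: emeasure_density)
    finally show "emeasure (density (PiM I M) (\<lambda>x. \<Prod>i\<in>I. f i (x i))) (Pi\<^sub>E I A)
       = (\<Prod>i\<in>I. emeasure (density (M i) (f i)) (A i))" .
  qed
qed

abbreviation lebesgue_d :: "nat \<Rightarrow> (nat \<Rightarrow> real) measure" where
  "lebesgue_d d \<equiv> PiM {..<d} (\<lambda>_. lborel)"

abbreviation borel_d :: "nat \<Rightarrow> (nat \<Rightarrow> real) measure" where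
  "borel_d d \<equiv> PiM {..<d} (\<lambda>_. borel)"

lemma sets_lebesgue_d: "sets (lebesgue_d d) = sets (borel_d d)"
  by (rule sets_PiM_cong) auto

lemma measurable_lebesgue_d: "measurable (lebesgue_d d) N = measurable (borel_d d) N"
  by (rule measurable_cong_sets) (simp_all add: sets_lebesgue_d)

lemma inner_d_measurable [measurable]:
  "f \<in> measurable M (borel_d d) \<Longrightarrow> g \<in> measurable M (borel_d d) \<Longrightarrow>
     (\<lambda>x. inner_d d (f x) (g x)) \<in> borel_measurable M"
  unfolding inner_d_def
  by (intro borel_measurable_sum borel_measurable_times)
     (auto intro: measurable_compose[OF _ measurable_component_singleton])

lemma normalize_d_measurable [measurable]: "normalize_d d \<in> measurable (borel_d d) (borel_d d)"
proof -
  have [measurable]: "(\<lambda>x. inner_d d x x) \<in> borel_measurable (borel_d d)" by measurable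
  show ?thesis unfolding normalize_d_def
    by (intro measurable_restrict) measurable
qed

lemma emeasure_lborel_scale:
  assumes r: "(r::real) > 0" and A: "A \<in> sets lborel"
  shows "emeasure lborel {x. r * x \<in> A} = emeasure lborel A / ennreal r"
proof -
  have [measurable]: "A \<in> sets borel" using A by simp
  have "emeasure lborel {x. r * x \<in> A} = emeasure (distr lborel borel ((*) r)) A"
    by (simp add: emeasure_distr vimage_def)
  also have "\<dots> = inverse (ennreal r) * emeasure lborel A"
    using r by (simp add: lborel_distr_mult emeasure_density nn_integral_cmult inverse_ennreal)
  finally show ?thesis by (simp add: divide_ennreal_def mult.commute)
qed

definition scale_d :: "nat \<Rightarrow> real \<Rightarrow> (nat \<Rightarrow> real) \<Rightarrow> (nat \<Rightarrow> real)" where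
  "scale_d d r x = (\<lambda>i\<in>{..<d}. r * x i)"

lemma scale_d_measurable [measurable]: "scale_d d r \<in> measurable (borel_d d) (borel_d d)"
  unfolding scale_d_def by (intro measurable_restrict) measurable

text \<open>
  Homogeneity of Lebesgue measure.  Together with \<open>normalize_d_scale\<close> it makes the volume of a
  truncated cone a power of its radius, which is all that polar coordinates need.
\<close>

lemma lebesgue_d_scale:
  assumes r: "r > 0"
  shows "scale_measure (ennreal r ^ d) (distr (lebesgue_d d) (borel_d d) (scale_d d r)) = lebesgue_d d"
proof -
  interpret product_sigma_finite "\<lambda>_::nat. lborel :: real measure" by standard
  have [measurable]: "scale_d d r \<in> measurable (lebesgue_d d) (borel_d d)"
    by (simp add: measurable_lebesgue_d)
  show ?thesis
  proof (rule PiM_eqI)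
    show "sets (scale_measure (ennreal r ^ d) (distr (lebesgue_d d) (borel_d d) (scale_d d r))) = sets (lebesgue_d d)"
      by (simp add: sets_lebesgue_d)
  next
    fix A :: "nat \<Rightarrow> real set" assume A: "\<And>i. i \<in> {..<d} \<Longrightarrow> A i \<in> sets lborel"
    have AB: "Pi\<^sub>E {..<d} A \<in> sets (borel_d d)"
      using A by (intro sets_PiM_I_finite) auto
    have pre: "scale_d d r -` (Pi\<^sub>E {..<d} A) \<inter> space (lebesgue_d d) = Pi\<^sub>E {..<d} (\<lambda>i. {x. r * x \<in> A i})"
      by (auto simp: scale_d_def space_PiM PiE_def Pi_def extensional_def)
    have m: "{x. r * x \<in> A i} \<in> sets lborel" if "i < d" for i
      using A that measurable_sets[of "(*) r" borel borel "A i"] by (auto simp: vimage_def)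
    have "emeasure (distr (lebesgue_d d) (borel_d d) (scale_d d r)) (Pi\<^sub>E {..<d} A)
        = (\<Prod>i<d. emeasure lborel {x. r * x \<in> A i})"
    proof -
      have "emeasure (lebesgue_d d) (Pi\<^sub>E {..<d} (\<lambda>i. {x. r * x \<in> A i})) = (\<Prod>i<d. emeasure lborel {x. r * x \<in> A i})"
        using m by (intro emeasure_PiM) auto
      then show ?thesis using AB by (subst emeasure_distr) (auto simp: pre)
    qed
    also have "\<dots> = (\<Prod>i<d. inverse (ennreal r) * emeasure lborel (A i))"
      using A by (intro prod.cong refl) (simp add: emeasure_lborel_scale[OF r] divide_ennreal_def mult.commute[of "inverse (ennreal r)"])
    also have "\<dots> = inverse (ennreal r) ^ d * (\<Prod>i<d. emeasure lborel (A i))"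
      by (simp add: prod.distrib)
    finally show "emeasure (scale_measure (ennreal r ^ d) (distr (lebesgue_d d) (borel_d d) (scale_d d r))) (Pi\<^sub>E {..<d} A)
        = (\<Prod>i<d. emeasure lborel (A i))"
      using r by (simp add: mult.assoc[symmetric] power_mult_distrib[symmetric] ennreal_mult[symmetric] inverse_ennreal)
  qed simp
qed

lemma inner_d_scale: "inner_d d (scale_d d r x) (scale_d d r x) = r\<^sup>2 * inner_d d x x"
  by (simp add: inner_d_def scale_d_def sum_distrib_left power2_eq_square algebra_simps)

lemma normalize_d_scale: "r > 0 \<Longrightarrow> normalize_d d (scale_d d r x) = normalize_d d x"
proof -
  assume r: "r > 0"
  have "r * x i / sqrt (r\<^sup>2 * inner_d d x x) = x i / sqrt (inner_d d x x)" for i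
    using r by (simp add: real_sqrt_mult)
  then show ?thesis
    unfolding normalize_d_def inner_d_scale by (auto simp: scale_d_def restrict_def fun_eq_iff)
qed

lemma inner_d_nonneg: "inner_d d x x \<ge> 0"
  by (simp add: inner_d_def sum_nonneg)

text \<open>
  The part of the cone over \<open>A\<close> with squared radius at most \<open>s\<close>; squares are used because
  \<open>inner_d d x x\<close> is what the later radial weights depend on.
\<close>

definition cone_ball :: "nat \<Rightarrow> (nat \<Rightarrow> real) set \<Rightarrow> real \<Rightarrow> (nat \<Rightarrow> real) set" where
  "cone_ball d A s = {x \<in> space (lebesgue_d d). normalize_d d x \<in> A \<and> inner_d d x x \<le> s}"

lemma space_borel_d: "space (borel_d d) = space (lebesgue_d d)"
  by (simp add: space_PiM)

lemma cone_ball_sets: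
  assumes "A \<in> sets (borel_d d)"
  shows "cone_ball d A s \<in> sets (borel_d d)"
proof -
  note assms[measurable]
  have "{x \<in> space (borel_d d). normalize_d d x \<in> A \<and> inner_d d x x \<le> s} \<in> sets (borel_d d)"
    by measurable
  then show ?thesis by (simp add: cone_ball_def space_borel_d)
qed

lemma emeasure_cone_ball:
  assumes A: "A \<in> sets (borel_d d)" and s: "s > 0"
  shows "emeasure (lebesgue_d d) (cone_ball d A s) = ennreal (sqrt s) ^ d * emeasure (lebesgue_d d) (cone_ball d A 1)"
proof -
  have r: "sqrt s > 0" using s by simp
  have [measurable]: "scale_d d (sqrt s) \<in> measurable (lebesgue_d d) (borel_d d)"
    by (simp add: measurable_lebesgue_d)
  have "emeasure (lebesgue_d d) (cone_ball d A s)
      = emeasure (scale_measure (ennreal (sqrt s) ^ d) (distr (lebesgue_d d) (borel_d d) (scale_d d (sqrt s)))) (cone_ball d A s)"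
    using lebesgue_d_scale[OF r] by simp
  also have "\<dots> = ennreal (sqrt s) ^ d * emeasure (lebesgue_d d) (scale_d d (sqrt s) -` cone_ball d A s \<inter> space (lebesgue_d d))"
    using cone_ball_sets[OF A] by (simp add: emeasure_distr)
  also have "scale_d d (sqrt s) -` cone_ball d A s \<inter> space (lebesgue_d d) = cone_ball d A 1"
    using s r by (auto simp: cone_ball_def normalize_d_scale inner_d_scale)
      (auto simp: scale_d_def space_PiM)
  finally show ?thesis .
qed

lemma emeasure_cone_ball_0:
  assumes "d > 0" "s \<le> 0"
  shows "emeasure (lebesgue_d d) (cone_ball d A s) = 0"
proof -
  interpret product_sigma_finite "\<lambda>_::nat. lborel :: real measure" by standard
  have sub: "cone_ball d A s \<subseteq> Pi\<^sub>E {..<d} (\<lambda>_. {0})"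
  proof
    fix x assume x: "x \<in> cone_ball d A s"
    then have "(\<Sum>i<d. x i * x i) \<le> 0" using assms by (auto simp: cone_ball_def inner_d_def)
    then have "\<forall>i\<in>{..<d}. x i * x i = 0"
      using sum_nonneg[of "{..<d}" "\<lambda>i. x i * x i"] by (subst sum_nonneg_eq_0_iff[symmetric]) auto
    with x show "x \<in> Pi\<^sub>E {..<d} (\<lambda>_. {0})" by (auto simp: cone_ball_def space_PiM PiE_def extensional_def fun_eq_iff restrict_def)
  qed
  have "emeasure (lebesgue_d d) (Pi\<^sub>E {..<d} (\<lambda>_. {0})) = 0"
    using assms(1) by (subst emeasure_PiM) auto
  moreover have "Pi\<^sub>E {..<d} (\<lambda>_. {0}) \<in> sets (lebesgue_d d)" by (intro sets_PiM_I_finite) auto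
  ultimately show ?thesis using emeasure_mono[OF sub, of "lebesgue_d d"] by simp
qed

lemma unit_ball_d_eq: "unit_ball_d d = cone_ball d (space (borel_d d)) 1"
  by (auto simp: unit_ball_d_def cone_ball_def normalize_d_def space_PiM)

lemma unit_ball_d_measure:
  "emeasure (lebesgue_d d) (unit_ball_d d) \<noteq> 0" (is ?pos)
  "emeasure (lebesgue_d d) (unit_ball_d d) \<noteq> \<infinity>" (is ?fin)
proof -
  interpret product_sigma_finite "\<lambda>_::nat. lborel :: real measure" by standard
  have B: "unit_ball_d d \<in> sets (lebesgue_d d)"
    unfolding unit_ball_d_eq sets_lebesgue_d by (intro cone_ball_sets) auto
  have sub1: "Pi\<^sub>E {..<d} (\<lambda>_. {0..1 / real d}) \<subseteq> unit_ball_d d"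
  proof
    fix x assume x: "x \<in> Pi\<^sub>E {..<d} (\<lambda>_. {0..1 / real d})"
    have "(\<Sum>i<d. x i * x i) \<le> (\<Sum>i<d. 1 / real d)"
    proof (intro sum_mono)
      fix i assume i: "i \<in> {..<d}"
      then have "0 \<le> x i" "x i \<le> 1 / real d" "x i \<le> 1"
        using x by (auto simp: PiE_def Pi_def intro: order_trans[of _ "1 / real d"])
      then show "x i * x i \<le> 1 / real d" using mult_mono[of "x i" 1 "x i" "1 / real d"] by simp
    qed
    also have "\<dots> \<le> 1" by simp
    finally show "x \<in> unit_ball_d d" using x by (auto simp: unit_ball_d_def inner_d_def space_PiM)
  qed
  have "emeasure (lebesgue_d d) (Pi\<^sub>E {..<d} (\<lambda>_. {0..1 / real d})) = ennreal (1 / real d) ^ d"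
    by (subst emeasure_PiM) auto
  moreover have "ennreal (1 / real d) ^ d \<noteq> 0"
    by (cases "d = 0") auto
  ultimately show ?pos using emeasure_mono[OF sub1 B] by auto
  have sub2: "unit_ball_d d \<subseteq> Pi\<^sub>E {..<d} (\<lambda>_. {-1..1})"
  proof
    fix x assume x: "x \<in> unit_ball_d d"
    have "x i \<in> {-1..1}" if "i < d" for i
    proof -
      have "x i * x i \<le> (\<Sum>i<d. x i * x i)"
        using that by (intro member_le_sum) auto
      also have "\<dots> \<le> 1" using x by (auto simp: unit_ball_d_def inner_d_def)
      finally have "(x i)\<^sup>2 \<le> 1" by (simp add: power2_eq_square)
      then have "\<bar>x i\<bar> \<le> 1" by (simp add: abs_square_le_1)
      then show ?thesis by auto
    qed
    with x show "x \<in> Pi\<^sub>E {..<d} (\<lambda>_. {-1..1})" by (auto simp: unit_ball_d_def space_PiM PiE_def)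
  qed
  have "emeasure (lebesgue_d d) (Pi\<^sub>E {..<d} (\<lambda>_. {-1..1})) = (ennreal 2) ^ d"
    by (subst emeasure_PiM) auto
  also have "\<dots> < \<infinity>" by (simp add: power_eq_top_ennreal less_top[symmetric])
  moreover have "Pi\<^sub>E {..<d} (\<lambda>_. {-1..1::real}) \<in> sets (lebesgue_d d)" by (intro sets_PiM_I_finite) auto
  ultimately show ?fin using emeasure_mono[OF sub2, of "lebesgue_d d"] by (auto simp: top_unique)
qed

lemma unit_ball_d_sets: "unit_ball_d d \<in> sets (lebesgue_d d)"
  unfolding unit_ball_d_eq sets_lebesgue_d by (intro cone_ball_sets) auto

lemma sets_unif_sphere [simp, measurable_cong]: "sets (unif_sphere d) = sets (borel_d d)"
  by (simp add: unif_sphere_def)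

lemma space_unif_sphere: "space (unif_sphere d) = space (borel_d d)"
  by (simp add: unif_sphere_def)

lemma normalize_d_measurable': "normalize_d d \<in> measurable (uniform_measure (lebesgue_d d) B) (borel_d d)"
  using normalize_d_measurable[of d] measurable_lebesgue_d[of d "borel_d d"] by simp

lemma prob_space_unif_sphere: "prob_space (unif_sphere d)"
  unfolding unif_sphere_def
  using unit_ball_d_measure
  by (intro prob_space.prob_space_distr prob_space_uniform_measure normalize_d_measurable') auto

lemma emeasure_unif_sphere:
  assumes A: "A \<in> sets (borel_d d)"
  shows "emeasure (unif_sphere d) A = emeasure (lebesgue_d d) (cone_ball d A 1) / emeasure (lebesgue_d d) (unit_ball_d d)"
proof -
  have m: "normalize_d d \<in> measurable (lebesgue_d d) (borel_d d)" by (simp add: measurable_lebesgue_d)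
  have "emeasure (unif_sphere d) A = emeasure (uniform_measure (lebesgue_d d) (unit_ball_d d)) (normalize_d d -` A \<inter> space (lebesgue_d d))"
    unfolding unif_sphere_def using A by (subst emeasure_distr[OF normalize_d_measurable']) auto
  also have "\<dots> = emeasure (lebesgue_d d) (unit_ball_d d \<inter> (normalize_d d -` A \<inter> space (lebesgue_d d))) / emeasure (lebesgue_d d) (unit_ball_d d)"
    using measurable_sets[OF m A] unit_ball_d_sets by (intro emeasure_uniform_measure) auto
  also have "unit_ball_d d \<inter> (normalize_d d -` A \<inter> space (lebesgue_d d)) = cone_ball d A 1"
    by (auto simp: unit_ball_d_def cone_ball_def)
  finally show ?thesis .
qed

lemma emeasure_cone_ball_product:
  assumes A: "A \<in> sets (borel_d d)" and d: "d > 0"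
  shows "emeasure (lebesgue_d d) (cone_ball d A s) =
    emeasure (unif_sphere d) A * emeasure (lebesgue_d d) (cone_ball d (space (borel_d d)) s)"
proof (cases "s > 0")
  case True
  let ?V = "emeasure (lebesgue_d d) (unit_ball_d d)"
  have "emeasure (lebesgue_d d) (cone_ball d A 1) = emeasure (unif_sphere d) A * ?V"
    using unit_ball_d_measure[of d] by (simp add: emeasure_unif_sphere[OF A] ennreal_divide_times ennreal_divide_self less_top)
  then show ?thesis
    using emeasure_cone_ball[OF A True] emeasure_cone_ball[OF sets.top True, of d]
    by (simp add: unit_ball_d_eq mult.left_commute)
next
  case False
  then show ?thesis using emeasure_cone_ball_0[OF d, of s] by simp
qed

text \<open>
  Both measures on the line agree on the half-lines \<open>{..s}\<close>, where they are volumes of truncated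
  cones; so the direction and the length of a vector separate.
\<close>

lemma polar_radial:
  assumes A: "A \<in> sets (borel_d d)" and d: "d > 0"
  shows "distr (density (lebesgue_d d) (indicator {x\<in>space (borel_d d). normalize_d d x \<in> A})) borel (\<lambda>x. inner_d d x x)
      = scale_measure (emeasure (unif_sphere d) A) (distr (lebesgue_d d) borel (\<lambda>x. inner_d d x x))"
    (is "?L = ?R")
proof (rule measure_eqI_generator_eq[where E="range (\<lambda>s::real. {..s})" and \<Omega>=UNIV and A="\<lambda>n. {..real n}"])
  note A[measurable]
  interpret prob_space "unif_sphere d" by (rule prob_space_unif_sphere)
  have C: "{x\<in>space (borel_d d). normalize_d d x \<in> A} \<in> sets (lebesgue_d d)" unfolding sets_lebesgue_d by measurable
  have m: "(\<lambda>x. inner_d d x x) \<in> borel_measurable (lebesgue_d d)" unfolding measurable_lebesgue_d by measurable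
  have key: "emeasure ?L {..s} = emeasure (lebesgue_d d) (cone_ball d A s)" for s
  proof -
    have "emeasure ?L {..s} = emeasure (lebesgue_d d) ({x\<in>space (borel_d d). normalize_d d x \<in> A} \<inter> ((\<lambda>x. inner_d d x x) -` {..s} \<inter> space (lebesgue_d d)))"
      using C m measurable_sets[OF m, of "{..s}"] by (subst emeasure_distr) (auto simp: emeasure_restricted)
    also have "\<dots> = emeasure (lebesgue_d d) (cone_ball d A s)"
      by (rule arg_cong[where f="emeasure _"]) (auto simp: cone_ball_def space_borel_d)
    finally show ?thesis .
  qed
  have key2: "emeasure ?R {..s} = emeasure (unif_sphere d) A * emeasure (lebesgue_d d) (cone_ball d (space (borel_d d)) s)" for s
  proof -
    have "(\<lambda>x. inner_d d x x) -` {..s} \<inter> space (lebesgue_d d) = cone_ball d (space (borel_d d)) s"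
      by (auto simp: cone_ball_def space_PiM normalize_d_def)
    then show ?thesis using m by (simp add: emeasure_distr)
  qed
  show eq: "emeasure ?L X = emeasure ?R X" if "X \<in> range (\<lambda>s::real. {..s})" for X
    using that key key2 emeasure_cone_ball_product[OF A d] by auto
  show "Int_stable (range (\<lambda>s::real. {..s}))" by (auto simp: Int_stable_def)
  show "sets ?L = sigma_sets UNIV (range (\<lambda>s::real. {..s}))"
       "sets ?R = sigma_sets UNIV (range (\<lambda>s::real. {..s}))"
    by (auto simp: borel_eq_atMost[where 'a=real])
  show "(\<Union>n. {..real n}) = UNIV" using real_arch_simple by auto
  show "emeasure ?L {..real n} \<noteq> \<infinity>" for n
  proof (cases "n > 0")
    case True
    then have "emeasure (lebesgue_d d) (cone_ball d (space (borel_d d)) (real n)) \<noteq> \<infinity>"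
      using emeasure_cone_ball[OF sets.top, of "real n" d] unit_ball_d_measure(2)[of d]
      by (simp add: unit_ball_d_eq ennreal_mult_eq_top_iff ennreal_power)
    then show ?thesis unfolding key emeasure_cone_ball_product[OF A d]
      by (simp add: ennreal_mult_eq_top_iff)
  next
    case False
    then show ?thesis unfolding key using emeasure_cone_ball_0[OF d, of "real n"] by simp
  qed
qed auto

text \<open>
  Under every rotation-invariant density the direction of a vector follows the cone measure.  The
  density may have infinite mass, which is why the statement is about a scaled measure.
\<close>

lemma polar_decomposition:
  assumes d: "d > 0" and [measurable]: "\<phi> \<in> borel_measurable borel"
  shows "distr (density (lebesgue_d d) (\<lambda>x. \<phi> (inner_d d x x))) (borel_d d) (normalize_d d)
      = scale_measure (\<integral>\<^sup>+x. \<phi> (inner_d d x x) \<partial>lebesgue_d d) (unif_sphere d)"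
proof (rule measure_eqI)
  fix A assume "A \<in> sets (distr (density (lebesgue_d d) (\<lambda>x. \<phi> (inner_d d x x))) (borel_d d) (normalize_d d))"
  then have A[measurable]: "A \<in> sets (borel_d d)" by simp
  have m: "(\<lambda>x. inner_d d x x) \<in> borel_measurable (lebesgue_d d)" unfolding measurable_lebesgue_d by measurable
  have n: "normalize_d d \<in> measurable (lebesgue_d d) (borel_d d)" unfolding measurable_lebesgue_d by measurable
  note m[measurable] n[measurable]
  let ?C = "{x\<in>space (borel_d d). normalize_d d x \<in> A}"
  have C[measurable]: "?C \<in> sets (lebesgue_d d)" unfolding sets_lebesgue_d by measurable
  have "emeasure (distr (density (lebesgue_d d) (\<lambda>x. \<phi> (inner_d d x x))) (borel_d d) (normalize_d d)) A
      = emeasure (density (lebesgue_d d) (\<lambda>x. \<phi> (inner_d d x x))) (normalize_d d -` A \<inter> space (lebesgue_d d))"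
    using n by (subst emeasure_distr) auto
  also have "\<dots> = (\<integral>\<^sup>+x. \<phi> (inner_d d x x) * indicator (normalize_d d -` A \<inter> space (lebesgue_d d)) x \<partial>lebesgue_d d)"
    using measurable_sets[OF n A] by (intro emeasure_density) auto
  also have "\<dots> = (\<integral>\<^sup>+x. indicator ?C x * \<phi> (inner_d d x x) \<partial>lebesgue_d d)"
    by (intro nn_integral_cong) (auto simp: indicator_def space_borel_d)
  also have "\<dots> = (\<integral>\<^sup>+s. \<phi> s \<partial>distr (density (lebesgue_d d) (indicator ?C)) borel (\<lambda>x. inner_d d x x))"
    by (simp add: nn_integral_distr nn_integral_density)
  also have "\<dots> = emeasure (unif_sphere d) A * (\<integral>\<^sup>+x. \<phi> (inner_d d x x) \<partial>lebesgue_d d)"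
    unfolding polar_radial[OF A d] by (simp add: nn_integral_scale_measure nn_integral_distr)
  finally show "emeasure (distr (density (lebesgue_d d) (\<lambda>x. \<phi> (inner_d d x x))) (borel_d d) (normalize_d d)) A
      = emeasure (scale_measure (\<integral>\<^sup>+x. \<phi> (inner_d d x x) \<partial>lebesgue_d d) (unif_sphere d)) A"
    by (simp add: mult.commute)
qed simp

lemma nn_integral_polar:
  assumes d: "d > 0" and [measurable]: "\<phi> \<in> borel_measurable borel" "g \<in> borel_measurable (borel_d d)"
  shows "(\<integral>\<^sup>+x. \<phi> (inner_d d x x) * g (normalize_d d x) \<partial>lebesgue_d d)
       = (\<integral>\<^sup>+x. \<phi> (inner_d d x x) \<partial>lebesgue_d d) * (\<integral>\<^sup>+u. g u \<partial>unif_sphere d)"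
proof -
  have m: "(\<lambda>x. inner_d d x x) \<in> borel_measurable (lebesgue_d d)" unfolding measurable_lebesgue_d by measurable
  have n: "normalize_d d \<in> measurable (lebesgue_d d) (borel_d d)" unfolding measurable_lebesgue_d by measurable
  note m[measurable] n[measurable]
  have "(\<integral>\<^sup>+x. \<phi> (inner_d d x x) * g (normalize_d d x) \<partial>lebesgue_d d)
     = (\<integral>\<^sup>+u. g u \<partial>distr (density (lebesgue_d d) (\<lambda>x. \<phi> (inner_d d x x))) (borel_d d) (normalize_d d))"
    by (simp add: nn_integral_distr nn_integral_density)
  also have "\<dots> = (\<integral>\<^sup>+x. \<phi> (inner_d d x x) \<partial>lebesgue_d d) * (\<integral>\<^sup>+u. g u \<partial>unif_sphere d)"
    unfolding polar_decomposition[OF d assms(2)] by (simp add: nn_integral_scale_measure)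
  finally show ?thesis .
qed

section \<open>Gaussian vectors and even moments of linear forms\<close>

abbreviation gauss_d :: "nat \<Rightarrow> (nat \<Rightarrow> real) measure" where
  "gauss_d d \<equiv> PiM {..<d} (\<lambda>_. density lborel std_normal_density)"

lemma prob_space_std_normal: "prob_space (density lborel std_normal_density)"
  by (rule prob_space_normal_density) simp

lemma gauss_d_eq_density:
  "gauss_d d = density (lebesgue_d d) (\<lambda>x. ennreal ((1 / sqrt (2 * pi)) ^ d * exp (- inner_d d x x / 2)))"
proof -
  have "gauss_d d = density (lebesgue_d d) (\<lambda>x. \<Prod>i<d. ennreal (std_normal_density (x i)))"
    by (rule finite_PiM_density)
       (auto intro: lborel.sigma_finite_measure_axioms prob_space_imp_sigma_finite prob_space_std_normal)
  also have "(\<lambda>x. \<Prod>i<d. ennreal (std_normal_density (x i))) = (\<lambda>x. ennreal ((1 / sqrt (2 * pi)) ^ d * exp (- inner_d d x x / 2)))"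
  proof
    fix x :: "nat \<Rightarrow> real"
    have "(\<Prod>i<d. std_normal_density (x i)) = (1 / sqrt (2 * pi)) ^ d * (\<Prod>i<d. exp (- (x i)\<^sup>2 / 2))"
      unfolding std_normal_density_def by (simp add: prod.distrib power_divide prod_dividef)
    also have "(\<Prod>i<d. exp (- (x i)\<^sup>2 / 2)) = exp (- inner_d d x x / 2)"
      by (simp add: exp_sum[symmetric] inner_d_def sum_divide_distrib[symmetric] sum_negf power2_eq_square)
    finally show "(\<Prod>i<d. ennreal (std_normal_density (x i))) = ennreal ((1 / sqrt (2 * pi)) ^ d * exp (- inner_d d x x / 2))"
      by (simp add: prod_ennreal)
  qed
  finally show ?thesis .
qed

text \<open>
  A linear form in a standard Gaussian vector is a centred Gaussian variable with variance
  \<open>|a|^2\<close>.  Coordinates with \<open>a i = 0\<close> are discarded first, since a degenerate normal variable has no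
  density.
\<close>

lemma gaussian_linear_moment:
  "(\<integral>\<^sup>+x. ennreal ((inner_d d x a) ^ (2 * m)) \<partial>gauss_d d)
     = ennreal (fact (2 * m) / (2 ^ m * fact m) * inner_d d a a ^ m)"
proof -
  let ?N = "density lborel std_normal_density :: real measure"
  interpret product_prob_space "\<lambda>_. ?N" "{..<d}"
    by (simp add: product_prob_spaceI prob_space_std_normal)
  interpret P: prob_space "gauss_d d" by (intro prob_space_PiM prob_space_std_normal)
  define I where "I = {i\<in>{..<d}. a i \<noteq> 0}"
  have fin: "finite I" by (simp add: I_def)
  have sI: "inner_d d a a = (\<Sum>i\<in>I. (a i)\<^sup>2)"
    unfolding inner_d_def I_def by (intro sum.mono_neutral_cong_right) (auto simp: power2_eq_square)
  have xI: "inner_d d x a = (\<Sum>i\<in>I. a i * x i)" for x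
    unfolding inner_d_def I_def by (intro sum.mono_neutral_cong_right) auto
  show ?thesis
  proof (cases "I = {}")
    case True
    then show ?thesis by (cases "m = 0") (simp_all add: sI xI P.emeasure_space_1 power_0_left)
  next
    case False
    then have ne: "{..<d} \<noteq> {}" by (auto simp: I_def)
    have rv: "(\<lambda>x. x i) \<in> measurable (gauss_d d) ?N" if "i \<in> {..<d}" for i
      using that by (intro measurable_component_singleton)
    have comp: "distr (gauss_d d) ?N (\<lambda>x. x i) = ?N" if "i \<in> {..<d}" for i
      using distr_PiM_component[of "{..<d}" "\<lambda>_. ?N" i] that prob_space_std_normal by simp
    have "P.indep_vars (\<lambda>_. ?N) (\<lambda>i x. x i) {..<d}"
    proof (subst P.indep_vars_iff_distr_eq_PiM'[OF ne rv])
      have "distr (gauss_d d) (gauss_d d) (\<lambda>x. \<lambda>i\<in>{..<d}. x i) = distr (gauss_d d) (gauss_d d) (\<lambda>x. x)"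
        by (intro distr_cong refl) (auto simp: space_PiM)
      also have "\<dots> = gauss_d d" by (rule distr_id)
      also have "\<dots> = PiM {..<d} (\<lambda>i. distr (gauss_d d) ?N (\<lambda>x. x i))"
        by (intro PiM_cong refl) (simp add: comp)
      finally show "distr (gauss_d d) (gauss_d d) (\<lambda>x. \<lambda>i\<in>{..<d}. x i) = PiM {..<d} (\<lambda>i. distr (gauss_d d) ?N (\<lambda>x. x i))" .
    qed auto
    then have "P.indep_vars (\<lambda>_. borel) (\<lambda>i x. a i * x i) {..<d}"
      by (rule P.indep_vars_compose2) auto
    then have ind: "P.indep_vars (\<lambda>_. borel) (\<lambda>i x. a i * x i) I"
      by (rule P.indep_vars_subset) (auto simp: I_def)
    have norm: "distributed (gauss_d d) lborel (\<lambda>x. a i * x i) (normal_density 0 \<bar>a i\<bar>)" if i: "i \<in> I" for i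
    proof -
      have "distributed (gauss_d d) lborel (\<lambda>x. x i) std_normal_density"
        unfolding distributed_def
      proof (intro conjI)
        have "distr (gauss_d d) lborel (\<lambda>x. x i) = distr (gauss_d d) ?N (\<lambda>x. x i)"
          by (intro distr_cong) auto
        then show "distr (gauss_d d) lborel (\<lambda>x. x i) = ?N" using comp[of i] i by (auto simp: I_def)
        show "(\<lambda>x. x i) \<in> measurable (gauss_d d) lborel" using rv[of i] i by (simp add: I_def)
      qed auto
      from P.normal_density_affine[OF this, of "a i" 0] show ?thesis using i by (simp add: I_def)
    qed
    have s: "0 < inner_d d a a" unfolding sI using False fin by (intro sum_pos) (auto simp: I_def)
    have "distributed (gauss_d d) lborel (\<lambda>x. \<Sum>i\<in>I. a i * x i) (normal_density (\<Sum>i\<in>I. 0) (sqrt (\<Sum>i\<in>I. \<bar>a i\<bar>\<^sup>2)))"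
      by (rule P.sum_indep_normal[OF fin False ind _ norm]) (auto simp: I_def)
    then have D: "distributed (gauss_d d) lborel (\<lambda>x. inner_d d x a) (normal_density 0 (sqrt (inner_d d a a)))"
      unfolding sI by (simp add: xI)
    have "(\<integral>\<^sup>+x. ennreal ((inner_d d x a) ^ (2 * m)) \<partial>gauss_d d)
       = (\<integral>\<^sup>+x. ennreal (normal_density 0 (sqrt (inner_d d a a)) x) * ennreal (x ^ (2 * m)) \<partial>lborel)"
      by (rule distributed_nn_integral[OF D, symmetric]) auto
    also have "\<dots> = (\<integral>\<^sup>+x. ennreal (normal_density 0 (sqrt (inner_d d a a)) x * (x - 0) ^ (2 * m)) \<partial>lborel)"
      by (simp add: ennreal_mult)
    also have "\<dots> = ennreal (\<integral>x. normal_density 0 (sqrt (inner_d d a a)) x * (x - 0) ^ (2 * m) \<partial>lborel)"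
      using s by (intro nn_integral_eq_integral integrable_normal_moment) auto
    also have "(\<integral>x. normal_density 0 (sqrt (inner_d d a a)) x * (x - 0) ^ (2 * m) \<partial>lborel)
        = fact (2 * m) / ((2 / (sqrt (inner_d d a a))\<^sup>2) ^ m * fact m)"
      using s by (intro integral_normal_moment_even) auto
    also have "\<dots> = fact (2 * m) / (2 ^ m * fact m) * inner_d d a a ^ m"
      using s by (simp add: power_divide)
    finally show ?thesis .
  qed
qed

text \<open>
  The constant \<open>c\<close> in \<open>E \<langle>U, a\<rangle>^(2 m) = c |a|^(2 m)\<close>, obtained from the first unit vector.
\<close>

definition sphere_moment :: "nat \<Rightarrow> nat \<Rightarrow> real" where
  "sphere_moment d m = (\<integral>u. u 0 ^ (2 * m) \<partial>unif_sphere d)"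

lemma inner_d_normalize: "inner_d d (normalize_d d x) a = inner_d d x a / sqrt (inner_d d x x)"
  by (simp add: inner_d_def normalize_d_def sum_divide_distrib)

lemma inner_d_commute: "inner_d d x y = inner_d d y x"
  by (simp add: inner_d_def mult.commute)

lemma inner_d_eq_0_iff: "inner_d d x x = 0 \<longleftrightarrow> (\<forall>i<d. x i = 0)"
  unfolding inner_d_def by (subst sum_nonneg_eq_0_iff) auto

lemma AE_unif_sphere:
  assumes "d > 0"
  shows "AE u in unif_sphere d. inner_d d u u = 1"
proof (rule AE_I')
  let ?A = "{u \<in> space (borel_d d). inner_d d u u \<noteq> 1}"
  have A: "?A \<in> sets (borel_d d)" by measurable
  have sub: "cone_ball d ?A 1 \<subseteq> cone_ball d (space (borel_d d)) 0"
  proof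
    fix x assume "x \<in> cone_ball d ?A 1"
    then have x: "x \<in> space (lebesgue_d d)" "normalize_d d x \<in> space (borel_d d)"
      and "inner_d d (normalize_d d x) (normalize_d d x) \<noteq> 1"
      by (auto simp: cone_ball_def)
    then have "inner_d d x x = 0"
      by (auto simp: inner_d_normalize inner_d_commute[of d x "normalize_d d x"] inner_d_nonneg split: if_splits)
    with x show "x \<in> cone_ball d (space (borel_d d)) 0" by (simp add: cone_ball_def)
  qed
  have "cone_ball d (space (borel_d d)) 0 \<in> sets (lebesgue_d d)"
    unfolding sets_lebesgue_d by (intro cone_ball_sets) auto
  then have "emeasure (lebesgue_d d) (cone_ball d ?A 1) = 0"
    using emeasure_mono[OF sub] emeasure_cone_ball_0[OF assms, of 0] by fastforce
  then show "?A \<in> null_sets (unif_sphere d)"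
    using A by (intro null_setsI) (auto simp: emeasure_unif_sphere)
  show "{u \<in> space (unif_sphere d). inner_d d u u \<noteq> 1} \<subseteq> ?A" by (simp add: space_unif_sphere)
qed

lemma Cauchy_Schwarz_inner_d: "\<bar>inner_d d x y\<bar> \<le> sqrt (inner_d d x x) * sqrt (inner_d d y y)"
proof -
  have "(inner_d d x y)\<^sup>2 \<le> inner_d d x x * inner_d d y y"
    using Cauchy_Schwarz_ineq_sum[of x y "{..<d}"] by (simp add: inner_d_def power2_eq_square)
  then have "sqrt ((inner_d d x y)\<^sup>2) \<le> sqrt (inner_d d x x * inner_d d y y)" by (rule real_sqrt_le_mono)
  then show ?thesis by (simp add: real_sqrt_mult)
qed

lemma integrable_inner_power:
  assumes d: "d > 0"
  shows "integrable (unif_sphere d) (\<lambda>u. inner_d d u a ^ j * inner_d d u b ^ k)"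
proof -
  interpret prob_space "unif_sphere d" by (rule prob_space_unif_sphere)
  show ?thesis
  proof (rule integrable_const_bound[where B="sqrt (inner_d d a a) ^ j * sqrt (inner_d d b b) ^ k"])
    show "AE u in unif_sphere d. norm (inner_d d u a ^ j * inner_d d u b ^ k) \<le> sqrt (inner_d d a a) ^ j * sqrt (inner_d d b b) ^ k"
      using AE_unif_sphere[OF d]
    proof eventually_elim
      case (elim u)
      have "\<bar>inner_d d u a\<bar> \<le> sqrt (inner_d d a a)" "\<bar>inner_d d u b\<bar> \<le> sqrt (inner_d d b b)"
        using Cauchy_Schwarz_inner_d[of d u a] Cauchy_Schwarz_inner_d[of d u b] elim by auto
      then show ?case by (auto simp: abs_mult power_abs inner_d_nonneg intro!: mult_mono power_mono)
    qed
    have [measurable]: "(\<lambda>u. inner_d d u a) \<in> borel_measurable (borel_d d)" for a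
      unfolding inner_d_def by measurable
    show "(\<lambda>u. inner_d d u a ^ j * inner_d d u b ^ k) \<in> borel_measurable (unif_sphere d)"
      by measurable
  qed
qed

text \<open>
  Writing a Gaussian vector as length times direction factors its moment as
  \<open>E \<langle>G, a\<rangle>^(2 m) = E |G|^(2 m) E \<langle>U, a\<rangle>^(2 m)\<close>.  The left side depends on \<open>a\<close> only through \<open>|a|\<close>, and the
  radial moment cancels against the same identity for a unit vector, so it is never computed.
\<close>

theorem sphere_moment_linear:
  assumes d: "d > 0"
  shows "(\<integral>u. inner_d d u a ^ (2 * m) \<partial>unif_sphere d) = sphere_moment d m * inner_d d a a ^ m"
proof -
  interpret prob_space "unif_sphere d" by (rule prob_space_unif_sphere)
  define \<phi> where "\<phi> = (\<lambda>s. ennreal ((1 / sqrt (2 * pi)) ^ d * exp (- s / 2)) * ennreal (s ^ m))"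
  define R where "R = (\<integral>\<^sup>+x. \<phi> (inner_d d x x) \<partial>lebesgue_d d)"
  let ?c = "fact (2 * m) / (2 ^ m * fact m) :: real"
  have [measurable]: "\<phi> \<in> borel_measurable borel" unfolding \<phi>_def by measurable
  have m: "(\<lambda>x. inner_d d x a) \<in> borel_measurable (borel_d d)" for a
    unfolding inner_d_def by measurable
  note m[measurable]
  have m': "(\<lambda>x. inner_d d x a) \<in> borel_measurable (lebesgue_d d)" for a
    using m[of a] by (simp add: measurable_lebesgue_d)
  have m'': "(\<lambda>x. inner_d d x x) \<in> borel_measurable (lebesgue_d d)" unfolding measurable_lebesgue_d by measurable
  note m'[measurable] m''[measurable]
  have nn: "(\<integral>\<^sup>+u. ennreal (inner_d d u a ^ (2 * m)) \<partial>unif_sphere d) = ennreal (\<integral>u. inner_d d u a ^ (2 * m) \<partial>unif_sphere d)" for a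
    using integrable_inner_power[OF d, of a "2 * m" a 0] by (intro nn_integral_eq_integral) auto
  have key: "R * ennreal (\<integral>u. inner_d d u a ^ (2 * m) \<partial>unif_sphere d) = ennreal (?c * inner_d d a a ^ m)" for a
  proof -
    have "ennreal (?c * inner_d d a a ^ m) = (\<integral>\<^sup>+x. ennreal ((inner_d d x a) ^ (2 * m)) \<partial>gauss_d d)"
      by (rule gaussian_linear_moment[symmetric])
    also have "\<dots> = (\<integral>\<^sup>+x. ennreal ((1 / sqrt (2 * pi)) ^ d * exp (- inner_d d x x / 2)) * ennreal ((inner_d d x a) ^ (2 * m)) \<partial>lebesgue_d d)"
      unfolding gauss_d_eq_density by (subst nn_integral_density) auto
    also have "\<dots> = (\<integral>\<^sup>+x. \<phi> (inner_d d x x) * ennreal (inner_d d (normalize_d d x) a ^ (2 * m)) \<partial>lebesgue_d d)"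
    proof (intro nn_integral_cong)
      fix x
      have "inner_d d x a ^ (2 * m) = inner_d d x x ^ m * inner_d d (normalize_d d x) a ^ (2 * m)"
      proof (cases "inner_d d x x = 0")
        case True
        then have "inner_d d x a = 0" by (simp add: inner_d_eq_0_iff) (simp add: inner_d_def)
        then show ?thesis using True by (cases "m = 0") (auto simp: power_0_left)
      next
        case False
        then show ?thesis using inner_d_nonneg[of d x]
          by (simp add: inner_d_normalize power_divide power_mult)
      qed
      then show "ennreal ((1 / sqrt (2 * pi)) ^ d * exp (- inner_d d x x / 2)) * ennreal ((inner_d d x a) ^ (2 * m))
          = \<phi> (inner_d d x x) * ennreal (inner_d d (normalize_d d x) a ^ (2 * m))"
        unfolding \<phi>_def by (simp add: ennreal_mult inner_d_nonneg mult.assoc)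
    qed
    also have "\<dots> = R * (\<integral>\<^sup>+u. ennreal (inner_d d u a ^ (2 * m)) \<partial>unif_sphere d)"
      unfolding R_def by (rule nn_integral_polar[OF d]) measurable
    finally show ?thesis unfolding nn by simp
  qed
  define e :: "nat \<Rightarrow> real" where "e = (\<lambda>i. if i = 0 then 1 else 0)"
  have e: "inner_d d u e = u 0" for u
  proof -
    have "inner_d d u e = (\<Sum>i<d. if i = 0 then u i else 0)"
      unfolding inner_d_def e_def by (intro sum.cong) auto
    then show ?thesis using d by simp
  qed
  have c: "?c > 0" by simp
  have "R * ennreal (sphere_moment d m) = ennreal ?c"
    using key[of e] by (simp add: e sphere_moment_def) (simp add: e_def)
  moreover have "sphere_moment d m \<ge> 0" unfolding sphere_moment_def by simp
  \<comment> \<open>A finite nonzero product forces the radial moment \<open>R\<close> to be finite and nonzero.\<close>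
  ultimately have R: "R \<noteq> 0" "R \<noteq> \<infinity>"
    using c by (auto simp: ennreal_top_mult split: if_splits)
  then obtain r where r: "R = ennreal r" "r > 0"
    by (cases R) (auto simp: less_le)
  have "r * sphere_moment d m = ?c"
    using \<open>R * ennreal (sphere_moment d m) = ennreal ?c\<close> r c \<open>sphere_moment d m \<ge> 0\<close>
    by (simp add: ennreal_mult[symmetric])
  moreover have "r * (\<integral>u. inner_d d u a ^ (2 * m) \<partial>unif_sphere d) = ?c * inner_d d a a ^ m"
  proof -
    have "(\<integral>u. inner_d d u a ^ (2 * m) \<partial>unif_sphere d) \<ge> 0" by simp
    then show ?thesis using key[of a] r c inner_d_nonneg[of d a] by (simp add: ennreal_mult[symmetric])
  qed
  ultimately have "r * (\<integral>u. inner_d d u a ^ (2 * m) \<partial>unif_sphere d) = r * (sphere_moment d m * inner_d d a a ^ m)"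
    by (simp only: mult.assoc[symmetric])
  then show ?thesis using r by simp
qed

section \<open>The Funk--Hecke formula for the quartic harmonic\<close>

lemma inner_d_measurable1 [measurable]: "(\<lambda>u. inner_d d u a) \<in> borel_measurable (borel_d d)"
  unfolding inner_d_def by measurable

text \<open>
  Polarization: both sides of \<open>E \<langle>U, a + s b\<rangle>^(2 M) = c |a + s b|^(2 M)\<close> are polynomials in \<open>s\<close>, and
  the lemma compares their coefficients.
\<close>

lemma mixed_moment:
  assumes d: "d > 0" and k: "k \<le> 2 * M"
  shows "real (2 * M choose k) * (\<integral>u. inner_d d u a ^ (2 * M - k) * inner_d d u b ^ k \<partial>unif_sphere d)
      = sphere_moment d M * coeff ([:inner_d d a a, 2 * inner_d d a b, inner_d d b b:] ^ M) k"
proof -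
  define I where "I = (\<lambda>k. \<integral>u. inner_d d u a ^ (2 * M - k) * inner_d d u b ^ k \<partial>unif_sphere d)"
  define p where "p = (\<Sum>k\<le>2 * M. monom (real (2 * M choose k) * I k) k)"
  define q where "q = smult (sphere_moment d M) ([:inner_d d a a, 2 * inner_d d a b, inner_d d b b:] ^ M)"
  have "poly p s = poly q s" for s
  proof -
    let ?c = "\<lambda>i. s * b i + a i"
    have lin: "inner_d d u ?c = s * inner_d d u b + inner_d d u a" for u
      by (simp add: inner_d_def sum_distrib_left sum.distrib algebra_simps)
    have quad: "inner_d d ?c ?c = inner_d d a a + s * (2 * inner_d d a b + s * inner_d d b b)"
      by (simp add: inner_d_def sum_distrib_left sum.distrib[symmetric] algebra_simps)
    have "poly q s = sphere_moment d M * inner_d d ?c ?c ^ M"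
      unfolding quad by (simp add: q_def poly_power mult.commute)
    also have "\<dots> = (\<integral>u. (s * inner_d d u b + inner_d d u a) ^ (2 * M) \<partial>unif_sphere d)"
      using sphere_moment_linear[OF d, of ?c M] by (simp add: lin)
    also have "\<dots> = (\<integral>u. (\<Sum>k\<le>2 * M. real (2 * M choose k) * s ^ k * (inner_d d u a ^ (2 * M - k) * inner_d d u b ^ k)) \<partial>unif_sphere d)"
      by (simp add: binomial_ring power_mult_distrib mult_ac)
    also have "\<dots> = (\<Sum>k\<le>2 * M. real (2 * M choose k) * s ^ k * I k)"
      unfolding I_def by (subst Bochner_Integration.integral_sum) (auto intro!: integrable_inner_power[OF d])
    also have "\<dots> = poly p s"
      by (simp add: p_def poly_sum poly_monom mult_ac)
    finally show ?thesis by simp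
  qed
  then have "p = q" by (simp add: poly_eq_poly_eq_iff[symmetric] fun_eq_iff)
  then have "coeff p k = coeff q k" by simp
  moreover have "coeff p k = real (2 * M choose k) * I k"
    using k by (simp add: p_def coeff_sum)
  ultimately show ?thesis by (simp add: q_def I_def)
qed

lemma coeff_palindromic_quadratic_power:
  fixes t :: real
  defines "T \<equiv> [:1, 2 * t, 1:]"
  shows "coeff (T ^ M) 0 = 1"
    and "coeff (T ^ M) 1 = 2 * real M * t"
    and "coeff (T ^ M) 2 = real M + 2 * real M * (real M - 1) * t\<^sup>2"
    and "coeff (T ^ M) 3 = 2 * real M * (real M - 1) * t + 4 / 3 * real M * (real M - 1) * (real M - 2) * t ^ 3"
    and "coeff (T ^ M) 4 = real M * (real M - 1) / 2 + 2 * real M * (real M - 1) * (real M - 2) * t\<^sup>2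
           + 2 / 3 * real M * (real M - 1) * (real M - 2) * (real M - 3) * t ^ 4"
proof (induction M)
  case 0
  case 1 show ?case by simp
  case 2 show ?case by simp
  case 3 show ?case by simp
  case 4 show ?case by simp
  case 5 show ?case by simp
next
  case (Suc M)
  note simps = coeff_pCons numeral_eq_Suc power2_eq_square field_simps
  have rec: "coeff (T ^ Suc M) (Suc (Suc n)) = coeff (T ^ M) (Suc (Suc n)) + 2 * t * coeff (T ^ M) (Suc n) + coeff (T ^ M) n" for n
    by (simp add: T_def)
  have rec1: "coeff (T ^ Suc M) 1 = coeff (T ^ M) 1 + 2 * t * coeff (T ^ M) 0"
    by (simp add: T_def)
  case 1 show ?case using Suc.IH(1) by (simp add: T_def)
  case 2 show ?case unfolding rec1 Suc.IH(1,2) by (simp add: algebra_simps)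
  case 3 show ?case using rec[of 0] Suc.IH(1-3) by (simp add: numeral_2_eq_2 algebra_simps power2_eq_square)
  case 4 show ?case using rec[of 1] Suc.IH(2-4)
    by (simp add: eval_nat_numeral) (simp add: field_simps)
  case 5 show ?case using rec[of 2] Suc.IH(3-5)
    by (simp add: eval_nat_numeral) (simp add: field_simps)
qed

lemma sphere_moment_0: "sphere_moment d 0 = 1"
proof -
  interpret prob_space "unif_sphere d" by (rule prob_space_unif_sphere)
  show ?thesis by (simp add: sphere_moment_def prob_space)
qed

text \<open>
  The Laplacian of \<open>E \<langle>U, a\<rangle>^(2 m + 2) = c |a|^(2 m + 2)\<close> at a unit vector \<open>a\<close>: the second-order
  coefficients in the coordinate directions are summed, using \<open>|U| = 1\<close> on the left.
\<close>

lemma sphere_moment_Suc: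
  assumes d: "d > 0"
  shows "(real d + 2 * real m) * sphere_moment d (Suc m) = (2 * real m + 1) * sphere_moment d m"
proof -
  define e :: "nat \<Rightarrow> nat \<Rightarrow> real" where "e = (\<lambda>j i. if i = j then 1 else 0)"
  have e: "inner_d d u (e j) = u j" if "j < d" for j u
  proof -
    have "inner_d d u (e j) = (\<Sum>i<d. if i = j then u i else 0)"
      unfolding inner_d_def e_def by (intro sum.cong) auto
    then show ?thesis using that by simp
  qed
  let ?M = "Suc m"
  have "real (2 * ?M choose 2) * (\<integral>u. u 0 ^ (2 * m) * u j ^ 2 \<partial>unif_sphere d)
      = sphere_moment d ?M * (real ?M + 2 * real ?M * real m * (if j = 0 then 1 else 0))" if j: "j < d" for j
  proof -
    have "inner_d d (e 0) (e j) = (if j = 0 then 1 else 0)" using e[OF j, of "e 0"] by (simp add: e_def)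
    moreover have "inner_d d (e 0) (e 0) = 1" "inner_d d (e j) (e j) = 1"
      using e[OF j, of "e j"] e[OF d, of "e 0"] by (simp_all add: e_def)
    ultimately have "real (2 * ?M choose 2) * (\<integral>u. inner_d d u (e 0) ^ (2 * ?M - 2) * inner_d d u (e j) ^ 2 \<partial>unif_sphere d)
      = sphere_moment d ?M * coeff ([:1, 2 * (if j = 0 then 1 else 0), 1:] ^ ?M) 2"
      using mixed_moment[OF d, of 2 ?M "e 0" "e j"] by (simp del: power_Suc)
    then show ?thesis unfolding coeff_palindromic_quadratic_power e[OF j] e[OF d] by simp
  qed
  then have "(\<Sum>j<d. real (2 * ?M choose 2) * (\<integral>u. u 0 ^ (2 * m) * u j ^ 2 \<partial>unif_sphere d))
     = (\<Sum>j<d. sphere_moment d ?M * (real ?M + 2 * real ?M * real m * (if j = 0 then 1 else 0)))"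
    by (intro sum.cong) auto
  also have "\<dots> = sphere_moment d ?M * real ?M * (real d + 2 * real m)"
    using d by (simp add: sum.distrib sum_distrib_left[symmetric]) (simp add: algebra_simps)
  also have "(\<Sum>j<d. real (2 * ?M choose 2) * (\<integral>u. u 0 ^ (2 * m) * u j ^ 2 \<partial>unif_sphere d))
     = real (2 * ?M choose 2) * (\<Sum>j<d. (\<integral>u. u 0 ^ (2 * m) * u j ^ 2 \<partial>unif_sphere d))"
    by (simp add: sum_distrib_left)
  also have "(\<Sum>j<d. (\<integral>u. u 0 ^ (2 * m) * u j ^ 2 \<partial>unif_sphere d))
     = (\<integral>u. (\<Sum>j<d. u 0 ^ (2 * m) * u j ^ 2) \<partial>unif_sphere d)"
  proof (rule Bochner_Integration.integral_sum[symmetric])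
    fix j assume "j \<in> {..<d}"
    then show "integrable (unif_sphere d) (\<lambda>u. u 0 ^ (2 * m) * u j ^ 2)"
      using integrable_inner_power[OF d, of "e 0" "2 * m" "e j" 2] by (simp add: e d)
  qed
  also have "\<dots> = (\<integral>u. u 0 ^ (2 * m) \<partial>unif_sphere d)"
  proof (rule integral_cong_AE)
    have [measurable]: "(\<lambda>u. u j) \<in> borel_measurable (borel_d d)" if "j < d" for j
      using that by (intro measurable_component_singleton) auto
    show "(\<lambda>u. \<Sum>j<d. u 0 ^ (2 * m) * u j ^ 2) \<in> borel_measurable (unif_sphere d)"
      using d by (intro borel_measurable_sum borel_measurable_times borel_measurable_power) auto
    show "(\<lambda>u. u 0 ^ (2 * m)) \<in> borel_measurable (unif_sphere d)"
      using d by measurable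
    show "AE u in unif_sphere d. (\<Sum>j<d. u 0 ^ (2 * m) * u j ^ 2) = u 0 ^ (2 * m)"
      using AE_unif_sphere[OF d]
      by eventually_elim (simp add: sum_distrib_left[symmetric] inner_d_def power2_eq_square)
  qed
  also have "\<dots> = sphere_moment d m" by (simp add: sphere_moment_def)
  also have "real (2 * ?M choose 2) = real ?M * (2 * real m + 1)"
    by (simp add: choose_two field_simps)
  finally have "real ?M * ((real d + 2 * real m) * sphere_moment d ?M) = real ?M * ((2 * real m + 1) * sphere_moment d m)"
    by (simp only: mult_ac)
  then show ?thesis by (subst (asm) mult_cancel_left) (auto simp del: of_nat_Suc)
qed

lemma P4_expand:
  "P4 d t = (real d + 2) * (real d + 4) / ((real d - 1) * (real d + 1)) * t ^ 4
     - 6 * (real d + 2) / ((real d - 1) * (real d + 1)) * t\<^sup>2 + 3 / ((real d - 1) * (real d + 1))"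
  by (simp only: P4_def add_divide_distrib diff_divide_distrib times_divide_eq_left)

context
  fixes d :: nat and x z :: "nat \<Rightarrow> real"
  assumes d: "d \<ge> 3" and x: "inner_d d x x = 1" and z: "inner_d d z z = 1"
begin

lemma mixed_moment_2:
  "(\<integral>u. inner_d d u x ^ (2 * m) * inner_d d u z ^ 2 \<partial>unif_sphere d)
     = sphere_moment d m * (1 + 2 * real m * (inner_d d x z)\<^sup>2) / (real d + 2 * real m)"
    (is "?I = _")
proof -
  have "real (2 * Suc m choose 2) * ?I = sphere_moment d (Suc m) * coeff ([:1, 2 * inner_d d x z, 1:] ^ Suc m) 2"
    using mixed_moment[of d 2 "Suc m" x z] d by (simp add: x z del: power_Suc)
  moreover have "real (2 * Suc m choose 2) = real (Suc m) * (2 * real m + 1)"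
    by (simp add: choose_two field_simps)
  ultimately have "real (Suc m) * ((2 * real m + 1) * ?I) = real (Suc m) * (sphere_moment d (Suc m) * (1 + 2 * real m * (inner_d d x z)\<^sup>2))"
    unfolding coeff_palindromic_quadratic_power by (simp add: algebra_simps)
  then have "(2 * real m + 1) * ?I = sphere_moment d (Suc m) * (1 + 2 * real m * (inner_d d x z)\<^sup>2)"
    by (simp del: of_nat_Suc)
  moreover have "sphere_moment d (Suc m) = (2 * real m + 1) * sphere_moment d m / (real d + 2 * real m)"
    using sphere_moment_Suc[of d m] d by (simp add: field_simps)
  ultimately have "(2 * real m + 1) * ?I = (2 * real m + 1) * (sphere_moment d m * (1 + 2 * real m * (inner_d d x z)\<^sup>2) / (real d + 2 * real m))"
    by simp
  then show ?thesis by (subst (asm) mult_cancel_left) auto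
qed

lemma mixed_moment_4:
  "(\<integral>u. inner_d d u x ^ (2 * m) * inner_d d u z ^ 4 \<partial>unif_sphere d)
     = sphere_moment d m * (3 + 12 * real m * (inner_d d x z)\<^sup>2 + 4 * real m * (real m - 1) * inner_d d x z ^ 4)
        / ((real d + 2 * real m) * (real d + 2 * real m + 2))"
    (is "?I = sphere_moment d m * ?P / _")
proof -
  let ?M = "Suc (Suc m)" and ?K = "real (Suc (Suc m)) * real (Suc m) / 6"
  have "real (2 * ?M choose 4) * ?I = sphere_moment d ?M * coeff ([:1, 2 * inner_d d x z, 1:] ^ ?M) 4"
    using mixed_moment[of d 4 ?M x z] d by (simp add: x z del: power_Suc)
  moreover have "real (2 * ?M choose 4) = ?K * ((2 * real m + 3) * (2 * real m + 1))"
  proof -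
    have "real (2 * ?M choose 4) = (\<Prod>i = 0..<4. real (2 * ?M) - real i) / fact 4"
      by (simp only: binomial_gbinomial gbinomial_prod_rev)
    then show ?thesis by (simp add: eval_nat_numeral) (simp add: field_simps)
  qed
  moreover have "coeff ([:1, 2 * inner_d d x z, 1:] ^ ?M) 4 = ?K * ?P"
    unfolding coeff_palindromic_quadratic_power by (simp add: field_simps)
  ultimately have "?K * ((2 * real m + 3) * (2 * real m + 1) * ?I) = ?K * (sphere_moment d ?M * ?P)"
    by (simp only: mult_ac)
  then have eq: "(2 * real m + 3) * (2 * real m + 1) * ?I = sphere_moment d ?M * ?P"
    by (subst (asm) mult_cancel_left) (auto simp del: of_nat_Suc)
  have "sphere_moment d (Suc m) = (2 * real m + 1) * sphere_moment d m / (real d + 2 * real m)"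
       "sphere_moment d ?M = (2 * real m + 3) * sphere_moment d (Suc m) / (real d + 2 * real m + 2)"
    using sphere_moment_Suc[of d m] sphere_moment_Suc[of d "Suc m"] d by (simp_all add: field_simps)
  then have "sphere_moment d ?M = (2 * real m + 3) * (2 * real m + 1) * (sphere_moment d m / ((real d + 2 * real m) * (real d + 2 * real m + 2)))"
    by simp
  with eq have "((2 * real m + 3) * (2 * real m + 1)) * ?I =
     ((2 * real m + 3) * (2 * real m + 1)) * (sphere_moment d m * ?P / ((real d + 2 * real m) * (real d + 2 * real m + 2)))"
    by simp
  then show ?thesis by (subst (asm) mult_cancel_left) auto
qed

text \<open>
  Integration against an even power of \<open>\<langle>x, u\<rangle>\<close> commutes with rotations, hence acts on quartic
  harmonics as a scalar.  The scalar vanishes for \<open>m = 0\<close> and \<open>m = 1\<close>, where the power has degree below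
  four.
\<close>

theorem Hecke_P4:
  "(\<integral>u. inner_d d u x ^ (2 * m) * P4 d (inner_d d u z) \<partial>unif_sphere d)
     = 4 * real m * (real m - 1) / ((real d + 2 * real m) * (real d + 2 * real m + 2)) * sphere_moment d m
        * P4 d (inner_d d x z)"
proof -
  have d0: "d > 0" using d by simp
  let ?J = "\<lambda>k. \<integral>u. inner_d d u x ^ (2 * m) * inner_d d u z ^ k \<partial>unif_sphere d"
  let ?D = "(real d - 1) * (real d + 1)"
  have D: "?D \<noteq> 0" using d by auto
  have "(\<integral>u. inner_d d u x ^ (2 * m) * P4 d (inner_d d u z) \<partial>unif_sphere d)
    = (\<integral>u. ((real d + 2) * (real d + 4) / ?D) * (inner_d d u x ^ (2 * m) * inner_d d u z ^ 4)
        - (6 * (real d + 2) / ?D) * (inner_d d u x ^ (2 * m) * inner_d d u z ^ 2)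
        + (3 / ?D) * (inner_d d u x ^ (2 * m) * inner_d d u z ^ 0) \<partial>unif_sphere d)"
    unfolding P4_expand by (intro Bochner_Integration.integral_cong refl) (simp only: ring_distribs mult_ac power_0 mult_1_right)
  also have "\<dots> = ((real d + 2) * (real d + 4) / ?D) * ?J 4 - (6 * (real d + 2) / ?D) * ?J 2 + (3 / ?D) * ?J 0"
    using integrable_inner_power[OF d0, of x "2 * m" z 4] integrable_inner_power[OF d0, of x "2 * m" z 2]
      integrable_inner_power[OF d0, of x "2 * m" z 0] by simp
  also have "?J 0 = sphere_moment d m" using sphere_moment_linear[OF d0, of x m] by (simp add: x)
  also have "((real d + 2) * (real d + 4) / ?D) * ?J 4 - (6 * (real d + 2) / ?D) * ?J 2 + (3 / ?D) * sphere_moment d m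
     = ((real d + 2) * (real d + 4) * ?J 4 - 6 * (real d + 2) * ?J 2 + 3 * sphere_moment d m) / ?D"
    by (simp only: add_divide_distrib diff_divide_distrib times_divide_eq_left)
  also have "(real d + 2) * (real d + 4) * ?J 4 - 6 * (real d + 2) * ?J 2 + 3 * sphere_moment d m
     = 4 * real m * (real m - 1) / ((real d + 2 * real m) * (real d + 2 * real m + 2)) * sphere_moment d m
        * ((real d + 2) * (real d + 4) * inner_d d x z ^ 4 - 6 * (real d + 2) * (inner_d d x z)\<^sup>2 + 3)"
  proof -
    define E where "E = real d + 2 * real m"
    have E: "E > 0" using d by (simp add: E_def)
    define c where "c = sphere_moment d m / (E * (E + 2))"
    have c: "sphere_moment d m = c * (E * (E + 2))" using E by (simp add: c_def)
    have J4: "?J 4 = c * (3 + 12 * real m * (inner_d d x z)\<^sup>2 + 4 * real m * (real m - 1) * inner_d d x z ^ 4)"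
      unfolding mixed_moment_4 c_def E_def by simp
    have J2: "?J 2 = c * (E + 2) * (1 + 2 * real m * (inner_d d x z)\<^sup>2)"
      unfolding mixed_moment_2 E_def[symmetric] c using E by simp
    have "4 * real m * (real m - 1) / (E * (E + 2)) * (c * (E * (E + 2))) = 4 * real m * (real m - 1) * c"
      using E by simp
    then show ?thesis unfolding J4 J2 c E_def[symmetric] 
      by (simp only:) (simp add: E_def algebra_simps power2_eq_square)
  qed
  finally show ?thesis by (simp add: P4_def)
qed

end

text \<open>
  The dimension of the space of harmonic polynomials of degree four in \<open>d\<close> variables.
\<close>

definition harmonic_dim :: "nat \<Rightarrow> real" where
  "harmonic_dim d = real d * (real d - 1) * (real d + 1) * (real d + 6) / 24"

lemma inner_d_sphere_le_1:
  assumes "inner_d d x x = 1" "inner_d d y y = 1"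
  shows "\<bar>inner_d d x y\<bar> \<le> 1"
  using Cauchy_Schwarz_inner_d[of d x y] assms by simp

text \<open>
  Expanding one factor into powers, only its leading term survives in \<open>Hecke_P4\<close>.
\<close>

theorem P4_reproducing:
  assumes d: "d \<ge> 3" and x: "inner_d d x x = 1" and z: "inner_d d z z = 1"
  shows "(\<integral>u. P4 d (inner_d d u x) * P4 d (inner_d d u z) \<partial>unif_sphere d) = P4 d (inner_d d x z) / harmonic_dim d"
proof -
  have d0: "d > 0" using d by simp
  let ?D = "(real d - 1) * (real d + 1)"
  define a b c where "a = (real d + 2) * (real d + 4) / ?D" and "b = 6 * (real d + 2) / ?D" and "c = 3 / ?D"
  have P: "P4 d t = a * t ^ 4 - b * t\<^sup>2 + c" for t
    unfolding a_def b_def c_def by (rule P4_expand)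
  let ?J = "\<lambda>m. \<integral>u. inner_d d u x ^ (2 * m) * P4 d (inner_d d u z) \<partial>unif_sphere d"
  have int: "integrable (unif_sphere d) (\<lambda>u. inner_d d u x ^ j * P4 d (inner_d d u z))" for j
  proof -
    have eq: "(\<lambda>u. inner_d d u x ^ j * P4 d (inner_d d u z)) =
      (\<lambda>u. a * (inner_d d u x ^ j * inner_d d u z ^ 4)
        - b * (inner_d d u x ^ j * inner_d d u z ^ 2)
        + c * (inner_d d u x ^ j * inner_d d u z ^ 0))"
      unfolding P by (simp add: fun_eq_iff algebra_simps)
    show ?thesis unfolding eq
      by (intro Bochner_Integration.integrable_add Bochner_Integration.integrable_diff integrable_mult_right integrable_inner_power d0)
  qed
  have "(\<integral>u. P4 d (inner_d d u x) * P4 d (inner_d d u z) \<partial>unif_sphere d)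
    = (\<integral>u. a * (inner_d d u x ^ (2 * 2) * P4 d (inner_d d u z))
        - b * (inner_d d u x ^ (2 * 1) * P4 d (inner_d d u z))
        + c * (inner_d d u x ^ (2 * 0) * P4 d (inner_d d u z)) \<partial>unif_sphere d)"
    by (intro Bochner_Integration.integral_cong refl)
       (simp add: P[of "inner_d d _ x"] algebra_simps power2_eq_square)
  also have "\<dots> = a * ?J 2 - b * ?J 1 + c * ?J 0"
    using int[of "2 * 2"] int[of "2 * 1"] int[of "2 * 0"] by simp
  also have "?J 1 = 0" by (subst Hecke_P4[OF d x z]) simp
  also have "?J 0 = 0" by (subst Hecke_P4[OF d x z]) simp
  also have "?J 2 = 8 / ((real d + 4) * (real d + 6)) * sphere_moment d 2 * P4 d (inner_d d x z)"
    by (subst Hecke_P4[OF d x z]) simp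
  also have "sphere_moment d 2 = 3 / (real d * (real d + 2))"
  proof -
    have "real d * sphere_moment d 1 = 1" "(real d + 2) * sphere_moment d 2 = 3 * sphere_moment d 1"
      using sphere_moment_Suc[of d 0] sphere_moment_Suc[of d 1] d by (simp_all add: sphere_moment_0 numeral_2_eq_2)
    then have "sphere_moment d 2 * (real d * (real d + 2)) = 3" by algebra
    then show ?thesis using d by (simp add: nonzero_eq_divide_eq)
  qed
  finally have "(\<integral>u. P4 d (inner_d d u x) * P4 d (inner_d d u z) \<partial>unif_sphere d)
    = (real d + 2) * (real d + 4) / ?D * (8 / ((real d + 4) * (real d + 6)) * (3 / (real d * (real d + 2))) * P4 d (inner_d d x z))"
    by (simp add: a_def)
  also have "\<dots> = P4 d (inner_d d x z) / harmonic_dim d"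
  proof -
    have "real d \<noteq> 0" "real d + 2 \<noteq> 0" "real d + 4 \<noteq> 0" "real d + 6 \<noteq> 0" "real d - 1 \<noteq> 0" "real d + 1 \<noteq> 0"
      using d by auto
    then show ?thesis by (simp add: harmonic_dim_def divide_simps)
  qed
  finally show ?thesis .
qed

lemma P4_1: "d \<ge> 3 \<Longrightarrow> P4 d 1 = 1"
proof -
  assume "d \<ge> 3"
  then have "(real d - 1) * (real d + 1) \<noteq> 0" by auto
  moreover have "(real d + 2) * (real d + 4) * 1 ^ 4 - 6 * (real d + 2) * 1\<^sup>2 + 3 = (real d - 1) * (real d + 1)"
    by (simp add: algebra_simps)
  ultimately show ?thesis unfolding P4_def by (metis divide_self)
qed

lemma abs_P4_le_1:
  assumes d: "d \<ge> 3" and t: "\<bar>t\<bar> \<le> 1"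
  shows "\<bar>P4 d t\<bar> \<le> 1"
proof -
  define D where "D = real d"
  have D: "D \<ge> 3" using d by (simp add: D_def)
  define s where "s = t\<^sup>2"
  have s: "0 \<le> s" "s \<le> 1" using t by (simp_all add: s_def abs_square_le_1)
  have P: "P4 d t = ((D + 2) * (D + 4) * s\<^sup>2 - 6 * (D + 2) * s + 3) / (D\<^sup>2 - 1)"
    by (simp add: P4_def D_def s_def power2_eq_square power4_eq_xxxx algebra_simps)
  have pos: "D\<^sup>2 - 1 > 0" using D power_mono[of 3 D 2] by simp
  have "(D + 2) * (D + 4) * s\<^sup>2 - 6 * (D + 2) * s + 3 \<le> D\<^sup>2 - 1"
  proof -
    have "D\<^sup>2 - 1 - ((D + 2) * (D + 4) * s\<^sup>2 - 6 * (D + 2) * s + 3) = (1 - s) * ((D + 2) * (D + 4) * s + (D\<^sup>2 - 4))"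
      by (simp add: algebra_simps power2_eq_square)
    moreover have "D\<^sup>2 - 4 \<ge> 0" using D power_mono[of 3 D 2] by simp
    then have "0 \<le> (1 - s) * ((D + 2) * (D + 4) * s + (D\<^sup>2 - 4))"
      using s D by (intro mult_nonneg_nonneg add_nonneg_nonneg) auto
    ultimately show ?thesis by linarith
  qed
  moreover have "(D + 2) * (D + 4) * s\<^sup>2 - 6 * (D + 2) * s + 3 \<ge> - (D\<^sup>2 - 1)"
  proof -
    have "(D + 4) * ((D + 2) * (D + 4) * s\<^sup>2 - 6 * (D + 2) * s + 3 + (D\<^sup>2 - 1))
       = (D + 2) * ((D + 4) * s - 3)\<^sup>2 + (D + 1) * ((D - 1) * (D + 4) - 6)"
      by (simp add: algebra_simps power2_eq_square)
    moreover have "(D - 1) * (D + 4) \<ge> 2 * 7" using D by (intro mult_mono) auto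
    ultimately have "0 \<le> (D + 4) * ((D + 2) * (D + 4) * s\<^sup>2 - 6 * (D + 2) * s + 3 + (D\<^sup>2 - 1))"
      using D by simp
    then show ?thesis using D by (simp add: zero_le_mult_iff)
  qed
  ultimately show ?thesis unfolding P using pos by (simp add: abs_le_iff divide_simps)
qed

section \<open>Rank and traces of a reproducing kernel\<close>

lemma infsum_single:
  fixes f :: "'a \<Rightarrow> real"
  assumes "a \<in> A" "\<And>x. x \<in> A \<Longrightarrow> x \<noteq> a \<Longrightarrow> f x = 0"
  shows "infsum f A = f a"
proof -
  have "infsum f A = infsum f {a}" using assms by (intro infsum_cong_neutral) auto
  then show ?thesis by simp
qed

definition sq_integrable :: "'a measure \<Rightarrow> ('a \<Rightarrow> real) \<Rightarrow> bool" where
  "sq_integrable M f \<longleftrightarrow> f \<in> borel_measurable M \<and> integrable M (\<lambda>x. (f x)\<^sup>2)"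

lemma sq_integrable_mult:
  assumes "sq_integrable M f" "sq_integrable M g"
  shows "integrable M (\<lambda>x. f x * g x)"
proof (rule Bochner_Integration.integrable_bound)
  show "integrable M (\<lambda>x. (f x)\<^sup>2 + (g x)\<^sup>2)"
    using assms by (simp add: sq_integrable_def)
  show "(\<lambda>x. f x * g x) \<in> borel_measurable M"
    using assms unfolding sq_integrable_def by (intro borel_measurable_times) auto
  have "\<bar>a * b\<bar> \<le> a\<^sup>2 + b\<^sup>2" for a b :: real
  proof -
    have "2 * (\<bar>a\<bar> * \<bar>b\<bar>) \<le> a\<^sup>2 + b\<^sup>2"
      using sum_squares_ge_zero[of "\<bar>a\<bar> - \<bar>b\<bar>" 0] by (simp add: power2_eq_square algebra_simps)
    moreover have "0 \<le> \<bar>a\<bar> * \<bar>b\<bar>" by simp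
    ultimately show ?thesis unfolding abs_mult by linarith
  qed
  then show "AE x in M. norm (f x * g x) \<le> norm ((f x)\<^sup>2 + (g x)\<^sup>2)"
    by (intro AE_I2) simp
qed

lemma sq_integrable_add:
  assumes "sq_integrable M f" "sq_integrable M g"
  shows "sq_integrable M (\<lambda>x. f x + g x)"
proof -
  have "integrable M (\<lambda>x. (f x)\<^sup>2 + (g x)\<^sup>2 + 2 * (f x * g x))"
    using assms sq_integrable_mult[OF assms] by (auto simp: sq_integrable_def)
  then show ?thesis using assms by (auto simp: sq_integrable_def power2_sum mult.assoc)
qed

lemma sq_integrable_cmult:
  "sq_integrable M f \<Longrightarrow> sq_integrable M (\<lambda>x. c * f x)"
  by (auto simp: sq_integrable_def power_mult_distrib)

lemma sq_integrable_sum: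
  "(\<And>i. i \<in> I \<Longrightarrow> sq_integrable M (f i)) \<Longrightarrow> sq_integrable M (\<lambda>x. \<Sum>i\<in>I. f i x)"
proof (induction I rule: infinite_finite_induct)
  case (insert i I)
  then show ?case by (simp add: sq_integrable_add)
qed (auto simp: sq_integrable_def)

lemma sq_integrable_diff:
  "sq_integrable M f \<Longrightarrow> sq_integrable M g \<Longrightarrow> sq_integrable M (\<lambda>x. f x - g x)"
  using sq_integrable_add[of M f "\<lambda>x. -1 * g x"] sq_integrable_cmult[of M g "-1"] by simp

lemma (in finite_measure) sq_integrable_bounded:
  assumes "f \<in> borel_measurable M" "\<And>x. x \<in> space M \<Longrightarrow> \<bar>f x\<bar> \<le> C"
  shows "sq_integrable M f"
  unfolding sq_integrable_def
proof (intro conjI assms(1) integrable_const_bound[where B="C\<^sup>2"])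
  show "AE x in M. norm ((f x)\<^sup>2) \<le> C\<^sup>2"
  proof (intro AE_I2)
    fix x assume "x \<in> space M"
    from power_mono[OF assms(2)[OF this], of 2] show "norm ((f x)\<^sup>2) \<le> C\<^sup>2" by simp
  qed
qed (use assms(1) in simp)

lemma (in finite_measure) sq_integrable_integrable: "sq_integrable M f \<Longrightarrow> integrable M f"
  using sq_integrable_mult[of M f "\<lambda>_. 1"] by (simp add: sq_integrable_def)

text \<open>
  The reproducing property says that the integral operator is idempotent, and symmetry makes it an
  orthogonal projection.  The diagonal is assumed constant so that the rank can be read off pointwise.
\<close>

locale projection_kernel = prob_space M for M :: "'a measure" +
  fixes K :: "'a \<Rightarrow> 'a \<Rightarrow> real" and \<kappa> C :: real
  assumes kernel_measurable: "(\<lambda>(x, y). K x y) \<in> borel_measurable (M \<Otimes>\<^sub>M M)"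
    and kernel_bounded: "x \<in> space M \<Longrightarrow> y \<in> space M \<Longrightarrow> \<bar>K x y\<bar> \<le> C"
    and kernel_sym: "x \<in> space M \<Longrightarrow> y \<in> space M \<Longrightarrow> K x y = K y x"
    and kernel_reproducing: "x \<in> space M \<Longrightarrow> z \<in> space M \<Longrightarrow> (\<integral>y. K x y * K y z \<partial>M) = K x z"
    and kernel_diagonal: "x \<in> space M \<Longrightarrow> K x x = \<kappa>"
begin

definition proj :: "('a \<Rightarrow> real) \<Rightarrow> 'a \<Rightarrow> real" where
  "proj f x = (\<integral>y. K x y * f y \<partial>M)"

lemma kernel_measurable' [measurable]:
  "f \<in> measurable N M \<Longrightarrow> g \<in> measurable N M \<Longrightarrow> (\<lambda>x. K (f x) (g x)) \<in> borel_measurable N"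
  using measurable_compose[OF measurable_Pair kernel_measurable, of f N g] by simp

lemma proj_measurable [measurable]:
  assumes [measurable]: "f \<in> borel_measurable M"
  shows "proj f \<in> borel_measurable M"
  unfolding proj_def by measurable

lemma kernel_sq_integrable: "x \<in> space M \<Longrightarrow> sq_integrable M (K x)"
  by (rule sq_integrable_bounded[where C=C]) (auto simp: kernel_bounded)

text \<open>
  This holds at every point, not only almost everywhere, since the kernel is defined pointwise.
\<close>

lemma proj_idempotent:
  assumes f: "integrable M f" and x: "x \<in> space M"
  shows "proj (proj f) x = proj f x"
proof -
  interpret P: pair_prob_space M M ..
  have [measurable]: "f \<in> borel_measurable M" using f by auto
  have C: "0 \<le> C" using kernel_bounded[OF x x] by linarith
  have bd: "\<bar>K x y * (K y z * f z)\<bar> \<le> C * C * \<bar>f z\<bar>" if "y \<in> space M" "z \<in> space M" for y z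
  proof -
    have "\<bar>K x y\<bar> * \<bar>K y z\<bar> \<le> C * C" using that x C by (intro mult_mono kernel_bounded) auto
    then show ?thesis using mult_right_mono[of "\<bar>K x y\<bar> * \<bar>K y z\<bar>" "C * C" "\<bar>f z\<bar>"]
      by (simp add: abs_mult mult.assoc)
  qed
  have int: "integrable (M \<Otimes>\<^sub>M M) (\<lambda>(y, z). K x y * (K y z * f z))"
  proof (rule P.Fubini_integrable)
    show "(\<lambda>(y, z). K x y * (K y z * f z)) \<in> borel_measurable (M \<Otimes>\<^sub>M M)" using x by measurable
    have inner: "integrable M (\<lambda>z. K x y * (K y z * f z))" if y: "y \<in> space M" for y
    proof (rule Bochner_Integration.integrable_bound)
      show "integrable M (\<lambda>z. C * C * \<bar>f z\<bar>)" using f by simp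
      show "AE z in M. norm (K x y * (K y z * f z)) \<le> norm (C * C * \<bar>f z\<bar>)"
        using bd[OF y] C by (intro AE_I2) (auto simp: abs_mult)
    qed (use y in measurable)
    then show "AE y in M. integrable M (\<lambda>z. (case (y, z) of (y, z) \<Rightarrow> K x y * (K y z * f z)))" by simp
    show "integrable M (\<lambda>y. \<integral>z. norm (case (y, z) of (y, z) \<Rightarrow> K x y * (K y z * f z)) \<partial>M)"
    proof (rule integrable_const_bound[where B="C * C * (\<integral>z. \<bar>f z\<bar> \<partial>M)"])
      show "AE y in M. norm (\<integral>z. norm (case (y, z) of (y, z) \<Rightarrow> K x y * (K y z * f z)) \<partial>M) \<le> C * C * (\<integral>z. \<bar>f z\<bar> \<partial>M)"
      proof (intro AE_I2)
        fix y assume y: "y \<in> space M"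
        have "(\<integral>z. \<bar>K x y * (K y z * f z)\<bar> \<partial>M) \<le> (\<integral>z. C * C * \<bar>f z\<bar> \<partial>M)"
          using f inner[OF y] bd[OF y] by (intro integral_mono) auto
        then show "norm (\<integral>z. norm (case (y, z) of (y, z) \<Rightarrow> K x y * (K y z * f z)) \<partial>M) \<le> C * C * (\<integral>z. \<bar>f z\<bar> \<partial>M)"
          by simp
      qed
      show "(\<lambda>y. \<integral>z. norm (case (y, z) of (y, z) \<Rightarrow> K x y * (K y z * f z)) \<partial>M) \<in> borel_measurable M"
        using x by measurable
    qed
  qed
  have "proj (proj f) x = (\<integral>y. \<integral>z. K x y * (K y z * f z) \<partial>M \<partial>M)" by (simp add: proj_def)
  also have "\<dots> = (\<integral>z. \<integral>y. K x y * (K y z * f z) \<partial>M \<partial>M)"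
    using P.Fubini_integral[of "\<lambda>y z. K x y * (K y z * f z)"] int by simp
  also have "\<dots> = (\<integral>z. K x z * f z \<partial>M)"
  proof (intro Bochner_Integration.integral_cong refl)
    fix z assume z: "z \<in> space M"
    have "(\<integral>y. K x y * (K y z * f z) \<partial>M) = (\<integral>y. K x y * K y z \<partial>M) * f z"
      by (simp add: mult.assoc[symmetric])
    then show "(\<integral>y. K x y * (K y z * f z) \<partial>M) = K x z * f z" by (simp add: kernel_reproducing x z)
  qed
  finally show ?thesis by (simp add: proj_def)
qed

definition range_space :: "('a \<Rightarrow> real) set" where
  "range_space = {f. sq_integrable M f \<and> (AE x in M. proj f x = f x)}"

definition orthonormal_in_range :: "nat \<Rightarrow> (nat \<Rightarrow> 'a \<Rightarrow> real) \<Rightarrow> bool" where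
  "orthonormal_in_range r e \<longleftrightarrow> (\<forall>i<r. e i \<in> range_space) \<and>
     (\<forall>i<r. \<forall>j<r. (\<integral>x. e i x * e j x \<partial>M) = (if i = j then 1 else 0))"

text \<open>
  The kernel of the projection onto the orthogonal complement of \<open>e 0, ..., e (r - 1)\<close> in the range.
\<close>

definition residual :: "nat \<Rightarrow> (nat \<Rightarrow> 'a \<Rightarrow> real) \<Rightarrow> 'a \<Rightarrow> 'a \<Rightarrow> real" where
  "residual r e x y = K x y - (\<Sum>i<r. e i x * e i y)"

lemma residual_properties:
  assumes e: "orthonormal_in_range r e" and x: "x \<in> space M" "\<And>i. i < r \<Longrightarrow> proj (e i) x = e i x"
  shows "residual r e x \<in> range_space"
    and "j < r \<Longrightarrow> (\<integral>y. residual r e x y * e j y \<partial>M) = 0"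
    and "(\<integral>y. residual r e x y * residual r e x y \<partial>M) = \<kappa> - (\<Sum>i<r. (e i x)\<^sup>2)"
proof -
  have e2: "sq_integrable M (e i)" if "i < r" for i
    using e that by (auto simp: orthonormal_in_range_def range_space_def)
  have eo: "(\<integral>x. e i x * e j x \<partial>M) = (if i = j then 1 else 0)" if "i < r" "j < r" for i j
    using e that by (auto simp: orthonormal_in_range_def)
  have res2: "sq_integrable M (residual r e x)"
    unfolding residual_def
    by (intro sq_integrable_diff sq_integrable_sum sq_integrable_cmult kernel_sq_integrable e2 x) simp
  have pair: "(\<integral>y. residual r e x y * f y \<partial>M) = proj f x - (\<Sum>i<r. e i x * (\<integral>y. e i y * f y \<partial>M))"
    if f: "sq_integrable M f" for f
  proof -
    have "(\<integral>y. residual r e x y * f y \<partial>M) = (\<integral>y. K x y * f y - (\<Sum>i<r. e i x * (e i y * f y)) \<partial>M)"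
      by (intro Bochner_Integration.integral_cong refl)
         (simp add: residual_def left_diff_distrib sum_distrib_right mult.assoc)
    also have "\<dots> = (\<integral>y. K x y * f y \<partial>M) - (\<integral>y. (\<Sum>i<r. e i x * (e i y * f y)) \<partial>M)"
      by (intro Bochner_Integration.integral_diff sq_integrable_mult kernel_sq_integrable x f Bochner_Integration.integrable_sum integrable_mult_right e2) auto
    also have "(\<integral>y. (\<Sum>i<r. e i x * (e i y * f y)) \<partial>M) = (\<Sum>i<r. \<integral>y. e i x * (e i y * f y) \<partial>M)"
      by (intro Bochner_Integration.integral_sum integrable_mult_right sq_integrable_mult e2 f) auto
    finally show ?thesis by (simp add: proj_def)
  qed
  show orth: "(\<integral>y. residual r e x y * e j y \<partial>M) = 0" if j: "j < r" for j
  proof -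
    have "(\<Sum>i<r. e i x * (\<integral>y. e i y * e j y \<partial>M)) = (\<Sum>i<r. if i = j then e j x else 0)"
      by (intro sum.cong refl) (auto simp: eo j)
    then show ?thesis using pair[OF e2[OF j]] x(2)[OF j] j by simp
  qed
  have ek: "(\<integral>y. e i y * K x' y \<partial>M) = proj (e i) x'" if "x' \<in> space M" for x' i
    by (simp add: proj_def mult.commute)
  show "(\<integral>y. residual r e x y * residual r e x y \<partial>M) = \<kappa> - (\<Sum>i<r. (e i x)\<^sup>2)"
  proof -
    have "(\<integral>y. residual r e x y * K x y \<partial>M) = proj (K x) x - (\<Sum>i<r. e i x * e i x)"
      unfolding pair[OF kernel_sq_integrable[OF x(1)]] ek[OF x(1)] using x(2) by simp
    also have "proj (K x) x = (\<integral>y. K x y * K y x \<partial>M)"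
      unfolding proj_def by (intro Bochner_Integration.integral_cong refl) (simp add: kernel_sym x)
    also have "\<dots> = \<kappa>" by (simp add: kernel_reproducing kernel_diagonal x)
    finally have 1: "(\<integral>y. residual r e x y * K x y \<partial>M) = \<kappa> - (\<Sum>i<r. (e i x)\<^sup>2)" by (simp add: power2_eq_square)
    have "(\<integral>y. residual r e x y * residual r e x y \<partial>M)
       = (\<integral>y. residual r e x y * K x y - (\<Sum>i<r. e i x * (residual r e x y * e i y)) \<partial>M)"
      by (intro Bochner_Integration.integral_cong refl)
         (subst (2) residual_def, simp add: right_diff_distrib sum_distrib_left mult_ac)
    also have "\<dots> = (\<integral>y. residual r e x y * K x y \<partial>M) - (\<integral>y. (\<Sum>i<r. e i x * (residual r e x y * e i y)) \<partial>M)"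
      by (intro Bochner_Integration.integral_diff sq_integrable_mult kernel_sq_integrable x res2 Bochner_Integration.integrable_sum integrable_mult_right e2) auto
    also have "(\<integral>y. (\<Sum>i<r. e i x * (residual r e x y * e i y)) \<partial>M) = (\<Sum>i<r. \<integral>y. e i x * (residual r e x y * e i y) \<partial>M)"
      by (intro Bochner_Integration.integral_sum integrable_mult_right sq_integrable_mult e2 res2) auto
    also have "\<dots> = 0" by (simp add: orth)
    finally show ?thesis using 1 by simp
  qed
  have "AE y in M. \<forall>i\<in>{..<r}. proj (e i) y = e i y"
    using e by (intro AE_finite_allI) (auto simp: orthonormal_in_range_def range_space_def)
  then have "AE y in M. proj (residual r e x) y = residual r e x y"
    using AE_space
  proof eventually_elim
    case (elim y)
    have "proj (residual r e x) y = (\<integral>z. residual r e x z * K y z \<partial>M)"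
      by (simp add: proj_def mult.commute)
    also have "\<dots> = proj (K y) x - (\<Sum>i<r. e i x * e i y)"
      unfolding pair[OF kernel_sq_integrable[OF elim(2)]] ek[OF elim(2)] using elim by simp
    also have "proj (K y) x = (\<integral>z. K x z * K z y \<partial>M)"
      unfolding proj_def by (intro Bochner_Integration.integral_cong refl) (simp add: kernel_sym elim)
    also have "\<dots> = K x y" by (simp add: kernel_reproducing x elim)
    finally show ?case unfolding residual_def[of r e x y] .
  qed
  with res2 show "residual r e x \<in> range_space" by (simp add: range_space_def)
qed

lemma orthonormal_AE_bound:
  assumes e: "orthonormal_in_range r e"
  shows "AE x in M. \<forall>i\<in>{..<r}. proj (e i) x = e i x"
    and "AE x in M. (\<Sum>i<r. (e i x)\<^sup>2) \<le> \<kappa>"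
    and "integrable M (\<lambda>x. \<Sum>i<r. (e i x)\<^sup>2)"
    and "(\<integral>x. (\<Sum>i<r. (e i x)\<^sup>2) \<partial>M) = real r"
proof -
  show ae: "AE x in M. \<forall>i\<in>{..<r}. proj (e i) x = e i x"
    using e by (intro AE_finite_allI) (auto simp: orthonormal_in_range_def range_space_def)
  then show "AE x in M. (\<Sum>i<r. (e i x)\<^sup>2) \<le> \<kappa>"
    using AE_space
  proof eventually_elim
    case (elim x)
    have "0 \<le> (\<integral>y. residual r e x y * residual r e x y \<partial>M)" by simp
    also have "\<dots> = \<kappa> - (\<Sum>i<r. (e i x)\<^sup>2)" using elim by (intro residual_properties(3)[OF e]) auto
    finally show ?case by simp
  qed
  have i: "integrable M (\<lambda>x. (e i x)\<^sup>2)" if "i < r" for i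
    using e that by (auto simp: orthonormal_in_range_def range_space_def sq_integrable_def)
  then show "integrable M (\<lambda>x. \<Sum>i<r. (e i x)\<^sup>2)" by auto
  have "(\<integral>x. (\<Sum>i<r. (e i x)\<^sup>2) \<partial>M) = (\<Sum>i<r. \<integral>x. (e i x)\<^sup>2 \<partial>M)"
    using i by (intro Bochner_Integration.integral_sum) auto
  also have "\<dots> = (\<Sum>i<r. 1)"
    using e by (intro sum.cong) (auto simp: orthonormal_in_range_def power2_eq_square)
  finally show "(\<integral>x. (\<Sum>i<r. (e i x)\<^sup>2) \<partial>M) = real r" by simp
qed

lemma orthonormal_le:
  assumes e: "orthonormal_in_range r e"
  shows "real r \<le> \<kappa>"
proof -
  have "real r \<le> (\<integral>x. \<kappa> \<partial>M)"
    unfolding orthonormal_AE_bound(4)[OF e, symmetric]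
    by (intro integral_mono_AE orthonormal_AE_bound[OF e]) simp
  then show ?thesis by (simp add: prob_space)
qed

text \<open>
  If \<open>r\<close> is below the trace \<open>\<kappa>\<close> of the projection, the residual kernel has positive trace, so one of
  its sections is a nonzero element of the range orthogonal to the given family.
\<close>

lemma orthonormal_extend:
  assumes e: "orthonormal_in_range r e" and r: "real r < \<kappa>"
  shows "\<exists>e'. orthonormal_in_range (Suc r) e'"
proof -
  have "\<exists>x\<in>space M. (\<forall>i<r. proj (e i) x = e i x) \<and> (\<Sum>i<r. (e i x)\<^sup>2) < \<kappa>"
  proof (rule ccontr)
    assume "\<not> ?thesis"
    then have *: "\<And>x. x \<in> space M \<Longrightarrow> (\<forall>i<r. proj (e i) x = e i x) \<Longrightarrow> \<kappa> \<le> (\<Sum>i<r. (e i x)\<^sup>2)"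
      by (meson not_le)
    have "AE x in M. \<kappa> \<le> (\<Sum>i<r. (e i x)\<^sup>2)"
      using orthonormal_AE_bound(1)[OF e] AE_space by eventually_elim (auto intro!: *)
    then have "(\<integral>x. \<kappa> \<partial>M) \<le> (\<integral>x. (\<Sum>i<r. (e i x)\<^sup>2) \<partial>M)"
      by (intro integral_mono_AE orthonormal_AE_bound[OF e]) simp_all
    then show False using r orthonormal_AE_bound(4)[OF e] by (simp add: prob_space)
  qed
  then obtain x where x: "x \<in> space M" "\<And>i. i < r \<Longrightarrow> proj (e i) x = e i x" "(\<Sum>i<r. (e i x)\<^sup>2) < \<kappa>" by auto
  define N where "N = sqrt (\<kappa> - (\<Sum>i<r. (e i x)\<^sup>2))"
  have N: "N > 0" "N * N = \<kappa> - (\<Sum>i<r. (e i x)\<^sup>2)" using x(3) by (auto simp: N_def)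
  let ?g = "\<lambda>y. (1 / N) * residual r e x y"
  note rp = residual_properties[OF e x(1,2)]
  have g: "?g \<in> range_space"
  proof -
    have "proj ?g y = (1 / N) * proj (residual r e x) y" for y
    proof -
      have "proj ?g y = (\<integral>z. (1 / N) * (K y z * residual r e x z) \<partial>M)"
        unfolding proj_def by (intro Bochner_Integration.integral_cong) auto
      then show ?thesis by (simp add: proj_def)
    qed
    then show ?thesis using rp(1) sq_integrable_cmult[of M "residual r e x" "1 / N"] by (auto simp: range_space_def)
  qed
  have g0: "(\<integral>y. ?g y * e j y \<partial>M) = 0" "(\<integral>y. e j y * ?g y \<partial>M) = 0" if "j < r" for j
  proof -
    have "(\<integral>y. ?g y * e j y \<partial>M) = (1 / N) * (\<integral>y. residual r e x y * e j y \<partial>M)"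
      by (simp add: mult.assoc)
    then show "(\<integral>y. ?g y * e j y \<partial>M) = 0" using rp(2)[OF _ that] by simp
    then show "(\<integral>y. e j y * ?g y \<partial>M) = 0" by (simp add: mult.commute)
  qed
  have g1: "(\<integral>y. ?g y * ?g y \<partial>M) = 1"
  proof -
    have "(\<integral>y. ?g y * ?g y \<partial>M) = (\<integral>y. (1 / (N * N)) * (residual r e x y * residual r e x y) \<partial>M)"
      by (intro Bochner_Integration.integral_cong) auto
    also have "\<dots> = (1 / (N * N)) * (\<integral>y. residual r e x y * residual r e x y \<partial>M)" by simp
    also have "(\<integral>y. residual r e x y * residual r e x y \<partial>M) = N * N" using rp(3) N(2) by simp
    also have "(1 / (N * N)) * (N * N) = 1" using N(1) by simp
    finally show ?thesis .
  qed
  have "orthonormal_in_range (Suc r) (e(r := ?g))"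
    unfolding orthonormal_in_range_def
  proof (intro conjI allI impI)
    fix i assume "i < Suc r"
    then show "(e(r := ?g)) i \<in> range_space"
      using e g by (auto simp: orthonormal_in_range_def less_Suc_eq)
  next
    fix i j assume ij: "i < Suc r" "j < Suc r"
    consider "i < r" "j < r" | "i = r" "j < r" | "i < r" "j = r" | "i = r" "j = r"
      using ij by linarith
    then show "(\<integral>x. (e(r := ?g)) i x * (e(r := ?g)) j x \<partial>M) = (if i = j then 1 else 0)"
    proof cases
      case 1 then show ?thesis using e by (auto simp: orthonormal_in_range_def)
    next
      case 2 then show ?thesis using g0(1)[of j] by (simp del: times_divide_eq_left)
    next
      case 3 then show ?thesis using g0(2)[of i] by (simp del: times_divide_eq_left)
    next
      case 4 then show ?thesis using g1 by (simp del: times_divide_eq_left)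
    qed
  qed
  then show ?thesis by blast
qed

text \<open>
  Bessel's inequality bounds every orthonormal family, and a family of maximal size cannot be
  extended.  In particular the diagonal value is a natural number.
\<close>

theorem rank_eq_diagonal:
  "real (Sup {r. \<exists>e. orthonormal_in_range r e}) = \<kappa>"
proof -
  let ?S = "{r. \<exists>e. orthonormal_in_range r e}"
  have "?S \<subseteq> {..nat \<lceil>\<kappa>\<rceil>}"
  proof
    fix r assume "r \<in> ?S"
    then have "real r \<le> \<kappa>" using orthonormal_le by auto
    then show "r \<in> {..nat \<lceil>\<kappa>\<rceil>}" by (simp add: le_nat_iff) linarith
  qed
  then have fin: "finite ?S" by (rule finite_subset) simp
  have ne: "?S \<noteq> {}" by (auto simp: orthonormal_in_range_def intro!: exI[of _ 0])
  have Sup: "Sup ?S = Max ?S" unfolding Sup_nat_def using ne by (simp only: if_False)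
  have "Max ?S \<in> ?S" using fin ne by (rule Max_in)
  then obtain e where e: "orthonormal_in_range (Max ?S) e" by auto
  have "\<not> real (Max ?S) < \<kappa>"
  proof
    assume "real (Max ?S) < \<kappa>"
    then have "Suc (Max ?S) \<in> ?S" using orthonormal_extend[OF e] by auto
    then have "Suc (Max ?S) \<le> Max ?S" using fin by (intro Max_ge) auto
    then show False by simp
  qed
  then show ?thesis using orthonormal_le[OF e] Sup by simp
qed

text \<open>
  A multiple \<open>l\<close> of a projection has powers \<open>l ^ n\<close> times the projection, so \<open>l ^ n\<close> is the only nonzero
  eigenvalue.  The kernel \<open>k\<close> is compared with \<open>l K\<close> only on a set \<open>S\<close> of full measure because the
  kernels on the sphere are not controlled off the sphere.
\<close>

theorem op_trace_power:
  fixes A :: "('a \<Rightarrow> real) \<Rightarrow> 'a \<Rightarrow> real" and k :: "'a \<Rightarrow> 'a \<Rightarrow> real"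
  assumes A: "\<And>f x. A f x = (\<integral>y. k x y * f y \<partial>M)"
    and k: "(\<lambda>(x, y). k x y) \<in> borel_measurable (M \<Otimes>\<^sub>M M)"
    and S: "AE x in M. x \<in> S" "\<And>x y. x \<in> S \<Longrightarrow> y \<in> S \<Longrightarrow> k x y = l * K x y"
    and l: "l \<noteq> 0" and n: "n \<ge> 1"
  shows "op_trace M (A ^^ n) = \<kappa> * l ^ n"
proof -
  have km [measurable]: "(\<lambda>x. k (f x) (g x)) \<in> borel_measurable N"
    if "f \<in> measurable N M" "g \<in> measurable N M" for f g and N :: "'c measure"
    using measurable_compose[OF measurable_Pair k, of f N g] that by simp
  have step: "A f x = l * proj f x" if x: "x \<in> S" "x \<in> space M" and [measurable]: "f \<in> borel_measurable M" for f x
  proof -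
    have "A f x = (\<integral>y. l * (K x y * f y) \<partial>M)"
      unfolding A
    proof (rule integral_cong_AE)
      show "AE y in M. k x y * f y = l * (K x y * f y)"
        using S(1) by eventually_elim (simp add: S(2) x)
    qed (use x in measurable)
    then show ?thesis by (simp add: proj_def)
  qed
  have meas: "A f \<in> borel_measurable M" if [measurable]: "f \<in> borel_measurable M" for f
    unfolding A[abs_def] by measurable
  have proj_cmult: "proj (\<lambda>x. c * f x) x = c * proj f x" for c f x
  proof -
    have "proj (\<lambda>x. c * f x) x = (\<integral>y. c * (K x y * f y) \<partial>M)"
      unfolding proj_def by (intro Bochner_Integration.integral_cong) auto
    then show ?thesis by (simp add: proj_def)
  qed
  have proj_cong: "proj f x = proj g x"
    if ae: "AE x in M. f x = g x" and [measurable]: "f \<in> borel_measurable M" "g \<in> borel_measurable M" and x: "x \<in> space M" for f g x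
    unfolding proj_def
  proof (rule integral_cong_AE)
    show "AE y in M. K x y * f y = K x y * g y" using ae by eventually_elim simp
  qed (use x in measurable)
  have iter: "(A ^^ Suc j) f \<in> borel_measurable M \<and> (\<forall>x\<in>S \<inter> space M. (A ^^ Suc j) f x = l ^ Suc j * proj f x)"
    if f: "integrable M f" for f j
  proof (induction j)
    case 0
    have "f \<in> borel_measurable M" using f by auto
    then show ?case using step meas by simp
  next
    case (Suc j)
    have fm: "f \<in> borel_measurable M" using f by auto
    have "(A ^^ Suc (Suc j)) f x = l ^ Suc (Suc j) * proj f x" if x: "x \<in> S" "x \<in> space M" for x
    proof -
      have "(A ^^ Suc (Suc j)) f x = l * proj ((A ^^ Suc j) f) x"
        using step[OF x, of "(A ^^ Suc j) f"] Suc by simp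
      also have "proj ((A ^^ Suc j) f) x = proj (\<lambda>x. l ^ Suc j * proj f x) x"
      proof (rule proj_cong)
        show "AE x in M. (A ^^ Suc j) f x = l ^ Suc j * proj f x"
          using S(1) AE_space by eventually_elim (use Suc in auto)
        show "(A ^^ Suc j) f \<in> borel_measurable M" using Suc by blast
        show "(\<lambda>x. l ^ Suc j * proj f x) \<in> borel_measurable M" using fm by measurable
      qed fact
      also have "\<dots> = l ^ Suc j * proj f x" unfolding proj_cmult using proj_idempotent[OF f x(2)] by simp
      finally show ?thesis by simp
    qed
    then show ?case using meas[of "(A ^^ Suc j) f"] Suc by simp
  qed
  have pow: "AE x in M. (A ^^ n) f x = l ^ n * proj f x" if "integrable M f" for f
  proof -
    obtain j where j: "n = Suc j" using n by (cases n) auto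
    show ?thesis using S(1) AE_space
      by eventually_elim (use iter[OF that, of j] j in blast)
  qed
  have ef: "f \<in> eigenfunctions M (A ^^ n) \<nu> \<longleftrightarrow> sq_integrable M f \<and> (AE x in M. l ^ n * proj f x = \<nu> * f x)" for f \<nu>
  proof -
    have "(AE x in M. (A ^^ n) f x = \<nu> * f x) \<longleftrightarrow> (AE x in M. l ^ n * proj f x = \<nu> * f x)" if "sq_integrable M f"
    proof
      assume "AE x in M. (A ^^ n) f x = \<nu> * f x"
      with pow[OF sq_integrable_integrable[OF that]] show "AE x in M. l ^ n * proj f x = \<nu> * f x"
        by eventually_elim simp
    next
      assume "AE x in M. l ^ n * proj f x = \<nu> * f x"
      with pow[OF sq_integrable_integrable[OF that]] show "AE x in M. (A ^^ n) f x = \<nu> * f x"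
        by eventually_elim simp
    qed
    then show ?thesis unfolding eigenfunctions_def mem_Collect_eq sq_integrable_def by blast
  qed
  have eq: "eigenfunctions M (A ^^ n) (l ^ n) = range_space"
    using l by (auto simp: ef range_space_def)
  have mult: "real (eigen_mult M (A ^^ n) (l ^ n)) = \<kappa>"
    using rank_eq_diagonal unfolding eigen_mult_def orthonormal_in_range_def eq by simp
  have mult0: "eigen_mult M (A ^^ n) \<nu> = 0" if \<nu>: "\<nu> \<noteq> 0" "\<nu> \<noteq> l ^ n" for \<nu>
  proof -
    have zero: "AE x in M. f x = 0" if f: "f \<in> eigenfunctions M (A ^^ n) \<nu>" for f
    proof -
      have f2: "sq_integrable M f" and ae: "AE x in M. l ^ n * proj f x = \<nu> * f x" using f ef by auto
      have fm [measurable]: "f \<in> borel_measurable M" using f2 by (simp add: sq_integrable_def)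
      have "proj f x = 0" if x: "x \<in> space M" for x
      proof -
        have "l ^ n * proj f x = proj (\<lambda>x. l ^ n * proj f x) x"
          unfolding proj_cmult using proj_idempotent[OF sq_integrable_integrable[OF f2] x] by simp
        also have "\<dots> = proj (\<lambda>x. \<nu> * f x) x" by (intro proj_cong ae x) measurable
        also have "\<dots> = \<nu> * proj f x" by (rule proj_cmult)
        finally show ?thesis using \<nu> by simp
      qed
      then show ?thesis using ae AE_space by (auto elim!: eventually_elim2 simp: \<nu>)
    qed
    let ?S = "{r. \<exists>e :: nat \<Rightarrow> 'a \<Rightarrow> real. (\<forall>i<r. e i \<in> eigenfunctions M (A ^^ n) \<nu>) \<and>
             (\<forall>i<r. \<forall>j<r. (\<integral>x. e i x * e j x \<partial>M) = (if i = j then 1 else 0))}"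
    have "?S = {0}"
    proof (intro set_eqI iffI)
      fix r assume "r \<in> ?S"
      then obtain e where e: "\<forall>i<r. e i \<in> eigenfunctions M (A ^^ n) \<nu>"
        "\<forall>i<r. \<forall>j<r. (\<integral>x. e i x * e j x \<partial>M) = (if i = j then 1 else (0::real))" by blast
      have "r = 0"
      proof (rule ccontr)
        assume "r \<noteq> 0"
        then have r: "0 < r" by simp
        have "AE x in M. e 0 x * e 0 x = 0" using zero[of "e 0"] e(1) r by auto
        then have "(\<integral>x. e 0 x * e 0 x \<partial>M) = 0" by (rule integral_eq_zero_AE)
        then show False using e(2) r by auto
      qed
      then show "r \<in> {0}" by simp
    qed auto
    then show ?thesis unfolding eigen_mult_def by (simp add: Sup_nat_def)
  qed
  have "op_trace M (A ^^ n) = real (eigen_mult M (A ^^ n) (l ^ n)) * l ^ n"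
    unfolding op_trace_def by (rule infsum_single) (use l mult0 in auto)
  then show ?thesis by (simp add: mult)
qed

end

section \<open>The spectrum of the quartic kernel\<close>

text \<open>
  The measure on the sphere lives on the whole ambient space.  Moving the null set of points off the
  sphere to a fixed pole turns bounds and identities that hold on the sphere into ones that hold
  everywhere.
\<close>

definition sphere_retract :: "nat \<Rightarrow> (nat \<Rightarrow> real) \<Rightarrow> (nat \<Rightarrow> real)" where
  "sphere_retract d x = (if inner_d d x x = 1 then x else (\<lambda>i\<in>{..<d}. if i = 0 then 1 else 0))"

lemma sphere_retract_measurable [measurable]:
  assumes "f \<in> measurable N (unif_sphere d)"
  shows "(\<lambda>x. sphere_retract d (f x)) \<in> measurable N (borel_d d)"
proof -
  have [measurable]: "f \<in> measurable N (borel_d d)" using assms by (simp cong: measurable_cong_sets)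
  have [measurable]: "(\<lambda>i\<in>{..<d}. if i = 0 then 1 else 0) \<in> space (borel_d d)" by (simp add: space_PiM)
  show ?thesis unfolding sphere_retract_def by measurable
qed

lemma sphere_retract_norm: "d > 0 \<Longrightarrow> inner_d d (sphere_retract d x) (sphere_retract d x) = 1"
proof -
  assume d: "d > 0"
  have "inner_d d (\<lambda>i\<in>{..<d}. if i = 0 then 1 else 0) (\<lambda>i\<in>{..<d}. if i = 0 then 1 else 0) = (\<Sum>i<d. if i = 0 then 1 else 0)"
    unfolding inner_d_def by (intro sum.cong) auto
  then show ?thesis using d by (simp add: sphere_retract_def)
qed

lemma sphere_retract_id: "inner_d d x x = 1 \<Longrightarrow> sphere_retract d x = x"
  by (simp add: sphere_retract_def)

lemma AE_sphere_retract: "d > 0 \<Longrightarrow> AE x in unif_sphere d. sphere_retract d x = x"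
  using AE_unif_sphere[of d] by (auto elim!: eventually_mono simp: sphere_retract_id)

lemma P4_measurable [measurable]: "P4 d \<in> borel_measurable borel"
  unfolding P4_def by measurable

lemma inner_d_measurable_unif [measurable]:
  "f \<in> measurable M (unif_sphere d) \<Longrightarrow> g \<in> measurable M (unif_sphere d) \<Longrightarrow>
     (\<lambda>x. inner_d d (f x) (g x)) \<in> borel_measurable M"
  using inner_d_measurable[of f M d g] by (simp cong: measurable_cong_sets)

definition P4_kernel :: "nat \<Rightarrow> (nat \<Rightarrow> real) \<Rightarrow> (nat \<Rightarrow> real) \<Rightarrow> real" where
  "P4_kernel d x y = P4 d (inner_d d (sphere_retract d x) (sphere_retract d y))"

lemma P4_kernel_measurable [measurable]:
  assumes "f \<in> measurable N (unif_sphere d)" "g \<in> measurable N (unif_sphere d)"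
  shows "(\<lambda>x. P4_kernel d (f x) (g x)) \<in> borel_measurable N"
proof -
  note assms[measurable]
  have "(\<lambda>x. inner_d d (sphere_retract d (f x)) (sphere_retract d (g x))) \<in> borel_measurable N"
    by (intro inner_d_measurable sphere_retract_measurable assms)
  then show ?thesis unfolding P4_kernel_def by measurable
qed

lemma P4_kernel_sym: "P4_kernel d x y = P4_kernel d y x"
  by (simp add: P4_kernel_def inner_d_commute)

lemma P4_kernel_diag: "d \<ge> 3 \<Longrightarrow> P4_kernel d x x = 1"
  by (simp add: P4_kernel_def sphere_retract_norm P4_1)

lemma abs_P4_kernel_le_1: "d \<ge> 3 \<Longrightarrow> \<bar>P4_kernel d x y\<bar> \<le> 1"
  unfolding P4_kernel_def by (intro abs_P4_le_1 inner_d_sphere_le_1 sphere_retract_norm) auto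

lemma P4_kernel_reproducing:
  assumes d: "d \<ge> 3"
  shows "(\<integral>y. P4_kernel d x y * P4_kernel d y z \<partial>unif_sphere d) = P4_kernel d x z / harmonic_dim d"
proof -
  have d0: "d > 0" using d by simp
  have "(\<integral>y. P4_kernel d x y * P4_kernel d y z \<partial>unif_sphere d)
     = (\<integral>y. P4 d (inner_d d y (sphere_retract d x)) * P4 d (inner_d d y (sphere_retract d z)) \<partial>unif_sphere d)"
  proof (rule integral_cong_AE)
    show "AE y in unif_sphere d. P4_kernel d x y * P4_kernel d y z = P4 d (inner_d d y (sphere_retract d x)) * P4 d (inner_d d y (sphere_retract d z))"
      using AE_sphere_retract[OF d0] by eventually_elim (simp add: P4_kernel_def inner_d_commute)
    have [measurable]: "(\<lambda>u. inner_d d u a) \<in> borel_measurable (unif_sphere d)" for a by simp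
    show "(\<lambda>y. P4 d (inner_d d y (sphere_retract d x)) * P4 d (inner_d d y (sphere_retract d z))) \<in> borel_measurable (unif_sphere d)"
      by measurable
    have [measurable]: "(\<lambda>y. P4_kernel d c y) \<in> borel_measurable (unif_sphere d)" for c
    proof -
      have [measurable]: "(\<lambda>y. sphere_retract d y) \<in> measurable (unif_sphere d) (borel_d d)" by measurable
      show ?thesis unfolding P4_kernel_def inner_d_commute[of d "sphere_retract d c"] by measurable
    qed
    show "(\<lambda>y. P4_kernel d x y * P4_kernel d y z) \<in> borel_measurable (unif_sphere d)"
      unfolding P4_kernel_sym[of d _ z] by measurable
  qed
  also have "\<dots> = P4_kernel d x z / harmonic_dim d"
    unfolding P4_kernel_def by (rule P4_reproducing[OF d sphere_retract_norm[OF d0] sphere_retract_norm[OF d0]])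
  finally show ?thesis .
qed

lemma harmonic_dim_pos: "d \<ge> 3 \<Longrightarrow> harmonic_dim d > 0"
  by (simp add: harmonic_dim_def)

theorem tr_pow_P4:
  assumes d: "d \<ge> 3" and b: "b \<noteq> 0" and r: "r \<ge> 1"
  shows "tr_pow d (\<lambda>t. b * P4 d t) r = harmonic_dim d * (b / harmonic_dim d) ^ r"
proof -
  let ?N = "harmonic_dim d"
  note N = harmonic_dim_pos[OF d]
  interpret prob_space "unif_sphere d" by (rule prob_space_unif_sphere)
  interpret projection_kernel "unif_sphere d" "\<lambda>x y. ?N * P4_kernel d x y" ?N ?N
  proof
    show "(\<lambda>(x, y). ?N * P4_kernel d x y) \<in> borel_measurable (unif_sphere d \<Otimes>\<^sub>M unif_sphere d)"
      by measurable
    show "\<bar>?N * P4_kernel d x y\<bar> \<le> ?N" for x y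
      using N mult_left_le[OF abs_P4_kernel_le_1[OF d, of x y], of ?N] by (simp add: abs_mult)
    show "?N * P4_kernel d x y = ?N * P4_kernel d y x" for x y
      by (simp add: P4_kernel_sym)
    show "(\<integral>y. ?N * P4_kernel d x y * (?N * P4_kernel d y z) \<partial>unif_sphere d) = ?N * P4_kernel d x z" for x z
    proof -
      have "(\<integral>y. ?N * P4_kernel d x y * (?N * P4_kernel d y z) \<partial>unif_sphere d)
        = (\<integral>y. ?N * ?N * (P4_kernel d x y * P4_kernel d y z) \<partial>unif_sphere d)"
        by (intro Bochner_Integration.integral_cong) auto
      also have "\<dots> = ?N * ?N * (P4_kernel d x z / ?N)" by (simp add: P4_kernel_reproducing[OF d])
      finally show ?thesis using N by simp
    qed
    show "?N * P4_kernel d x x = ?N" for x by (simp add: P4_kernel_diag[OF d])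
  qed
  show ?thesis
    unfolding tr_pow_def
  proof (rule op_trace_power[where k="\<lambda>x y. b * P4 d (inner_d d x y)" and S="{x. inner_d d x x = 1}"])
    show "kernel_op d (\<lambda>t. b * P4 d t) f x = (\<integral>y. b * P4 d (inner_d d x y) * f y \<partial>unif_sphere d)" for f x
      by (simp add: kernel_op_def)
    show "AE x in unif_sphere d. x \<in> {x. inner_d d x x = 1}" using AE_unif_sphere[of d] d by simp
    show "b * P4 d (inner_d d x y) = b / ?N * (?N * P4_kernel d x y)"
      if "x \<in> {x. inner_d d x x = 1}" "y \<in> {x. inner_d d x x = 1}" for x y
      using that N by (simp add: P4_kernel_def sphere_retract_id)
    show "(\<lambda>(x, y). b * P4 d (inner_d d x y)) \<in> borel_measurable (unif_sphere d \<Otimes>\<^sub>M unif_sphere d)"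
      by measurable
  qed (use b N r in auto)
qed

section \<open>Random graphs with independent edges\<close>

lemma finite_vertex_pairs [simp]: "finite (vertex_pairs n)"
  by (rule finite_subset[of _ "{1..n} \<times> {1..n}"]) (auto simp: vertex_pairs_def)

definition edge_sign :: "'e set \<Rightarrow> 'e \<Rightarrow> real" where
  "edge_sign A e = (if e \<in> A then 1 else -1)"

text \<open>
  Up to the factor \<open>2 ^ card E\<close>, the probability of the edge set \<open>A\<close> when each \<open>e\<close> is present with
  probability \<open>(1 + u e) / 2\<close>; this is the likelihood ratio against fair coin flips.
\<close>

definition edge_weight :: "'e set \<Rightarrow> ('e \<Rightarrow> real) \<Rightarrow> 'e set \<Rightarrow> real" where
  "edge_weight E u A = (\<Prod>e\<in>E. 1 + edge_sign A e * u e)"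

lemma edge_sign_square [simp]: "(edge_sign A e)\<^sup>2 = 1" "edge_sign A e * edge_sign A e = 1"
  by (simp_all add: edge_sign_def)

lemma abs_edge_sign [simp]: "\<bar>edge_sign A e\<bar> = 1"
  by (simp add: edge_sign_def)

lemma edge_weight_nonneg:
  assumes "\<And>e. e \<in> E \<Longrightarrow> \<bar>u e\<bar> \<le> 1"
  shows "edge_weight E u A \<ge> 0"
  unfolding edge_weight_def
proof (intro prod_nonneg ballI)
  fix e assume "e \<in> E"
  then have "\<bar>u e\<bar> \<le> 1" by (rule assms)
  then show "0 \<le> 1 + edge_sign A e * u e" by (auto simp: edge_sign_def)
qed

lemma sum_Pow_insert:
  assumes "finite E" "x \<notin> E"
  shows "(\<Sum>A\<in>Pow (insert x E). g A) = (\<Sum>A\<in>Pow E. g A + g (insert x A))"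
proof -
  have "(\<Sum>A\<in>Pow (insert x E). g A) = (\<Sum>A\<in>Pow E. g A) + (\<Sum>A\<in>insert x ` Pow E. g A)"
    unfolding Pow_insert using assms by (intro sum.union_disjoint) auto
  also have "(\<Sum>A\<in>insert x ` Pow E. g A) = (\<Sum>A\<in>Pow E. g (insert x A))"
    using assms by (subst sum.reindex) (auto simp: inj_on_def o_def)
  finally show ?thesis by (simp add: sum.distrib)
qed

lemma edge_weight_insert:
  assumes "finite E" "x \<notin> E" "A \<subseteq> E"
  shows "edge_weight (insert x E) u A = (1 - u x) * edge_weight E u A"
    and "edge_weight (insert x E) u (insert x A) = (1 + u x) * edge_weight E u A"
proof -
  have "edge_sign (insert x A) e = edge_sign A e" if "e \<in> E" for e
    using that assms by (auto simp: edge_sign_def)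
  then have "(\<Prod>e\<in>E. 1 + edge_sign (insert x A) e * u e) = (\<Prod>e\<in>E. 1 + edge_sign A e * u e)"
    by (intro prod.cong) auto
  then show "edge_weight (insert x E) u A = (1 - u x) * edge_weight E u A"
    and "edge_weight (insert x E) u (insert x A) = (1 + u x) * edge_weight E u A"
    using assms by (auto simp: edge_weight_def edge_sign_def)
qed

text \<open>
  Normalization, centring and variance of the linear statistic \<open>\<Sum>e. a e * (edge_sign A e - u e)\<close>, as
  finite identities; the three are proved together by adding one edge at a time.
\<close>

lemma edge_weight_moments:
  fixes a u :: "'e \<Rightarrow> real"
  assumes "finite E"
  defines "T \<equiv> \<lambda>E A. \<Sum>e\<in>E. a e * (edge_sign A e - u e)"
  shows "(\<Sum>A\<in>Pow E. edge_weight E u A) = 2 ^ card E"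
    and "(\<Sum>A\<in>Pow E. edge_weight E u A * T E A) = 0"
    and "(\<Sum>A\<in>Pow E. edge_weight E u A * (T E A)\<^sup>2) = 2 ^ card E * (\<Sum>e\<in>E. (a e)\<^sup>2 * (1 - (u e)\<^sup>2))"
  using assms(1)
proof (induction E)
  case empty
  case 1 show ?case by (simp add: edge_weight_def)
  case 2 show ?case by (simp add: T_def)
  case 3 show ?case by (simp add: T_def)
next
  case (insert x E)
  have T1: "T (insert x E) A = a x * (- 1 - u x) + T E A"
    and T2: "T (insert x E) (insert x A) = a x * (1 - u x) + T E A" if "A \<in> Pow E" for A
  proof -
    have "(\<Sum>e\<in>E. a e * (edge_sign (insert x A) e - u e)) = (\<Sum>e\<in>E. a e * (edge_sign A e - u e))"
      using that insert by (intro sum.cong) (auto simp: edge_sign_def)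
    then show "T (insert x E) A = a x * (- 1 - u x) + T E A"
      and "T (insert x E) (insert x A) = a x * (1 - u x) + T E A"
      using that insert by (auto simp: T_def edge_sign_def)
  qed
  note w = edge_weight_insert[OF insert.hyps]
  have c: "2 ^ card (insert x E) = 2 * (2::real) ^ card E" using insert by simp
  case 1
  have "(\<Sum>A\<in>Pow (insert x E). edge_weight (insert x E) u A) = (\<Sum>A\<in>Pow E. 2 * edge_weight E u A)"
    unfolding sum_Pow_insert[OF insert.hyps] by (intro sum.cong) (auto simp: w algebra_simps)
  then show ?case unfolding c using insert.IH(1) by (simp add: sum_distrib_left[symmetric])
  case 2
  have "(\<Sum>A\<in>Pow (insert x E). edge_weight (insert x E) u A * T (insert x E) A) = (\<Sum>A\<in>Pow E. 2 * (edge_weight E u A * T E A))"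
    unfolding sum_Pow_insert[OF insert.hyps] by (intro sum.cong) (auto simp: w T1 T2 algebra_simps)
  then show ?case using insert.IH(2) by (simp add: sum_distrib_left[symmetric])
  case 3
  have "(\<Sum>A\<in>Pow (insert x E). edge_weight (insert x E) u A * (T (insert x E) A)\<^sup>2)
     = (\<Sum>A\<in>Pow E. 2 * (edge_weight E u A * (T E A)\<^sup>2) + 2 * ((a x)\<^sup>2 * (1 - (u x)\<^sup>2)) * edge_weight E u A)"
    unfolding sum_Pow_insert[OF insert.hyps]
    by (intro sum.cong) (auto simp: w T1 T2 algebra_simps power2_eq_square)
  also have "\<dots> = 2 * (\<Sum>A\<in>Pow E. edge_weight E u A * (T E A)\<^sup>2) + 2 * ((a x)\<^sup>2 * (1 - (u x)\<^sup>2)) * (\<Sum>A\<in>Pow E. edge_weight E u A)"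
    by (simp add: sum.distrib sum_distrib_left)
  also have "\<dots> = 2 ^ card (insert x E) * (\<Sum>e\<in>insert x E. (a e)\<^sup>2 * (1 - (u e)\<^sup>2))"
    unfolding insert.IH c using insert.hyps by (simp add: algebra_simps)
  finally show ?case .
qed

lemma pmf_indep_edges:
  assumes "A \<subseteq> vertex_pairs n"
  shows "pmf (indep_edges n p) A = (\<Prod>e\<in>vertex_pairs n. pmf (bernoulli_pmf (p e)) (e \<in> A))"
proof -
  let ?f = "\<lambda>\<omega>. {e \<in> vertex_pairs n. \<omega> e}"
  have vimage: "?f -` {A} = Pi (vertex_pairs n) (\<lambda>e. {e \<in> A})"
  proof (rule set_eqI)
    fix \<omega>
    have "?f \<omega> = A \<longleftrightarrow> (\<forall>e\<in>vertex_pairs n. \<omega> e = (e \<in> A))"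
      using assms by blast
    then show "\<omega> \<in> ?f -` {A} \<longleftrightarrow> \<omega> \<in> Pi (vertex_pairs n) (\<lambda>e. {e \<in> A})"
      unfolding Pi_def Ball_def by (simp del: split_paired_All)
  qed
  have "pmf (indep_edges n p) A
      = measure (measure_pmf (Pi_pmf (vertex_pairs n) False (\<lambda>e. bernoulli_pmf (p e)))) (?f -` {A})"
    unfolding indep_edges_def by (rule pmf_map)
  also have "\<dots> = (\<Prod>e\<in>vertex_pairs n. measure (measure_pmf (bernoulli_pmf (p e))) {e \<in> A})"
    unfolding vimage by (rule measure_Pi_pmf_Pi[OF finite_vertex_pairs])
  also have "\<dots> = (\<Prod>e\<in>vertex_pairs n. pmf (bernoulli_pmf (p e)) (e \<in> A))"
    by (intro prod.cong refl measure_pmf_single)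
  finally show ?thesis .
qed

lemma pmf_indep_edges_weight:
  assumes "A \<subseteq> vertex_pairs n" "\<And>e. e \<in> vertex_pairs n \<Longrightarrow> p e = (1 + u e) / 2" "\<And>e. e \<in> vertex_pairs n \<Longrightarrow> \<bar>u e\<bar> \<le> 1"
  shows "pmf (indep_edges n p) A = edge_weight (vertex_pairs n) u A / 2 ^ card (vertex_pairs n)"
proof -
  have "pmf (indep_edges n p) A = (\<Prod>e\<in>vertex_pairs n. (1 + edge_sign A e * u e) / 2)"
    unfolding pmf_indep_edges[OF assms(1)]
  proof (intro prod.cong refl)
    fix e assume e: "e \<in> vertex_pairs n"
    have "0 \<le> (1 + u e) / 2" "(1 + u e) / 2 \<le> 1" using assms(3)[OF e] by (auto simp: abs_le_iff)
    then show "pmf (bernoulli_pmf (p e)) (e \<in> A) = (1 + edge_sign A e * u e) / 2"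
      unfolding assms(2)[OF e] by (cases "e \<in> A") (auto simp: edge_sign_def field_simps)
  qed
  then show ?thesis by (simp add: prod_dividef edge_weight_def)
qed

lemma measure_indep_edges:
  "measure (measure_pmf (indep_edges n p)) B = (\<Sum>A\<in>Pow (vertex_pairs n) \<inter> B. pmf (indep_edges n p) A)"
proof -
  have "set_pmf (indep_edges n p) \<subseteq> Pow (vertex_pairs n)"
    by (auto simp: indep_edges_def)
  then have "measure (measure_pmf (indep_edges n p)) B = measure (measure_pmf (indep_edges n p)) (Pow (vertex_pairs n) \<inter> B)"
    by (intro measure_pmf.finite_measure_eq_AE) (auto simp: AE_measure_pmf_iff)
  also have "\<dots> = (\<Sum>A\<in>Pow (vertex_pairs n) \<inter> B. pmf (indep_edges n p) A)"
    by (intro measure_measure_pmf_finite) simp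
  finally show ?thesis .
qed

text \<open>
  The type of graphs is uncountable, but only finitely many of them carry mass, and each mass is a product
  of success probabilities, clipped to the unit interval.
\<close>

lemma indep_edges_kernel_measurable:
  assumes p: "\<And>e. e \<in> vertex_pairs n \<Longrightarrow> (\<lambda>X. p X e) \<in> borel_measurable N"
  shows "(\<lambda>X. measure_pmf (indep_edges n (p X))) \<in> measurable N (subprob_algebra (count_space UNIV))"
proof (rule measurable_subprob_algebra)
  fix B :: "(nat \<times> nat) set set"
  have b: "pmf (bernoulli_pmf x) c = (if c then min 1 (max 0 x) else 1 - min 1 (max 0 x))" for x c
    by (simp add: bernoulli_pmf.rep_eq)
  have "(\<lambda>X. \<Prod>e\<in>vertex_pairs n. pmf (bernoulli_pmf (p X e)) (e \<in> A)) \<in> borel_measurable N" for A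
    unfolding b using p by (intro borel_measurable_prod) auto
  then have "(\<lambda>X. pmf (indep_edges n (p X)) A) \<in> borel_measurable N" if "A \<subseteq> vertex_pairs n" for A
    using that by (simp add: pmf_indep_edges)
  then show "(\<lambda>X. emeasure (measure_pmf (indep_edges n (p X))) B) \<in> borel_measurable N"
    unfolding measure_pmf.emeasure_eq_measure measure_indep_edges
    by (intro measurable_compose[OF _ measurable_ennreal] borel_measurable_sum) auto
qed (auto simp: measure_pmf.subprob_space_axioms)

lemma measure_erdos_renyi_half:
  "measure (erdos_renyi_half n) B = real (card (Pow (vertex_pairs n) \<inter> B)) / 2 ^ card (vertex_pairs n)"
proof -
  have "pmf (indep_edges n (\<lambda>_. 1 / 2)) A = 1 / 2 ^ card (vertex_pairs n)" if "A \<subseteq> vertex_pairs n" for A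
    using pmf_indep_edges_weight[OF that, of "\<lambda>_. 1 / 2" "\<lambda>_. 0"] by (simp add: edge_weight_def)
  then show ?thesis by (simp add: erdos_renyi_half_def measure_indep_edges)
qed

lemma TV_le_1:
  assumes "prob_space P" "prob_space Q"
  shows "TV P Q \<le> 1"
proof -
  interpret P: prob_space P by fact
  interpret Q: prob_space Q by fact
  have "\<bar>measure P B - measure Q B\<bar> \<le> 1" for B
    using P.prob_le_1[of B] Q.prob_le_1[of B] measure_nonneg[of P B] measure_nonneg[of Q B] by linarith
  then show ?thesis unfolding TV_def by (intro cSUP_least) auto
qed

lemma TV_ge:
  assumes "prob_space P" "prob_space Q" "B \<in> sets P"
  shows "measure P B - measure Q B \<le> TV P Q"
proof -
  interpret P: prob_space P by fact
  interpret Q: prob_space Q by fact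
  have "\<bar>measure P B - measure Q B\<bar> \<le> 1" for B
    using P.prob_le_1[of B] Q.prob_le_1[of B] measure_nonneg[of P B] measure_nonneg[of Q B] by linarith
  then have "bdd_above ((\<lambda>B. \<bar>measure P B - measure Q B\<bar>) ` sets P)" by (auto intro!: bdd_aboveI[of _ 1])
  then have "\<bar>measure P B - measure Q B\<bar> \<le> TV P Q" unfolding TV_def using assms(3) by (intro cSUP_upper)
  then show ?thesis by linarith
qed

section \<open>Integrals over independent points\<close>

text \<open>
  The derivative of \<open>ln (1 + u) - u + 3/4 u^2\<close> is \<open>u\<close> times a positive factor.  A coefficient below one
  is essential: it is compared with \<open>\<rho>^2\<close>, which is below one.
\<close>

lemma exp_quadratic_le:
  fixes u :: real
  assumes "\<bar>u\<bar> \<le> 1 / 4"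
  shows "exp (u - 3 / 4 * u\<^sup>2) \<le> 1 + u"
proof -
  define f where "f = (\<lambda>u::real. ln (1 + u) - u + 3 / 4 * u\<^sup>2)"
  define f' where "f' = (\<lambda>u::real. u * (3 / 2 - 1 / (1 + u)))"
  have der: "(f has_real_derivative f' x) (at x)" if "\<bar>x\<bar> \<le> 1 / 4" for x
  proof -
    have "1 + x > 0" using that by linarith
    then show ?thesis unfolding f_def f'_def
      by (auto intro!: derivative_eq_intros simp: field_simps)
  qed
  have fac: "3 / 2 - 1 / (1 + x) \<ge> 0" if "\<bar>x\<bar> \<le> 1 / 4" for x :: real
  proof -
    have "1 + x \<ge> 3 / 4" using that by linarith
    then show ?thesis by (simp add: field_simps)
  qed
  have "f 0 \<le> f u"
  proof (cases "u \<ge> 0")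
    case True
    show ?thesis
    proof (rule DERIV_nonneg_imp_nondecreasing[OF True])
      fix x assume "0 \<le> x" "x \<le> u"
      then show "\<exists>y. (f has_real_derivative y) (at x) \<and> 0 \<le> y"
        using der[of x] fac[of x] assms by (intro exI[of _ "f' x"]) (auto simp: f'_def intro!: mult_nonneg_nonneg)
    qed
  next
    case False
    then have "u \<le> 0" by simp
    then show ?thesis
    proof (rule DERIV_nonpos_imp_nonincreasing)
      fix x assume "u \<le> x" "x \<le> 0"
      then show "\<exists>y. (f has_real_derivative y) (at x) \<and> y \<le> 0"
        using der[of x] fac[of x] assms by (intro exI[of _ "f' x"]) (auto simp: f'_def intro!: mult_nonpos_nonneg)
    qed
  qed
  then have "u - 3 / 4 * u\<^sup>2 \<le> ln (1 + u)" by (simp add: f_def)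
  then have "exp (u - 3 / 4 * u\<^sup>2) \<le> exp (ln (1 + u))" by simp
  then show ?thesis using assms by (simp add: abs_le_iff)
qed

lemma (in finite_measure) integrable_bounded:
  fixes f :: "'a \<Rightarrow> real"
  assumes "f \<in> borel_measurable M" "\<And>x. x \<in> space M \<Longrightarrow> \<bar>f x\<bar> \<le> C"
  shows "integrable M f"
  by (rule integrable_const_bound[where B=C]) (use assms in auto)

lemma integral_swap_bounded:
  fixes f :: "'a \<Rightarrow> 'b \<Rightarrow> real"
  assumes "prob_space M" "prob_space N"
    and f: "(\<lambda>(x, y). f x y) \<in> borel_measurable (M \<Otimes>\<^sub>M N)"
    and C: "\<And>x y. x \<in> space M \<Longrightarrow> y \<in> space N \<Longrightarrow> \<bar>f x y\<bar> \<le> C"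
  shows "(\<integral>y. \<integral>x. f x y \<partial>M \<partial>N) = (\<integral>x. \<integral>y. f x y \<partial>N \<partial>M)"
proof -
  interpret M: prob_space M by fact
  interpret N: prob_space N by fact
  interpret P: pair_prob_space M N ..
  show ?thesis
  proof (rule P.Fubini_integral)
    show "integrable (M \<Otimes>\<^sub>M N) (\<lambda>(x, y). f x y)"
      using f by (rule P.integrable_bounded[where C=C]) (auto simp: space_pair_measure C)
  qed
qed

lemma integral_PiM_remove:
  fixes f :: "('i \<Rightarrow> 'a) \<Rightarrow> real"
  assumes PS: "\<And>i. prob_space (N i)" and I: "finite I" "i \<in> I"
    and f: "f \<in> borel_measurable (PiM I N)"
    and C: "\<And>\<omega>. \<omega> \<in> space (PiM I N) \<Longrightarrow> \<bar>f \<omega>\<bar> \<le> C"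
  shows "(\<integral>\<omega>. f \<omega> \<partial>PiM I N) = (\<integral>\<omega>. (\<integral>x. f (fun_upd \<omega> i x) \<partial>N i) \<partial>PiM (I - {i}) N)"
proof -
  interpret Q: prob_space "PiM I N" using PS by (rule prob_space_PiM)
  interpret product_prob_space N I using PS by (rule product_prob_spaceI)
  have I': "insert i (I - {i}) = I" using I by auto
  have "integrable (PiM I N) f" using f C by (rule Q.integrable_bounded)
  then show ?thesis using product_integral_insert[of "I - {i}" i f] I by (simp add: I' insert_absorb)
qed

lemma integral_PiM_pair:
  fixes f :: "'a \<Rightarrow> 'a \<Rightarrow> real"
  assumes PS: "\<And>i. prob_space (N i)" and I: "finite I" "i \<in> I" "j \<in> I" "i \<noteq> j"
    and f: "(\<lambda>(x, y). f x y) \<in> borel_measurable (N i \<Otimes>\<^sub>M N j)"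
    and C: "\<And>x y. x \<in> space (N i) \<Longrightarrow> y \<in> space (N j) \<Longrightarrow> \<bar>f x y\<bar> \<le> C"
  shows "(\<integral>\<omega>. f (\<omega> i) (\<omega> j) \<partial>PiM I N) = (\<integral>y. \<integral>x. f x y \<partial>N i \<partial>N j)"
proof -
  interpret Ni: prob_space "N i" by (rule PS)
  interpret Nj: prob_space "N j" by (rule PS)
  interpret R: prob_space "PiM (I - {i} - {j}) N" using PS by (rule prob_space_PiM)
  have fm [measurable]: "(\<lambda>\<omega>. f (g \<omega>) (h \<omega>)) \<in> borel_measurable L"
    if "g \<in> measurable L (N i)" "h \<in> measurable L (N j)" for g h and L :: "'c measure"
    using measurable_compose[OF measurable_Pair f, of g L h] that by simp
  define F where "F y = (\<integral>x. f x y \<partial>N i)" for y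
  have Fm: "F \<in> borel_measurable (N j)"
  proof -
    have "(\<lambda>(y, x). f x y) \<in> borel_measurable (N j \<Otimes>\<^sub>M N i)" by measurable
    then show ?thesis unfolding F_def by measurable
  qed
  have FC: "\<bar>F y\<bar> \<le> C" if y: "y \<in> space (N j)" for y
  proof -
    have "\<bar>F y\<bar> \<le> (\<integral>x. \<bar>f x y\<bar> \<partial>N i)" unfolding F_def by (rule integral_abs_bound)
    also have "\<dots> \<le> (\<integral>x. C \<partial>N i)"
    proof (rule integral_mono)
      have "integrable (N i) (\<lambda>x. f x y)"
        using C[OF _ y] y by (intro Ni.integrable_bounded[where C=C]) auto
      then show "integrable (N i) (\<lambda>x. \<bar>f x y\<bar>)" by simp
    qed (use C y in auto)
    finally show ?thesis by (simp add: Ni.prob_space)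
  qed
  have sp: "\<omega> k \<in> space (N k)" if "\<omega> \<in> space (PiM J N)" "k \<in> J" for \<omega> k J
    using that by (auto simp: space_PiM)
  have "(\<integral>\<omega>. f (\<omega> i) (\<omega> j) \<partial>PiM I N) = (\<integral>\<omega>. (\<integral>x. f ((fun_upd \<omega> i x) i) ((fun_upd \<omega> i x) j) \<partial>N i) \<partial>PiM (I - {i}) N)"
    using I by (intro integral_PiM_remove[OF PS I(1,2), where C=C] C) (auto simp: sp)
  also have "\<dots> = (\<integral>\<omega>. F (\<omega> j) \<partial>PiM (I - {i}) N)" using I by (simp add: F_def)
  also have "\<dots> = (\<integral>\<omega>. (\<integral>y. F ((fun_upd \<omega> j y) j) \<partial>N j) \<partial>PiM (I - {i} - {j}) N)"
    using I Fm by (intro integral_PiM_remove[OF PS, where C=C] FC) (auto simp: sp)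
  also have "\<dots> = (\<integral>y. F y \<partial>N j)" by (simp add: R.prob_space)
  finally show ?thesis by (simp add: F_def)
qed

section \<open>Tilting the likelihood ratio\<close>

text \<open>Keeps the index set \<open>{1..n}\<close> in this form.\<close>

declare One_nat_def [simp del]

text \<open>
  The situation behind the lower bound on the total variation distance: \<open>\<kappa>\<close> is the connection kernel,
  \<open>h\<close> its squared norm, the same from every point, and \<open>q\<close> is a symmetric Markov density, bounded by
  \<open>Q\<close>, of which \<open>\<kappa>\<close> is an eigenfunction with eigenvalue \<open>\<rho>\<close>.
\<close>

locale planted_kernel = prob_space M for M :: "'a measure" +
  fixes \<kappa> q :: "'a \<Rightarrow> 'a \<Rightarrow> real" and h \<rho> Q \<beta> :: real
  assumes kappa_meas: "(\<lambda>(x, y). \<kappa> x y) \<in> borel_measurable (M \<Otimes>\<^sub>M M)"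
    and q_meas: "(\<lambda>(x, y). q x y) \<in> borel_measurable (M \<Otimes>\<^sub>M M)"
    and kappa_bound: "\<bar>\<kappa> x y\<bar> \<le> \<beta>" and beta_le: "\<beta> \<le> 1 / 4"
    and kappa_sym: "\<kappa> x y = \<kappa> y x"
    and kappa_var: "x \<in> space M \<Longrightarrow> (\<integral>y. (\<kappa> x y)\<^sup>2 \<partial>M) = h"
    and q_nonneg: "0 \<le> q x y" and q_le: "q x y \<le> Q"
    and q_sym: "q x y = q y x"
    and q_prob: "x \<in> space M \<Longrightarrow> (\<integral>y. q x y \<partial>M) = 1"
    and q_eigen: "x \<in> space M \<Longrightarrow> z \<in> space M \<Longrightarrow> (\<integral>y. q x y * \<kappa> y z \<partial>M) = \<rho> * \<kappa> x z"
    and rho: "0 \<le> \<rho>" "\<rho> \<le> 1"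
begin

lemma kappa_measurable [measurable]:
  "f \<in> measurable N M \<Longrightarrow> g \<in> measurable N M \<Longrightarrow> (\<lambda>x. \<kappa> (f x) (g x)) \<in> borel_measurable N"
  using measurable_compose[OF measurable_Pair kappa_meas, of f N g] by simp

lemma q_measurable [measurable]:
  "f \<in> measurable N M \<Longrightarrow> g \<in> measurable N M \<Longrightarrow> (\<lambda>x. q (f x) (g x)) \<in> borel_measurable N"
  using measurable_compose[OF measurable_Pair q_meas, of f N g] by simp

lemma beta_nonneg: "0 \<le> \<beta>"
  using abs_ge_zero kappa_bound by (rule order_trans)

lemma Q_nonneg: "0 \<le> Q"
  using q_nonneg q_le by (rule order_trans)

lemma kappa_sq_bound: "(\<kappa> x y)\<^sup>2 \<le> \<beta>\<^sup>2"
  using power_mono[OF kappa_bound[of x y], of 2] by simp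

lemma h_bounds: "0 \<le> h" "h \<le> \<beta>\<^sup>2"
proof -
  obtain x where x: "x \<in> space M" using not_empty by blast
  have "(\<integral>y. (\<kappa> x y)\<^sup>2 \<partial>M) \<le> (\<integral>y. \<beta>\<^sup>2 \<partial>M)"
    using x by (intro integral_mono integrable_bounded[where C="\<beta>\<^sup>2"]) (auto simp: kappa_sq_bound)
  then show "h \<le> \<beta>\<^sup>2" by (simp add: kappa_var[OF x] prob_space)
  show "0 \<le> h" unfolding kappa_var[OF x, symmetric] by simp
qed

lemma integrable_q: "x \<in> space M \<Longrightarrow> integrable M (q x)"
  by (rule integrable_bounded[where C=Q]) (auto simp: q_nonneg q_le)

definition tilted :: "'a \<Rightarrow> 'a measure" where
  "tilted x = density M (\<lambda>y. ennreal (q x y))"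

lemma tilted_space [simp]: "space (tilted x) = space M" and tilted_sets [simp, measurable_cong]: "sets (tilted x) = sets M"
  by (simp_all add: tilted_def)

lemma prob_space_tilted: "x \<in> space M \<Longrightarrow> prob_space (tilted x)"
proof
  assume x: "x \<in> space M"
  have "emeasure (tilted x) (space (tilted x)) = (\<integral>\<^sup>+y. ennreal (q x y) \<partial>M)"
    using x by (simp add: tilted_def emeasure_density cong: nn_integral_cong)
  also have "\<dots> = ennreal (\<integral>y. q x y \<partial>M)"
    using integrable_q[OF x] by (intro nn_integral_eq_integral) (auto simp: q_nonneg)
  finally show "emeasure (tilted x) (space (tilted x)) = 1" by (simp add: q_prob x)
qed

lemma integral_tilted:
  assumes "x \<in> space M" "f \<in> borel_measurable M"
  shows "(\<integral>y. f y \<partial>tilted x) = (\<integral>y. q x y * f y \<partial>M)"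
  unfolding tilted_def using assms by (subst integral_density) (auto simp: q_nonneg)

text \<open>
  The second moment of the kernel when both points are tilted; \<open>tilted_kappa_mean\<close> is the corresponding
  first moment.
\<close>

definition smoothed :: "'a \<Rightarrow> 'a \<Rightarrow> real" where
  "smoothed x x' = (\<integral>y'. \<integral>y. (\<kappa> y y')\<^sup>2 \<partial>tilted x \<partial>tilted x')"

definition half_smoothed :: "'a \<Rightarrow> 'a \<Rightarrow> real" where
  "half_smoothed x y' = (\<integral>y. q x y * (\<kappa> y y')\<^sup>2 \<partial>M)"

lemma half_smoothed_measurable [measurable]:
  assumes [measurable]: "f \<in> measurable N M" "g \<in> measurable N M"
  shows "(\<lambda>x. half_smoothed (f x) (g x)) \<in> borel_measurable N"
  unfolding half_smoothed_def by measurable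

lemma q_kappa_bound: "\<bar>q x y * (\<kappa> z w)\<^sup>2\<bar> \<le> Q * (\<beta>\<^sup>2)"
  using q_nonneg q_le kappa_sq_bound Q_nonneg by (simp add: abs_mult mult_mono abs_of_nonneg)

lemma half_smoothed_bounds:
  assumes x: "x \<in> space M" "y' \<in> space M"
  shows "0 \<le> half_smoothed x y'" "half_smoothed x y' \<le> \<beta>\<^sup>2"
proof -
  show "0 \<le> half_smoothed x y'" unfolding half_smoothed_def by (simp add: q_nonneg)
  have "half_smoothed x y' \<le> (\<integral>y. q x y * (\<beta>\<^sup>2) \<partial>M)"
    unfolding half_smoothed_def
  proof (rule integral_mono)
    show "integrable M (\<lambda>y. q x y * (\<kappa> y y')\<^sup>2)"
      using x by (intro integrable_bounded[OF _ q_kappa_bound]) measurable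
  qed (use integrable_q[OF x(1)] in \<open>auto intro!: mult_left_mono kappa_sq_bound simp: q_nonneg\<close>)
  then show "half_smoothed x y' \<le> \<beta>\<^sup>2" by (simp add: q_prob x)
qed

lemma smoothed_eq:
  assumes x: "x \<in> space M" "x' \<in> space M"
  shows "smoothed x x' = (\<integral>y'. q x' y' * half_smoothed x y' \<partial>M)"
proof -
  have "smoothed x x' = (\<integral>y'. half_smoothed x y' \<partial>tilted x')"
    unfolding smoothed_def half_smoothed_def
    by (intro Bochner_Integration.integral_cong refl integral_tilted x) (use x in auto)
  also have "\<dots> = (\<integral>y'. q x' y' * half_smoothed x y' \<partial>M)"
    by (rule integral_tilted) (use x in auto)
  finally show ?thesis .
qed

lemma smoothed_bounds:
  assumes x: "x \<in> space M" "x' \<in> space M"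
  shows "0 \<le> smoothed x x'" "smoothed x x' \<le> \<beta>\<^sup>2"
proof -
  have bd: "q x' y' * half_smoothed x y' \<le> Q * (\<beta>\<^sup>2)" "0 \<le> q x' y' * half_smoothed x y'" if "y' \<in> space M" for y'
    using half_smoothed_bounds[OF x(1) that] q_nonneg q_le Q_nonneg by (auto intro!: mult_mono simp del: times_divide_eq_right)
  show "0 \<le> smoothed x x'" unfolding smoothed_eq[OF x]
    by (intro integral_nonneg_AE AE_I2 bd)
  have "smoothed x x' \<le> (\<integral>y. q x' y * (\<beta>\<^sup>2) \<partial>M)"
    unfolding smoothed_eq[OF x]
  proof (rule integral_mono)
    show "integrable M (\<lambda>y'. q x' y' * half_smoothed x y')"
      using x bd by (intro integrable_bounded[where C="Q * (\<beta>\<^sup>2)"]) (auto simp: abs_of_nonneg)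
    show "integrable M (\<lambda>y. q x' y * (\<beta>\<^sup>2))" using integrable_q[OF x(2)] by simp
    show "q x' y * half_smoothed x y \<le> q x' y * (\<beta>\<^sup>2)" if "y \<in> space M" for y
      using half_smoothed_bounds[OF x(1) that] by (intro mult_left_mono q_nonneg)
  qed
  then show "smoothed x x' \<le> \<beta>\<^sup>2" by (simp add: q_prob x)
qed

lemma smoothed_sym:
  assumes x: "x \<in> space M" "x' \<in> space M"
  shows "smoothed x x' = smoothed x' x"
proof -
  have "smoothed x x' = (\<integral>y. \<integral>y'. (\<kappa> y y')\<^sup>2 \<partial>tilted x' \<partial>tilted x)"
    unfolding smoothed_def
    by (rule integral_swap_bounded[where C="\<beta>\<^sup>2"]) (auto simp: prob_space_tilted x kappa_sq_bound)
  also have "\<dots> = smoothed x' x" unfolding smoothed_def by (simp add: kappa_sym)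
  finally show ?thesis .
qed

text \<open>
  Stationarity: by symmetry of \<open>q\<close>, tilting a uniform point leaves it uniform.
\<close>

lemma smoothed_mean:
  assumes x: "x \<in> space M"
  shows "(\<integral>x'. smoothed x x' \<partial>M) = h"
proof -
  have "(\<integral>x'. smoothed x x' \<partial>M) = (\<integral>x'. \<integral>y'. q x' y' * half_smoothed x y' \<partial>M \<partial>M)"
    by (intro Bochner_Integration.integral_cong refl smoothed_eq x)
  also have "\<dots> = (\<integral>y'. \<integral>x'. q x' y' * half_smoothed x y' \<partial>M \<partial>M)"
  proof (rule integral_swap_bounded[symmetric, where C="Q * (\<beta>\<^sup>2)"])
    show "\<bar>q x' y' * half_smoothed x y'\<bar> \<le> Q * (\<beta>\<^sup>2)" if "x' \<in> space M" "y' \<in> space M" for x' y'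
      using half_smoothed_bounds[OF x that(2)] q_nonneg q_le Q_nonneg
      unfolding abs_mult by (intro mult_mono) auto
  qed (use x in \<open>auto simp: prob_space_axioms\<close>)
  also have "\<dots> = (\<integral>y'. half_smoothed x y' \<partial>M)"
    by (intro Bochner_Integration.integral_cong refl) (simp add: q_sym[of _ y' for y'] q_prob)
  also have "\<dots> = (\<integral>y. \<integral>y'. q x y * (\<kappa> y y')\<^sup>2 \<partial>M \<partial>M)"
    unfolding half_smoothed_def
    by (rule integral_swap_bounded[where C="Q * (\<beta>\<^sup>2)"]) (use x q_kappa_bound in \<open>auto simp: prob_space_axioms\<close>)
  also have "\<dots> = (\<integral>y. q x y * h \<partial>M)"
    by (intro Bochner_Integration.integral_cong refl) (simp add: kappa_var)
  finally show ?thesis by (simp add: q_prob x)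
qed

lemma smoothed_measurable [measurable]:
  assumes [measurable]: "f \<in> measurable N M" "g \<in> measurable N M"
  shows "(\<lambda>x. smoothed (f x) (g x)) \<in> borel_measurable N"
proof -
  have sp: "f x \<in> space M" "g x \<in> space M" if "x \<in> space N" for x
    using measurable_space[OF assms(1) that] measurable_space[OF assms(2) that] by auto
  have "(\<lambda>x. \<integral>y'. q (g x) y' * half_smoothed (f x) y' \<partial>M) \<in> borel_measurable N"
    by measurable
  then show ?thesis
    by (rule measurable_cong[THEN iffD2, rotated]) (simp add: smoothed_eq sp)
qed

lemma tilted_kappa_mean:
  assumes x: "x \<in> space M" "x' \<in> space M"
  shows "(\<integral>y'. \<integral>y. \<kappa> y y' \<partial>tilted x \<partial>tilted x') = \<rho>\<^sup>2 * \<kappa> x x'"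
proof -
  have "(\<integral>y'. \<integral>y. \<kappa> y y' \<partial>tilted x \<partial>tilted x') = (\<integral>y'. \<rho> * \<kappa> x y' \<partial>tilted x')"
  proof (intro Bochner_Integration.integral_cong refl)
    fix y' assume "y' \<in> space (tilted x')"
    then have y': "y' \<in> space M" by simp
    have "(\<integral>y. \<kappa> y y' \<partial>tilted x) = (\<integral>y. q x y * \<kappa> y y' \<partial>M)"
      using y' by (intro integral_tilted x) measurable
    then show "(\<integral>y. \<kappa> y y' \<partial>tilted x) = \<rho> * \<kappa> x y'" using q_eigen[OF x(1) y'] by simp
  qed
  also have "\<dots> = \<rho> * (\<integral>y'. q x' y' * \<kappa> y' x \<partial>M)"
    using x by (subst integral_tilted) (auto simp: kappa_sym[of x] mult.left_commute)
  also have "\<dots> = \<rho>\<^sup>2 * \<kappa> x x'"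
    using q_eigen[OF x(2,1)] by (simp add: power2_eq_square kappa_sym[of x'])
  finally show ?thesis .
qed

definition edge_kernel :: "(nat \<Rightarrow> 'a) \<Rightarrow> nat \<times> nat \<Rightarrow> real" where
  "edge_kernel X = (\<lambda>(i, j). \<kappa> (X i) (X j))"

definition edge_smoothed :: "(nat \<Rightarrow> 'a) \<Rightarrow> nat \<times> nat \<Rightarrow> real" where
  "edge_smoothed X = (\<lambda>(i, j). smoothed (X i) (X j))"

definition tilted_log_likelihood :: "nat \<Rightarrow> (nat \<Rightarrow> 'a) \<Rightarrow> (nat \<times> nat) set \<Rightarrow> real" where
  "tilted_log_likelihood n X A =
     (\<Sum>e\<in>vertex_pairs n. edge_sign A e * (\<rho>\<^sup>2 * edge_kernel X e) - 3 / 4 * edge_smoothed X e)"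

definition likelihood :: "nat \<Rightarrow> (nat \<times> nat) set \<Rightarrow> real" where
  "likelihood n A = (\<integral>X. edge_weight (vertex_pairs n) (edge_kernel X) A \<partial>PiM {1..n} (\<lambda>_. M))"

lemma vertex_pairsD: "(i, j) \<in> vertex_pairs n \<Longrightarrow> i \<in> {1..n} \<and> j \<in> {1..n} \<and> i \<noteq> j"
  by (auto simp: vertex_pairs_def)

lemma edge_kernel_bound: "\<bar>edge_kernel X e\<bar> \<le> \<beta>"
  by (simp add: edge_kernel_def kappa_bound split: prod.split)

lemma edge_kernel_measurable:
  assumes "e \<in> vertex_pairs n"
  shows "(\<lambda>X. edge_kernel X e) \<in> borel_measurable (PiM {1..n} (\<lambda>_. M))"
proof -
  obtain i j where e: "e = (i, j)" by fastforce
  have [measurable]: "(\<lambda>X. X i) \<in> measurable (PiM {1..n} (\<lambda>_. M)) M" "(\<lambda>X. X j) \<in> measurable (PiM {1..n} (\<lambda>_. M)) M"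
    using vertex_pairsD[of i j n] assms e by auto
  show ?thesis unfolding e edge_kernel_def prod.case by measurable
qed

lemma edge_smoothed_measurable:
  assumes "e \<in> vertex_pairs n"
  shows "(\<lambda>X. edge_smoothed X e) \<in> borel_measurable (PiM {1..n} (\<lambda>_. M))"
proof -
  obtain i j where e: "e = (i, j)" by fastforce
  have [measurable]: "(\<lambda>X. X i) \<in> measurable (PiM {1..n} (\<lambda>_. M)) M" "(\<lambda>X. X j) \<in> measurable (PiM {1..n} (\<lambda>_. M)) M"
    using vertex_pairsD[of i j n] assms e by auto
  show ?thesis unfolding e edge_smoothed_def prod.case by measurable
qed

lemma edge_weight_kernel_nonneg: "0 \<le> edge_weight E (edge_kernel X) A"
proof (rule edge_weight_nonneg)
  fix e show "\<bar>edge_kernel X e\<bar> \<le> 1" using edge_kernel_bound[of X e] beta_le by linarith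
qed

lemma edge_weight_kernel_le: "finite E \<Longrightarrow> \<bar>edge_weight E (edge_kernel X) A\<bar> \<le> 2 ^ card E"
proof -
  assume "finite E"
  have "\<bar>edge_weight E (edge_kernel X) A\<bar> = (\<Prod>e\<in>E. \<bar>1 + edge_sign A e * edge_kernel X e\<bar>)"
    by (simp add: edge_weight_def abs_prod)
  also have "\<dots> \<le> (\<Prod>e\<in>E. 2)"
  proof (intro prod_mono conjI)
    fix e assume "e \<in> E"
    have "\<bar>edge_sign A e * edge_kernel X e\<bar> \<le> 1 / 4" using edge_kernel_bound[of X e] beta_le by (simp add: abs_mult)
    then show "\<bar>1 + edge_sign A e * edge_kernel X e\<bar> \<le> 2" by linarith
  qed simp
  finally show ?thesis by simp
qed

lemma edge_weight_kernel_measurable: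
  "(\<lambda>X. edge_weight (vertex_pairs n) (edge_kernel X) A) \<in> borel_measurable (PiM {1..n} (\<lambda>_. M))"
  unfolding edge_weight_def
  by (intro borel_measurable_prod borel_measurable_add borel_measurable_times edge_kernel_measurable) auto

text \<open>
  The Gibbs variational principle: replacing the uniform law of the points by the tilted one costs the
  factor \<open>Q ^ n\<close>, and Jensen's inequality moves the tilted average into the exponent.
\<close>

lemma likelihood_lower_bound:
  assumes X: "X \<in> space (PiM {1..n} (\<lambda>_. M))"
  shows "exp (tilted_log_likelihood n X A) \<le> Q ^ n * likelihood n A"
proof -
  let ?V = "{1..n}" and ?E = "vertex_pairs n"
  let ?\<Pi> = "PiM ?V (\<lambda>_. M)"
  interpret Pi: prob_space ?\<Pi> by (intro prob_space_PiM prob_space_axioms)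
  have XM: "X i \<in> space M" if "i \<in> ?V" for i using X that by (auto simp: space_PiM)
  \<comment> \<open>Outside the vertex set the density is trivial, since product measures need a measure at every index.\<close>
  define f where "f i y = (if i \<in> ?V then q (X i) y else 1)" for i y
  have fm: "f i \<in> borel_measurable M" for i
    using XM[of i] by (cases "i \<in> ?V") (auto simp: f_def[abs_def])
  define N where "N i = density M (\<lambda>y. ennreal (f i y))" for i
  have N: "N i = (if i \<in> ?V then tilted (X i) else M)" for i
    by (auto simp: N_def f_def tilted_def density_1)
  have NP: "prob_space (N i)" for i
    using XM[of i] by (simp add: N prob_space_tilted prob_space_axioms)
  have Ns: "space (N i) = space M" "sets (N i) = sets M" for i by (simp_all add: N)
  have sets_N: "sets (PiM ?V N) = sets ?\<Pi>" by (intro sets_PiM_cong) (auto simp: Ns)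
  have meas_N: "measurable (PiM ?V N) L = measurable ?\<Pi> L" for L :: "'c measure"
    by (intro measurable_cong_sets sets_N) simp
  interpret T: prob_space "PiM ?V N" by (intro prob_space_PiM NP)
  have dens: "PiM ?V N = density ?\<Pi> (\<lambda>y. \<Prod>i\<in>?V. ennreal (f i (y i)))"
    unfolding N_def using fm
    by (intro finite_PiM_density)
       (auto intro: prob_space_imp_sigma_finite prob_space_axioms NP simp flip: N_def)
  define w where "w y = edge_weight ?E (edge_kernel y) A" for y
  define Z where "Z y = (\<Sum>e\<in>?E. edge_sign A e * edge_kernel y e - 3 / 4 * (edge_kernel y e)\<^sup>2)" for y
  have wm: "w \<in> borel_measurable ?\<Pi>" unfolding w_def by (rule edge_weight_kernel_measurable)
  have Zm: "Z \<in> borel_measurable ?\<Pi>" unfolding Z_def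
    by (intro borel_measurable_sum borel_measurable_diff borel_measurable_times borel_measurable_power edge_kernel_measurable) auto
  have w0: "0 \<le> w y" for y unfolding w_def by (rule edge_weight_kernel_nonneg)
  have wb: "\<bar>w y\<bar> \<le> 2 ^ card ?E" for y unfolding w_def by (rule edge_weight_kernel_le) simp
  have expZ: "exp (Z y) \<le> w y" for y
  proof -
    have "exp (Z y) = (\<Prod>e\<in>?E. exp (edge_sign A e * edge_kernel y e - 3 / 4 * (edge_sign A e * edge_kernel y e)\<^sup>2))"
      unfolding Z_def by (simp add: exp_sum power_mult_distrib)
    also have "\<dots> \<le> (\<Prod>e\<in>?E. 1 + edge_sign A e * edge_kernel y e)"
      using order_trans[OF edge_kernel_bound[of y] beta_le] by (intro prod_mono conjI exp_quadratic_le) (auto simp: abs_mult)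
    finally show ?thesis by (simp add: w_def edge_weight_def)
  qed
  have kint: "integrable (PiM ?V N) (\<lambda>y. edge_kernel y e)" "integrable (PiM ?V N) (\<lambda>y. (edge_kernel y e)\<^sup>2)" if "e \<in> ?E" for e
  proof -
    have m: "(\<lambda>y. edge_kernel y e) \<in> borel_measurable (PiM ?V N)"
      unfolding meas_N by (rule edge_kernel_measurable[OF that])
    then show "integrable (PiM ?V N) (\<lambda>y. edge_kernel y e)"
      by (rule T.integrable_bounded[OF _ edge_kernel_bound])
    show "integrable (PiM ?V N) (\<lambda>y. (edge_kernel y e)\<^sup>2)"
      using m by (intro T.integrable_bounded[where C="\<beta>\<^sup>2"])
        (auto simp: edge_kernel_def kappa_sq_bound split: prod.split)
  qed
  have Zint: "integrable (PiM ?V N) Z"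
    unfolding Z_def using kint by (intro Bochner_Integration.integrable_sum Bochner_Integration.integrable_diff integrable_mult_right) auto
  have EZ: "(\<integral>y. Z y \<partial>PiM ?V N) = tilted_log_likelihood n X A"
  proof -
    have k1: "(\<integral>y. edge_kernel y e \<partial>PiM ?V N) = \<rho>\<^sup>2 * edge_kernel X e"
      and k2: "(\<integral>y. (edge_kernel y e)\<^sup>2 \<partial>PiM ?V N) = edge_smoothed X e" if e: "e \<in> ?E" for e
    proof -
      obtain i j where ij: "e = (i, j)" by fastforce
      have V: "i \<in> ?V" "j \<in> ?V" "i \<noteq> j" using vertex_pairsD[of i j n] e ij by auto
      have Nij: "N i = tilted (X i)" "N j = tilted (X j)" using V by (simp_all add: N)
      have "(\<integral>y. \<kappa> (y i) (y j) \<partial>PiM ?V N) = (\<integral>y'. \<integral>y. \<kappa> y y' \<partial>N i \<partial>N j)"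
        by (rule integral_PiM_pair[OF NP _ V, where C="\<beta>"]) (auto simp: Nij kappa_bound)
      then show "(\<integral>y. edge_kernel y e \<partial>PiM ?V N) = \<rho>\<^sup>2 * edge_kernel X e"
        using tilted_kappa_mean[of "X i" "X j"] XM V by (simp add: ij edge_kernel_def Nij)
      have "(\<integral>y. (\<kappa> (y i) (y j))\<^sup>2 \<partial>PiM ?V N) = (\<integral>y'. \<integral>y. (\<kappa> y y')\<^sup>2 \<partial>N i \<partial>N j)"
        by (rule integral_PiM_pair[OF NP _ V, where C="\<beta>\<^sup>2"]) (auto simp: Nij kappa_sq_bound)
      then show "(\<integral>y. (edge_kernel y e)\<^sup>2 \<partial>PiM ?V N) = edge_smoothed X e"
        by (simp add: ij edge_kernel_def edge_smoothed_def smoothed_def Nij)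
    qed
    have "(\<integral>y. Z y \<partial>PiM ?V N) = (\<Sum>e\<in>?E. \<integral>y. edge_sign A e * edge_kernel y e - 3 / 4 * (edge_kernel y e)\<^sup>2 \<partial>PiM ?V N)"
      unfolding Z_def using kint by (intro Bochner_Integration.integral_sum Bochner_Integration.integrable_diff integrable_mult_right) auto
    also have "\<dots> = tilted_log_likelihood n X A"
      unfolding tilted_log_likelihood_def
    proof (intro sum.cong refl)
      fix e assume e: "e \<in> ?E"
      have "(\<integral>y. edge_sign A e * edge_kernel y e - 3 / 4 * (edge_kernel y e)\<^sup>2 \<partial>PiM ?V N)
          = edge_sign A e * (\<integral>y. edge_kernel y e \<partial>PiM ?V N) - 3 / 4 * (\<integral>y. (edge_kernel y e)\<^sup>2 \<partial>PiM ?V N)"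
        using kint[OF e] by simp
      then show "(\<integral>y. edge_sign A e * edge_kernel y e - 3 / 4 * (edge_kernel y e)\<^sup>2 \<partial>PiM ?V N)
          = edge_sign A e * (\<rho>\<^sup>2 * edge_kernel X e) - 3 / 4 * edge_smoothed X e"
        unfolding k1[OF e] k2[OF e] .
    qed
    finally show ?thesis .
  qed
  define s where "s = tilted_log_likelihood n X A"
  \<comment> \<open>Jensen via the tangent of the exponential at the mean of \<open>Z\<close>.\<close>
  have "exp s = (\<integral>y. exp s * (1 + (Z y - s)) \<partial>PiM ?V N)"
    using Zint EZ by (simp add: T.prob_space s_def)
  also have "\<dots> \<le> (\<integral>y. w y \<partial>PiM ?V N)"
  proof (rule integral_mono)
    show "integrable (PiM ?V N) (\<lambda>y. exp s * (1 + (Z y - s)))" using Zint by simp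
    show "integrable (PiM ?V N) w" using wm wb by (intro T.integrable_bounded[where C="2 ^ card ?E"]) (auto simp: meas_N)
    fix y
    have "exp s * (1 + (Z y - s)) \<le> exp s * exp (Z y - s)" by (intro mult_left_mono exp_ge_add_one_self) simp
    also have "\<dots> = exp (Z y)" by (simp add: exp_diff)
    also have "\<dots> \<le> w y" by (rule expZ)
    finally show "exp s * (1 + (Z y - s)) \<le> w y" .
  qed
  also have "\<dots> = (\<integral>y. (\<Prod>i\<in>?V. f i (y i)) * w y \<partial>?\<Pi>)"
  proof -
    have fn: "0 \<le> f i y" for i y by (simp add: f_def q_nonneg)
    have "PiM ?V N = density ?\<Pi> (\<lambda>y. ennreal (\<Prod>i\<in>?V. f i (y i)))"
      unfolding dens by (simp add: prod_ennreal fn)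
    moreover have "(\<lambda>y. \<Prod>i\<in>?V. f i (y i)) \<in> borel_measurable ?\<Pi>"
      using fm by (intro borel_measurable_prod) (auto intro: measurable_compose[OF measurable_component_singleton])
    ultimately show ?thesis using wm by (simp add: integral_density prod_nonneg fn)
  qed
  also have "\<dots> \<le> (\<integral>y. Q ^ n * w y \<partial>?\<Pi>)"
  proof (rule integral_mono)
    have fb: "(\<Prod>i\<in>?V. f i (y i)) \<le> Q ^ n" "0 \<le> (\<Prod>i\<in>?V. f i (y i))" for y
    proof -
      have "(\<Prod>i\<in>?V. f i (y i)) \<le> (\<Prod>i\<in>?V. Q)" by (intro prod_mono) (auto simp: f_def q_nonneg q_le)
      then show "(\<Prod>i\<in>?V. f i (y i)) \<le> Q ^ n" by simp
      show "0 \<le> (\<Prod>i\<in>?V. f i (y i))" by (intro prod_nonneg) (auto simp: f_def q_nonneg)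
    qed
    have fpm: "(\<lambda>y. \<Prod>i\<in>?V. f i (y i)) \<in> borel_measurable ?\<Pi>"
      using fm by (intro borel_measurable_prod) (auto intro: measurable_compose[OF measurable_component_singleton])
    show "integrable ?\<Pi> (\<lambda>y. (\<Prod>i\<in>?V. f i (y i)) * w y)"
    proof (rule Pi.integrable_bounded[where C="Q ^ n * 2 ^ card ?E"])
      show "(\<lambda>y. (\<Prod>i\<in>?V. f i (y i)) * w y) \<in> borel_measurable ?\<Pi>" using fpm wm by (rule borel_measurable_times)
      show "\<bar>(\<Prod>i\<in>?V. f i (y i)) * w y\<bar> \<le> Q ^ n * 2 ^ card ?E" for y
        unfolding abs_mult using fb[of y] wb[of y] Q_nonneg by (intro mult_mono) auto
    qed
    show "integrable ?\<Pi> (\<lambda>y. Q ^ n * w y)"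
      using wm wb by (intro integrable_mult_right Pi.integrable_bounded[where C="2 ^ card ?E"])
    show "(\<Prod>i\<in>?V. f i (y i)) * w y \<le> Q ^ n * w y" for y
      by (intro mult_right_mono fb w0)
  qed
  also have "\<dots> = Q ^ n * likelihood n A" by (simp add: likelihood_def w_def)
  finally show ?thesis by (simp add: s_def)
qed

end

section \<open>Fluctuations of the tilted log-likelihood\<close>

context planted_kernel begin

text \<open>
  The mean contribution of one pair to the tilted log-likelihood when \<open>X\<close> generated the graph: the edge
  sign then has mean \<open>\<kappa>\<close>, which turns \<open>\<rho>\<^sup>2 * \<kappa>\<close> into \<open>\<rho>\<^sup>2 * \<kappa>\<^sup>2\<close>.
\<close>

definition gain :: real where
  "gain = (\<rho>\<^sup>2 - 3 / 4) * h"

definition deviation :: "'a \<Rightarrow> 'a \<Rightarrow> real" where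
  "deviation x x' = \<rho>\<^sup>2 * (\<kappa> x x')\<^sup>2 - 3 / 4 * smoothed x x' - gain"

lemma deviation_measurable [measurable]:
  assumes [measurable]: "f \<in> measurable N M" "g \<in> measurable N M"
  shows "(\<lambda>x. deviation (f x) (g x)) \<in> borel_measurable N"
  unfolding deviation_def by measurable

lemma rho_sq: "0 \<le> \<rho>\<^sup>2" "\<rho>\<^sup>2 \<le> 1"
  using rho by (simp_all add: power_le_one)

lemma beta_sq_le: "\<beta>\<^sup>2 \<le> 1 / 16"
  using power_mono[OF beta_le beta_nonneg, of 2] by (simp add: power2_eq_square)

lemma kappa_integrable: "x \<in> space M \<Longrightarrow> integrable M (\<lambda>y. (\<kappa> x y)\<^sup>2)"
  by (rule integrable_bounded[where C="\<beta>\<^sup>2"]) (auto simp: kappa_sq_bound)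

lemma smoothed_integrable: "x \<in> space M \<Longrightarrow> integrable M (smoothed x)"
  by (rule integrable_bounded[where C="\<beta>\<^sup>2"]) (auto simp: smoothed_bounds abs_of_nonneg)

lemma deviation_bounds:
  assumes x: "x \<in> space M" "x' \<in> space M"
  shows "\<bar>deviation x x'\<bar> \<le> 1" and "(deviation x x')\<^sup>2 \<le> (\<kappa> x x')\<^sup>2 + smoothed x x' + h"
proof -
  have "\<bar>\<rho>\<^sup>2 - 3 / 4\<bar> \<le> 1" using rho_sq by linarith
  then have "\<bar>(\<rho>\<^sup>2 - 3 / 4) * h\<bar> \<le> 1 * h"
    unfolding abs_mult using h_bounds by (intro mult_mono) auto
  then have g: "\<bar>gain\<bar> \<le> h" by (simp add: gain_def)
  have k: "0 \<le> \<rho>\<^sup>2 * (\<kappa> x x')\<^sup>2" "\<rho>\<^sup>2 * (\<kappa> x x')\<^sup>2 \<le> (\<kappa> x x')\<^sup>2"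
    using rho_sq mult_left_le_one_le[of "(\<kappa> x x')\<^sup>2" "\<rho>\<^sup>2"] by auto
  have le: "\<bar>deviation x x'\<bar> \<le> (\<kappa> x x')\<^sup>2 + smoothed x x' + h"
    unfolding deviation_def using g k smoothed_bounds[OF x] by linarith
  then show 1: "\<bar>deviation x x'\<bar> \<le> 1"
    using kappa_sq_bound[of x x'] smoothed_bounds[OF x] h_bounds beta_sq_le by linarith
  have "(deviation x x')\<^sup>2 = \<bar>deviation x x'\<bar> * \<bar>deviation x x'\<bar>" by (simp add: power2_eq_square)
  also have "\<dots> \<le> 1 * \<bar>deviation x x'\<bar>" by (intro mult_right_mono 1 abs_ge_zero)
  finally show "(deviation x x')\<^sup>2 \<le> (\<kappa> x x')\<^sup>2 + smoothed x x' + h" using le by linarith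
qed

lemma deviation_sym: "x \<in> space M \<Longrightarrow> x' \<in> space M \<Longrightarrow> deviation x x' = deviation x' x"
  by (simp add: deviation_def smoothed_sym[of x x'] kappa_sym[of x x'])

text \<open>
  The fluctuation of a pair has mean zero already when one of its endpoints is fixed.
\<close>

lemma deviation_mean:
  assumes x: "x \<in> space M"
  shows "(\<integral>x'. deviation x x' \<partial>M) = 0"
proof -
  have "(\<integral>x'. deviation x x' \<partial>M) = \<rho>\<^sup>2 * h - 3 / 4 * h - gain"
    unfolding deviation_def using kappa_integrable[OF x] smoothed_integrable[OF x]
    by (simp add: kappa_var x smoothed_mean prob_space)
  then show ?thesis by (simp add: gain_def algebra_simps)
qed

definition edge_deviation :: "(nat \<Rightarrow> 'a) \<Rightarrow> nat \<times> nat \<Rightarrow> real" where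
  "edge_deviation X = (\<lambda>(i, j). deviation (X i) (X j))"

lemma edge_deviation_measurable:
  assumes "e \<in> vertex_pairs n"
  shows "(\<lambda>X. edge_deviation X e) \<in> borel_measurable (PiM {1..n} (\<lambda>_. M))"
proof -
  obtain i j where e: "e = (i, j)" by fastforce
  have [measurable]: "(\<lambda>X. X i) \<in> measurable (PiM {1..n} (\<lambda>_. M)) M" "(\<lambda>X. X j) \<in> measurable (PiM {1..n} (\<lambda>_. M)) M"
    using vertex_pairsD[of i j n] assms e by auto
  show ?thesis unfolding e edge_deviation_def prod.case by measurable
qed

lemma edge_deviation_bounds:
  assumes "e \<in> vertex_pairs n" "X \<in> space (PiM {1..n} (\<lambda>_. M))"
  shows "\<bar>edge_deviation X e\<bar> \<le> 1" "(edge_deviation X e)\<^sup>2 \<le> (edge_kernel X e)\<^sup>2 + edge_smoothed X e + h"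
proof -
  obtain i j where e: "e = (i, j)" by fastforce
  have "X i \<in> space M" "X j \<in> space M"
    using vertex_pairsD[of i j n] assms e by (auto simp: space_PiM)
  then show "\<bar>edge_deviation X e\<bar> \<le> 1" "(edge_deviation X e)\<^sup>2 \<le> (edge_kernel X e)\<^sup>2 + edge_smoothed X e + h"
    unfolding e edge_deviation_def edge_kernel_def edge_smoothed_def by (simp_all add: deviation_bounds)
qed

text \<open>
  Two distinct pairs differ in some vertex; integrating over the point of that vertex alone gives
  zero by \<open>deviation_mean\<close>.
\<close>

lemma edge_deviation_orthogonal:
  assumes e: "e \<in> vertex_pairs n" and f: "f \<in> vertex_pairs n" and ne: "e \<noteq> f"
  shows "(\<integral>X. edge_deviation X e * edge_deviation X f \<partial>PiM {1..n} (\<lambda>_. M)) = 0"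
proof -
  let ?V = "{1..n}"
  obtain i j where ij: "e = (i, j)" by fastforce
  obtain a b where ab: "f = (a, b)" by fastforce
  have V: "i \<in> ?V" "j \<in> ?V" "a \<in> ?V" "b \<in> ?V" and lt: "i < j" "a < b"
    using e f by (auto simp: vertex_pairs_def ij ab)
  \<comment> \<open>The endpoint \<open>v\<close> of \<open>e\<close> is not an endpoint of \<open>f\<close>; it exists because pairs are ordered.\<close>
  obtain v w where vw: "v \<in> ?V" "w \<in> ?V" "v \<noteq> w" "v \<noteq> a" "v \<noteq> b" "(v = i \<and> w = j) \<or> (v = j \<and> w = i)"
  proof (cases "i = a \<or> i = b")
    case True
    then have "j \<noteq> a" "j \<noteq> b" using lt ne by (auto simp: ij ab)
    then show ?thesis using that[of j i] V lt by auto
  next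
    case False
    then show ?thesis using that[of i j] V lt by auto
  qed
  have sp: "X k \<in> space M" if "X \<in> space (PiM J (\<lambda>_. M))" "k \<in> J" for X J and k :: nat
    using that by (auto simp: space_PiM)
  have "(\<integral>X. edge_deviation X e * edge_deviation X f \<partial>PiM ?V (\<lambda>_. M))
     = (\<integral>X. deviation (X w) (X v) * deviation (X a) (X b) \<partial>PiM ?V (\<lambda>_. M))"
    using vw V by (intro Bochner_Integration.integral_cong refl)
      (auto simp: edge_deviation_def ij ab sp deviation_sym[OF sp sp])
  also have "\<dots> = (\<integral>X. (\<integral>x. deviation ((fun_upd X v x) w) ((fun_upd X v x) v) * deviation ((fun_upd X v x) a) ((fun_upd X v x) b) \<partial>M) \<partial>PiM (?V - {v}) (\<lambda>_. M))"
  proof (rule integral_PiM_remove[where C=1])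
    have [measurable]: "(\<lambda>X. X k) \<in> measurable (PiM ?V (\<lambda>_. M)) M" if "k \<in> ?V" for k
      using that by (rule measurable_component_singleton)
    show "(\<lambda>X. deviation (X w) (X v) * deviation (X a) (X b)) \<in> borel_measurable (PiM ?V (\<lambda>_. M))"
      using V vw by measurable
    show "\<bar>deviation (X w) (X v) * deviation (X a) (X b)\<bar> \<le> 1" if "X \<in> space (PiM ?V (\<lambda>_. M))" for X
      using mult_mono[OF deviation_bounds(1) deviation_bounds(1), of "X w" "X v" "X a" "X b"] that V vw
      by (simp add: sp[OF that] abs_mult)
  qed (use vw in \<open>auto simp: prob_space_axioms\<close>)
  also have "\<dots> = (\<integral>X. 0 \<partial>PiM (?V - {v}) (\<lambda>_. M))"
  proof (intro Bochner_Integration.integral_cong refl)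
    fix X assume X: "X \<in> space (PiM (?V - {v}) (\<lambda>_. M))"
    have "X w \<in> space M" using sp[OF X, of w] vw by auto
    then show "(\<integral>x. deviation ((fun_upd X v x) w) ((fun_upd X v x) v) * deviation ((fun_upd X v x) a) ((fun_upd X v x) b) \<partial>M) = 0"
      using vw deviation_mean[of "X w"] by simp
  qed
  finally show ?thesis by simp
qed

lemma edge_second_moments:
  assumes e: "e \<in> vertex_pairs n"
  shows "(\<integral>X. (edge_kernel X e)\<^sup>2 \<partial>PiM {1..n} (\<lambda>_. M)) = h"
    and "(\<integral>X. edge_smoothed X e \<partial>PiM {1..n} (\<lambda>_. M)) = h"
    and "integrable (PiM {1..n} (\<lambda>_. M)) (\<lambda>X. (edge_kernel X e)\<^sup>2)"
    and "integrable (PiM {1..n} (\<lambda>_. M)) (\<lambda>X. edge_smoothed X e)"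
    and "integrable (PiM {1..n} (\<lambda>_. M)) (\<lambda>X. (edge_deviation X e)\<^sup>2)"
    and "(\<integral>X. (edge_deviation X e)\<^sup>2 \<partial>PiM {1..n} (\<lambda>_. M)) \<le> 3 * h"
proof -
  let ?P = "PiM {1..n} (\<lambda>_. M)"
  interpret Pi: prob_space ?P by (intro prob_space_PiM prob_space_axioms)
  obtain i j where ij: "e = (i, j)" by fastforce
  have V: "i \<in> {1..n}" "j \<in> {1..n}" "i \<noteq> j" using vertex_pairsD[of i j n] e ij by auto
  have sp: "X k \<in> space M" if "X \<in> space ?P" "k \<in> {1..n}" for X k
    using that by (auto simp: space_PiM)
  have "(\<integral>X. (\<kappa> (X i) (X j))\<^sup>2 \<partial>?P) = (\<integral>y. \<integral>x. (\<kappa> x y)\<^sup>2 \<partial>M \<partial>M)"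
    by (rule integral_PiM_pair[OF prob_space_axioms _ V, where C="\<beta>\<^sup>2"]) (auto simp: kappa_sq_bound)
  also have "\<dots> = (\<integral>y. h \<partial>M)"
    by (intro Bochner_Integration.integral_cong refl) (simp add: kappa_sym[of _ y for y] kappa_var)
  finally show k: "(\<integral>X. (edge_kernel X e)\<^sup>2 \<partial>?P) = h" by (simp add: ij edge_kernel_def prob_space)
  have "(\<integral>X. smoothed (X i) (X j) \<partial>?P) = (\<integral>y. \<integral>x. smoothed x y \<partial>M \<partial>M)"
    by (rule integral_PiM_pair[OF prob_space_axioms _ V, where C="\<beta>\<^sup>2"]) (auto simp: smoothed_bounds abs_of_nonneg)
  also have "\<dots> = (\<integral>y. h \<partial>M)"
  proof (intro Bochner_Integration.integral_cong refl)
    fix y assume y: "y \<in> space M"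
    have "(\<integral>x. smoothed x y \<partial>M) = (\<integral>x. smoothed y x \<partial>M)"
      by (intro Bochner_Integration.integral_cong refl) (simp add: smoothed_sym y)
    then show "(\<integral>x. smoothed x y \<partial>M) = h" by (simp add: smoothed_mean y)
  qed
  finally show s: "(\<integral>X. edge_smoothed X e \<partial>?P) = h" by (simp add: ij edge_smoothed_def prob_space)
  show ik: "integrable ?P (\<lambda>X. (edge_kernel X e)\<^sup>2)"
    using edge_kernel_measurable[OF e]
    by (intro Pi.integrable_bounded[where C="\<beta>\<^sup>2"]) (auto simp: edge_kernel_def kappa_sq_bound split: prod.split)
  show isq: "integrable ?P (\<lambda>X. edge_smoothed X e)"
    using edge_smoothed_measurable[OF e] V
    by (intro Pi.integrable_bounded[where C="\<beta>\<^sup>2"]) (auto simp: ij edge_smoothed_def smoothed_bounds abs_of_nonneg sp)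
  show id: "integrable ?P (\<lambda>X. (edge_deviation X e)\<^sup>2)"
  proof (rule Pi.integrable_bounded[where C=1])
    show "(\<lambda>X. (edge_deviation X e)\<^sup>2) \<in> borel_measurable ?P"
      using edge_deviation_measurable[OF e] by simp
    show "\<bar>(edge_deviation X e)\<^sup>2\<bar> \<le> 1" if "X \<in> space ?P" for X
      using edge_deviation_bounds(1)[OF e that] by (simp add: abs_square_le_1)
  qed
  have "(\<integral>X. (edge_deviation X e)\<^sup>2 \<partial>?P) \<le> (\<integral>X. (edge_kernel X e)\<^sup>2 + edge_smoothed X e + h \<partial>?P)"
    using ik isq id edge_deviation_bounds(2)[OF e] by (intro integral_mono) auto
  also have "\<dots> = 3 * h"
    using ik isq k s by (simp add: Pi.prob_space)
  finally show "(\<integral>X. (edge_deviation X e)\<^sup>2 \<partial>?P) \<le> 3 * h" .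
qed

text \<open>
  Given the points, the statistic splits into a centred sum of independent edge signs and a function
  of the points.  The first has variance at most \<open>\<Sum> \<kappa>\<^sup>2\<close>, the second is a sum of orthogonal terms; so the
  variance is linear in the number of pairs.
\<close>

lemma second_moment_bound:
  defines "E \<equiv> \<lambda>n. vertex_pairs n"
  shows "(\<integral>X. (\<Sum>A\<in>Pow (E n). edge_weight (E n) (edge_kernel X) A
            * (tilted_log_likelihood n X A - real (card (E n)) * gain)\<^sup>2) \<partial>PiM {1..n} (\<lambda>_. M))
     \<le> 2 ^ card (E n) * (4 * real (card (E n)) * h)" (is "(\<integral>X. ?F X \<partial>?P) \<le> _")
    and "integrable (PiM {1..n} (\<lambda>_. M)) (\<lambda>X. (\<Sum>A\<in>Pow (E n). edge_weight (E n) (edge_kernel X) A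
            * (tilted_log_likelihood n X A - real (card (E n)) * gain)\<^sup>2))"
proof -
  interpret Pi: prob_space ?P by (intro prob_space_PiM prob_space_axioms)
  let ?E = "vertex_pairs n"
  let ?N = "2 ^ card ?E :: real"
  let ?B = "\<lambda>X. \<Sum>e\<in>?E. edge_deviation X e"
  have eq: "?F X = ?N * ((\<Sum>e\<in>?E. (\<rho>\<^sup>2 * edge_kernel X e)\<^sup>2 * (1 - (edge_kernel X e)\<^sup>2)) + (?B X)\<^sup>2)" for X
  proof -
    let ?T = "\<lambda>A. \<Sum>e\<in>?E. (\<rho>\<^sup>2 * edge_kernel X e) * (edge_sign A e - edge_kernel X e)"
    have dec: "tilted_log_likelihood n X A - real (card ?E) * gain = ?T A + ?B X" for A
    proof -
      have "tilted_log_likelihood n X A - real (card ?E) * gain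
         = (\<Sum>e\<in>?E. edge_sign A e * (\<rho>\<^sup>2 * edge_kernel X e) - 3 / 4 * edge_smoothed X e - gain)"
        by (simp add: tilted_log_likelihood_def sum_subtractf)
      also have "\<dots> = (\<Sum>e\<in>?E. (\<rho>\<^sup>2 * edge_kernel X e) * (edge_sign A e - edge_kernel X e) + edge_deviation X e)"
        by (intro sum.cong refl)
           (auto simp: edge_deviation_def deviation_def edge_kernel_def edge_smoothed_def algebra_simps power2_eq_square)
      finally show ?thesis by (simp add: sum.distrib)
    qed
    note mom = edge_weight_moments[OF finite_vertex_pairs, of n "edge_kernel X"]
    have "?F X = (\<Sum>A\<in>Pow ?E. edge_weight ?E (edge_kernel X) A * (?T A)\<^sup>2
        + 2 * ?B X * (edge_weight ?E (edge_kernel X) A * ?T A) + (?B X)\<^sup>2 * edge_weight ?E (edge_kernel X) A)"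
      unfolding E_def dec by (intro sum.cong refl) (simp add: power2_sum algebra_simps)
    also have "\<dots> = (\<Sum>A\<in>Pow ?E. edge_weight ?E (edge_kernel X) A * (?T A)\<^sup>2)
        + 2 * ?B X * (\<Sum>A\<in>Pow ?E. edge_weight ?E (edge_kernel X) A * ?T A) + (?B X)\<^sup>2 * (\<Sum>A\<in>Pow ?E. edge_weight ?E (edge_kernel X) A)"
      by (simp only: sum.distrib sum_distrib_left)
    finally show ?thesis unfolding mom by (simp add: algebra_simps)
  qed
  have B2: "(?B X)\<^sup>2 = (\<Sum>e\<in>?E. \<Sum>f\<in>?E. edge_deviation X e * edge_deviation X f)" for X
    by (simp add: power2_eq_square sum_product)
  have int_ef: "integrable ?P (\<lambda>X. edge_deviation X e * edge_deviation X f)" if "e \<in> ?E" "f \<in> ?E" for e f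
  proof (rule Pi.integrable_bounded[where C=1])
    show "(\<lambda>X. edge_deviation X e * edge_deviation X f) \<in> borel_measurable ?P"
      using that by (intro borel_measurable_times edge_deviation_measurable)
    show "\<bar>edge_deviation X e * edge_deviation X f\<bar> \<le> 1" if "X \<in> space ?P" for X
      using mult_mono[OF edge_deviation_bounds(1)[OF \<open>e \<in> ?E\<close> that] edge_deviation_bounds(1)[OF \<open>f \<in> ?E\<close> that]]
      by (simp add: abs_mult)
  qed
  have intB: "integrable ?P (\<lambda>X. (?B X)\<^sup>2)" unfolding B2 using int_ef by auto
  have EB: "(\<integral>X. (?B X)\<^sup>2 \<partial>?P) \<le> 3 * real (card ?E) * h"
  proof -
    have "(\<integral>X. (?B X)\<^sup>2 \<partial>?P) = (\<Sum>e\<in>?E. \<Sum>f\<in>?E. \<integral>X. edge_deviation X e * edge_deviation X f \<partial>?P)"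
      unfolding B2 using int_ef by (simp add: Bochner_Integration.integral_sum)
    also have "\<dots> = (\<Sum>e\<in>?E. \<Sum>f\<in>?E. if f = e then \<integral>X. (edge_deviation X e)\<^sup>2 \<partial>?P else 0)"
    proof (intro sum.cong refl)
      fix e f assume "e \<in> ?E" "f \<in> ?E"
      then show "(\<integral>X. edge_deviation X e * edge_deviation X f \<partial>?P) = (if f = e then \<integral>X. (edge_deviation X e)\<^sup>2 \<partial>?P else 0)"
        using edge_deviation_orthogonal[of e n f] by (simp add: power2_eq_square)
    qed
    also have "\<dots> = (\<Sum>e\<in>?E. \<integral>X. (edge_deviation X e)\<^sup>2 \<partial>?P)" by simp
    also have "\<dots> \<le> (\<Sum>e\<in>?E. 3 * h)" by (intro sum_mono edge_second_moments)
    finally show ?thesis by simp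
  qed
  have kle: "(\<rho>\<^sup>2 * edge_kernel X e)\<^sup>2 * (1 - (edge_kernel X e)\<^sup>2) \<le> (edge_kernel X e)\<^sup>2"
    "0 \<le> (\<rho>\<^sup>2 * edge_kernel X e)\<^sup>2 * (1 - (edge_kernel X e)\<^sup>2)" for X e
  proof -
    have k1: "(edge_kernel X e)\<^sup>2 \<le> 1"
      using edge_kernel_bound[of X e] beta_le by (simp add: abs_square_le_1)
    have "(\<rho>\<^sup>2 * edge_kernel X e)\<^sup>2 = (\<rho>\<^sup>2)\<^sup>2 * (edge_kernel X e)\<^sup>2" by (simp add: power_mult_distrib)
    also have "\<dots> \<le> 1 * (edge_kernel X e)\<^sup>2" by (intro mult_right_mono power_le_one rho_sq zero_le_power2)
    finally have "(\<rho>\<^sup>2 * edge_kernel X e)\<^sup>2 * (1 - (edge_kernel X e)\<^sup>2) \<le> (edge_kernel X e)\<^sup>2 * 1"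
      using k1 by (intro mult_mono) auto
    then show "(\<rho>\<^sup>2 * edge_kernel X e)\<^sup>2 * (1 - (edge_kernel X e)\<^sup>2) \<le> (edge_kernel X e)\<^sup>2" by simp
    show "0 \<le> (\<rho>\<^sup>2 * edge_kernel X e)\<^sup>2 * (1 - (edge_kernel X e)\<^sup>2)" using k1 by (intro mult_nonneg_nonneg) auto
  qed
  have int1: "integrable ?P (\<lambda>X. (\<rho>\<^sup>2 * edge_kernel X e)\<^sup>2 * (1 - (edge_kernel X e)\<^sup>2))" if e: "e \<in> ?E" for e
  proof (rule Bochner_Integration.integrable_bound[OF edge_second_moments(3)[OF e]])
    show "(\<lambda>X. (\<rho>\<^sup>2 * edge_kernel X e)\<^sup>2 * (1 - (edge_kernel X e)\<^sup>2)) \<in> borel_measurable ?P"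
      using edge_kernel_measurable[OF e]
      by (intro borel_measurable_times borel_measurable_power borel_measurable_diff) auto
    show "AE X in ?P. norm ((\<rho>\<^sup>2 * edge_kernel X e)\<^sup>2 * (1 - (edge_kernel X e)\<^sup>2)) \<le> norm ((edge_kernel X e)\<^sup>2)"
      using kle[of _ e] by (intro AE_I2) (simp add: abs_of_nonneg)
  qed
  show "integrable ?P ?F" unfolding eq using int1 intB by (intro integrable_mult_right Bochner_Integration.integrable_add Bochner_Integration.integrable_sum) auto
  have "(\<integral>X. ?F X \<partial>?P) = ?N * ((\<Sum>e\<in>?E. \<integral>X. (\<rho>\<^sup>2 * edge_kernel X e)\<^sup>2 * (1 - (edge_kernel X e)\<^sup>2) \<partial>?P) + (\<integral>X. (?B X)\<^sup>2 \<partial>?P))"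
    unfolding eq using int1 intB by (simp add: Bochner_Integration.integral_sum)
  also have "\<dots> \<le> ?N * ((\<Sum>e\<in>?E. h) + 3 * real (card ?E) * h)"
  proof (intro mult_left_mono add_mono sum_mono EB)
    fix e assume e: "e \<in> ?E"
    show "(\<integral>X. (\<rho>\<^sup>2 * edge_kernel X e)\<^sup>2 * (1 - (edge_kernel X e)\<^sup>2) \<partial>?P) \<le> h"
      unfolding edge_second_moments(1)[OF e, symmetric]
      by (intro integral_mono int1 e edge_second_moments kle)
  qed simp
  also have "\<dots> = 2 ^ card (E n) * (4 * real (card (E n)) * h)" by (simp add: E_def)
  finally show "(\<integral>X. ?F X \<partial>?P) \<le> 2 ^ card (E n) * (4 * real (card (E n)) * h)" .
qed

lemma edge_weight_kernel_integrable:
  "integrable (PiM {1..n} (\<lambda>_. M)) (\<lambda>X. edge_weight (vertex_pairs n) (edge_kernel X) A)"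
proof -
  interpret Pi: prob_space "PiM {1..n} (\<lambda>_. M)" by (intro prob_space_PiM prob_space_axioms)
  show ?thesis
    by (rule Pi.integrable_bounded[OF edge_weight_kernel_measurable edge_weight_kernel_le]) simp
qed

lemma sum_likelihood: "(\<Sum>A\<in>Pow (vertex_pairs n). likelihood n A) = 2 ^ card (vertex_pairs n)"
proof -
  interpret Pi: prob_space "PiM {1..n} (\<lambda>_. M)" by (intro prob_space_PiM prob_space_axioms)
  have "(\<Sum>A\<in>Pow (vertex_pairs n). likelihood n A)
     = (\<integral>X. (\<Sum>A\<in>Pow (vertex_pairs n). edge_weight (vertex_pairs n) (edge_kernel X) A) \<partial>PiM {1..n} (\<lambda>_. M))"
    unfolding likelihood_def
    by (rule Bochner_Integration.integral_sum[symmetric]) (rule edge_weight_kernel_integrable)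
  then show ?thesis by (simp add: edge_weight_moments(1) Pi.prob_space)
qed

text \<open>
  The test accepts the graphs whose likelihood ratio reaches \<open>exp (E * gain / 2) / Q ^ n\<close>, where \<open>E\<close> is
  the number of pairs.  Markov's inequality bounds the error under the fair coin, Chebyshev's inequality
  the error under \<open>P\<close>, because rejection forces the statistic below half of its mean.
\<close>

theorem TV_lower_bound:
  fixes P :: "(nat \<times> nat) set measure"
  assumes P: "prob_space P" "sets P = UNIV"
    and mixture: "\<And>B. measure P B = (\<Sum>A\<in>Pow (vertex_pairs n) \<inter> B. likelihood n A / 2 ^ card (vertex_pairs n))"
    and gain: "gain > 0" and E: "card (vertex_pairs n) > 0"
  shows "1 - 16 * h / (real (card (vertex_pairs n)) * gain\<^sup>2)
           - Q ^ n * exp (- (real (card (vertex_pairs n)) * gain / 2))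
         \<le> TV P (erdos_renyi_half n)"
proof -
  let ?E = "vertex_pairs n" and ?P = "PiM {1..n} (\<lambda>_. M)"
  interpret Pi: prob_space ?P by (intro prob_space_PiM prob_space_axioms)
  define c where "c = real (card ?E)"
  define N where "N = (2 ^ card ?E :: real)"
  have N: "N > 0" by (simp add: N_def)
  have c: "c > 0" using E by (simp add: c_def)
  define B where "B = {A \<in> Pow ?E. exp (c * gain / 2) \<le> Q ^ n * likelihood n A}"
  have L0: "0 \<le> likelihood n A" for A
    unfolding likelihood_def by (intro integral_nonneg_AE AE_I2 edge_weight_kernel_nonneg)
  have finB: "finite B" unfolding B_def by simp
  have null: "measure (erdos_renyi_half n) B \<le> Q ^ n * exp (- (c * gain / 2))"
  proof -
    have "real (card B) * exp (c * gain / 2) = (\<Sum>A\<in>B. exp (c * gain / 2))" by simp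
    also have "\<dots> \<le> (\<Sum>A\<in>B. Q ^ n * likelihood n A)" by (intro sum_mono) (simp add: B_def)
    also have "\<dots> \<le> (\<Sum>A\<in>Pow ?E. Q ^ n * likelihood n A)"
      using Q_nonneg L0 by (intro sum_mono2) (auto simp: B_def)
    also have "\<dots> = Q ^ n * N" by (simp add: sum_distrib_left[symmetric] sum_likelihood N_def)
    finally have "real (card B) / N \<le> Q ^ n * exp (- (c * gain / 2))"
      using N by (simp add: exp_minus field_simps)
    moreover have "Pow ?E \<inter> B = B" by (auto simp: B_def)
    ultimately show ?thesis by (simp add: measure_erdos_renyi_half N_def)
  qed
  have alt: "1 - measure P B \<le> 16 * h / (c * gain\<^sup>2)"
  proof -
    let ?S = "\<lambda>X A. tilted_log_likelihood n X A - c * gain"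
    let ?w = "\<lambda>X A. edge_weight ?E (edge_kernel X) A"
    have "1 - measure P B = (\<Sum>A\<in>Pow ?E - B. likelihood n A / N)"
    proof -
      have "(\<Sum>A\<in>Pow ?E. likelihood n A / N) = 1"
        using N by (simp add: sum_divide_distrib[symmetric] sum_likelihood N_def)
      moreover have "(\<Sum>A\<in>Pow ?E. likelihood n A / N) = (\<Sum>A\<in>Pow ?E - B. likelihood n A / N) + (\<Sum>A\<in>B. likelihood n A / N)"
        by (rule sum.subset_diff) (auto simp: B_def)
      moreover have "Pow ?E \<inter> B = B" by (auto simp: B_def)
      ultimately show ?thesis by (simp add: mixture N_def)
    qed
    also have "\<dots> = (\<integral>X. (\<Sum>A\<in>Pow ?E - B. ?w X A) \<partial>?P) / N"
      unfolding sum_divide_distrib[symmetric] likelihood_def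
      by (subst Bochner_Integration.integral_sum) (auto intro: edge_weight_kernel_integrable)
    also have "\<dots> \<le> (\<integral>X. (4 / (c * gain)\<^sup>2) * (\<Sum>A\<in>Pow ?E. ?w X A * (?S X A)\<^sup>2) \<partial>?P) / N"
    proof (intro divide_right_mono integral_mono)
      show "integrable ?P (\<lambda>X. \<Sum>A\<in>Pow ?E - B. ?w X A)"
        by (intro Bochner_Integration.integrable_sum edge_weight_kernel_integrable)
      show "integrable ?P (\<lambda>X. (4 / (c * gain)\<^sup>2) * (\<Sum>A\<in>Pow ?E. ?w X A * (?S X A)\<^sup>2))"
        using second_moment_bound(2)[of n] unfolding c_def by (rule integrable_mult_right)
      fix X assume X: "X \<in> space ?P"
      have "(\<Sum>A\<in>Pow ?E - B. ?w X A) \<le> (\<Sum>A\<in>Pow ?E - B. (4 / (c * gain)\<^sup>2) * (?w X A * (?S X A)\<^sup>2))"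
      proof (intro sum_mono)
        fix A assume A: "A \<in> Pow ?E - B"
        have "exp (tilted_log_likelihood n X A) < exp (c * gain / 2)"
        proof -
          have "\<not> exp (c * gain / 2) \<le> Q ^ n * likelihood n A" using A by (auto simp: B_def)
          then show ?thesis using likelihood_lower_bound[OF X, of A] by linarith
        qed
        then have "c * gain / 2 \<le> - ?S X A" by simp
        then have "(c * gain / 2)\<^sup>2 \<le> (?S X A)\<^sup>2"
          using power_mono[of "c * gain / 2" "- ?S X A" 2] c gain by (simp only: power2_minus) simp
        then have "1 \<le> (4 / (c * gain)\<^sup>2) * (?S X A)\<^sup>2"
          using c gain by (simp add: field_simps power2_eq_square)
        then have "?w X A * 1 \<le> ?w X A * ((4 / (c * gain)\<^sup>2) * (?S X A)\<^sup>2)"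
          by (intro mult_left_mono edge_weight_kernel_nonneg)
        then show "?w X A \<le> (4 / (c * gain)\<^sup>2) * (?w X A * (?S X A)\<^sup>2)" by (simp add: mult.left_commute)
      qed
      also have "\<dots> \<le> (\<Sum>A\<in>Pow ?E. (4 / (c * gain)\<^sup>2) * (?w X A * (?S X A)\<^sup>2))"
        by (intro sum_mono2 mult_nonneg_nonneg edge_weight_kernel_nonneg zero_le_power2 divide_nonneg_nonneg) auto
      finally show "(\<Sum>A\<in>Pow ?E - B. ?w X A) \<le> (4 / (c * gain)\<^sup>2) * (\<Sum>A\<in>Pow ?E. ?w X A * (?S X A)\<^sup>2)"
        by (simp add: sum_distrib_left)
    qed (use N in simp)
    also have "\<dots> = (4 / (c * gain)\<^sup>2) * (\<integral>X. (\<Sum>A\<in>Pow ?E. ?w X A * (?S X A)\<^sup>2) \<partial>?P) / N" by simp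
    also have "\<dots> \<le> (4 / (c * gain)\<^sup>2) * (N * (4 * c * h)) / N"
      using second_moment_bound(1)[of n] N unfolding c_def N_def
      by (intro divide_right_mono mult_left_mono) auto
    also have "\<dots> = 16 * h / (c * gain\<^sup>2)" using N c gain by (simp add: field_simps power2_eq_square)
    finally show ?thesis .
  qed
  have "prob_space (erdos_renyi_half n)" by (simp add: erdos_renyi_half_def measure_pmf.prob_space_axioms)
  then have "measure P B - measure (erdos_renyi_half n) B \<le> TV P (erdos_renyi_half n)"
    using P by (intro TV_ge) auto
  then show ?thesis using null alt unfolding c_def by linarith
qed

end

section \<open>The quartic kernel in high dimension\<close>

lemma sphere_moment_pos: "d > 0 \<Longrightarrow> sphere_moment d m > 0"
proof (induction m)
  case (Suc m)
  have "(real d + 2 * real m) * sphere_moment d (Suc m) > 0"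
    unfolding sphere_moment_Suc[OF Suc.prems] using Suc by simp
  then show ?case using Suc.prems by (simp add: zero_less_mult_iff)
qed (simp add: sphere_moment_0)

text \<open>
  This is the entropy cost: the density \<open>\<langle>x, y\<rangle>^(2 m) / c\<close> is at most \<open>1 / c\<close>, which stays exponential in
  \<open>d\<close> when \<open>m\<close> is proportional to \<open>d\<close>.  The recursion for \<open>1 / c\<close> is dominated by that of a binomial
  coefficient.
\<close>

lemma inverse_sphere_moment_le:
  assumes d: "d > 0"
  shows "1 / sphere_moment d m \<le> 2 ^ (d + m)"
proof -
  have "1 / sphere_moment d m \<le> real (d + m choose m)"
  proof (induction m)
    case (Suc m)
    note pos = sphere_moment_pos[OF d, of m]
    have "sphere_moment d (Suc m) = (2 * real m + 1) / (real d + 2 * real m) * sphere_moment d m"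
      using sphere_moment_Suc[OF d, of m] d by (simp add: field_simps)
    then have "1 / sphere_moment d (Suc m) = (real d + 2 * real m) / (2 * real m + 1) * (1 / sphere_moment d m)"
      by simp
    also have "\<dots> \<le> (real d + real m + 1) / (real m + 1) * real (d + m choose m)"
    proof (intro mult_mono Suc.IH)
      have "(real d + 2 * real m) * (real m + 1) \<le> (real d + real m + 1) * (2 * real m + 1)"
        by (simp add: algebra_simps)
      then show "(real d + 2 * real m) / (2 * real m + 1) \<le> (real d + real m + 1) / (real m + 1)"
        by (simp add: divide_simps)
    qed (use pos in auto)
    also have "\<dots> = real (d + Suc m choose Suc m)"
    proof -
      have "real (Suc m) * real (Suc (d + m) choose Suc m) = real (Suc (d + m)) * real (d + m choose m)"
        by (metis Suc_times_binomial of_nat_mult)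
      then have "(real m + 1) * real (d + Suc m choose Suc m) = (real d + real m + 1) * real (d + m choose m)"
        by (simp add: add_ac del: binomial_Suc_Suc)
      then show ?thesis by (simp add: field_simps)
    qed
    finally show ?case .
  qed (simp add: sphere_moment_0)
  also have "\<dots> \<le> 2 ^ (d + m)"
    using binomial_le_pow2[of "d + m" m] by (metis of_nat_le_iff of_nat_numeral of_nat_power)
  finally show ?thesis .
qed

lemma card_vertex_pairs: "real (card (vertex_pairs n)) = real n * (real n - 1) / 2"
proof (induction n)
  case 0
  have "vertex_pairs 0 = {}" by (auto simp: vertex_pairs_def)
  then show ?case by simp
next
  case (Suc n)
  have "vertex_pairs (Suc n) = vertex_pairs n \<union> (\<lambda>i. (i, Suc n)) ` {1..n}"
    by (auto simp: vertex_pairs_def)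
  then have "card (vertex_pairs (Suc n)) = card (vertex_pairs n) + card ((\<lambda>i. (i, Suc n)) ` {1..n})"
  proof (simp only:, intro card_Un_disjoint)
    show "vertex_pairs n \<inter> (\<lambda>i. (i, Suc n)) ` {1..n} = {}" by (auto simp: vertex_pairs_def)
  qed simp_all
  also have "card ((\<lambda>i. (i, Suc n)) ` {1..n}) = n" by (subst card_image) (auto simp: inj_on_def)
  finally show ?case using Suc by (simp add: field_simps)
qed

definition tilt_density :: "nat \<Rightarrow> nat \<Rightarrow> (nat \<Rightarrow> real) \<Rightarrow> (nat \<Rightarrow> real) \<Rightarrow> real" where
  "tilt_density d m x y = inner_d d (sphere_retract d x) (sphere_retract d y) ^ (2 * m) / sphere_moment d m"

text \<open>
  The scalar of \<open>Hecke_P4\<close> after normalization of the power to a probability density.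
\<close>

definition tilt_eigenvalue :: "nat \<Rightarrow> nat \<Rightarrow> real" where
  "tilt_eigenvalue d m = 4 * real m * (real m - 1) / ((real d + 2 * real m) * (real d + 2 * real m + 2))"

lemma planted_kernel_P4:
  assumes d: "d \<ge> 3" and b: "0 < b" "b \<le> 1 / 4" and m: "m \<ge> 1"
  shows "planted_kernel (unif_sphere d) (\<lambda>x y. b * P4_kernel d x y) (tilt_density d m)
    (b\<^sup>2 / harmonic_dim d) (tilt_eigenvalue d m) (1 / sphere_moment d m) b"
proof -
  have d0: "d > 0" using d by simp
  interpret prob_space "unif_sphere d" by (rule prob_space_unif_sphere)
  let ?r = "sphere_retract d"
  note c = sphere_moment_pos[OF d0, of m]
  note nr = sphere_retract_norm[OF d0]
  have [measurable]: "(\<lambda>u. inner_d d u a) \<in> borel_measurable (unif_sphere d)" for a by simp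
  have [measurable]: "(\<lambda>u. inner_d d a (?r u)) \<in> borel_measurable (unif_sphere d)" for a
  proof -
    have [measurable]: "(\<lambda>u. ?r u) \<in> measurable (unif_sphere d) (borel_d d)" by measurable
    show ?thesis unfolding inner_d_commute[of d a] by measurable
  qed
  have AE_r: "AE u in unif_sphere d. ?r u = u" by (rule AE_sphere_retract[OF d0])
  show ?thesis
  proof
    show "(\<lambda>(x, y). b * P4_kernel d x y) \<in> borel_measurable (unif_sphere d \<Otimes>\<^sub>M unif_sphere d)" by measurable
    have "(\<lambda>p. inner_d d (?r (fst p)) (?r (snd p))) \<in> borel_measurable (unif_sphere d \<Otimes>\<^sub>M unif_sphere d)"
      by (intro inner_d_measurable sphere_retract_measurable) measurable
    then have "(\<lambda>p. inner_d d (?r (fst p)) (?r (snd p)) ^ (2 * m) / sphere_moment d m) \<in> borel_measurable (unif_sphere d \<Otimes>\<^sub>M unif_sphere d)"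
      by measurable
    then show "(\<lambda>(x, y). tilt_density d m x y) \<in> borel_measurable (unif_sphere d \<Otimes>\<^sub>M unif_sphere d)"
      by (simp add: tilt_density_def case_prod_beta')
    show "\<bar>b * P4_kernel d x y\<bar> \<le> b" for x y
      using mult_left_mono[OF abs_P4_kernel_le_1[OF d, of x y], of b] b by (simp add: abs_mult)
    show "b \<le> 1 / 4" by (rule b)
    show "b * P4_kernel d x y = b * P4_kernel d y x" for x y by (simp add: P4_kernel_sym)
    show "(\<integral>y. (b * P4_kernel d x y)\<^sup>2 \<partial>unif_sphere d) = b\<^sup>2 / harmonic_dim d" for x
    proof -
      have "(\<integral>y. (b * P4_kernel d x y)\<^sup>2 \<partial>unif_sphere d) = (\<integral>y. b\<^sup>2 * (P4_kernel d x y * P4_kernel d y x) \<partial>unif_sphere d)"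
        by (intro Bochner_Integration.integral_cong refl) (simp add: P4_kernel_sym[of d x] power2_eq_square)
      then show ?thesis by (simp add: P4_kernel_reproducing[OF d] P4_kernel_diag[OF d])
    qed
    show "0 \<le> tilt_density d m x y" for x y using c by (simp add: tilt_density_def)
    show "tilt_density d m x y \<le> 1 / sphere_moment d m" for x y
    proof -
      have "\<bar>inner_d d (?r x) (?r y)\<bar> ^ (2 * m) \<le> 1"
        by (intro power_le_one inner_d_sphere_le_1 nr) simp
      then show ?thesis using c by (simp add: tilt_density_def divide_right_mono power_even_abs)
    qed
    show "tilt_density d m x y = tilt_density d m y x" for x y by (simp add: tilt_density_def inner_d_commute)
    show "(\<integral>y. tilt_density d m x y \<partial>unif_sphere d) = 1" for x
    proof -
      have "(\<integral>y. tilt_density d m x y \<partial>unif_sphere d) = (\<integral>y. inner_d d y (?r x) ^ (2 * m) / sphere_moment d m \<partial>unif_sphere d)"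
      proof (rule integral_cong_AE)
        show "AE y in unif_sphere d. tilt_density d m x y = inner_d d y (?r x) ^ (2 * m) / sphere_moment d m"
          using AE_r by eventually_elim (simp add: tilt_density_def inner_d_commute)
        show "tilt_density d m x \<in> borel_measurable (unif_sphere d)" unfolding tilt_density_def by measurable
      qed measurable
      then show ?thesis using sphere_moment_linear[OF d0, of "?r x" m] c by (simp add: nr)
    qed
    show "(\<integral>y. tilt_density d m x y * (b * P4_kernel d y z) \<partial>unif_sphere d) = tilt_eigenvalue d m * (b * P4_kernel d x z)" for x z
    proof -
      have "(\<integral>y. tilt_density d m x y * (b * P4_kernel d y z) \<partial>unif_sphere d)
         = (\<integral>y. (b / sphere_moment d m) * (inner_d d y (?r x) ^ (2 * m) * P4 d (inner_d d y (?r z))) \<partial>unif_sphere d)"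
      proof (rule integral_cong_AE)
        show "AE y in unif_sphere d. tilt_density d m x y * (b * P4_kernel d y z)
            = (b / sphere_moment d m) * (inner_d d y (?r x) ^ (2 * m) * P4 d (inner_d d y (?r z)))"
          using AE_r by eventually_elim (simp add: tilt_density_def P4_kernel_def inner_d_commute)
        show "(\<lambda>y. tilt_density d m x y * (b * P4_kernel d y z)) \<in> borel_measurable (unif_sphere d)"
          unfolding tilt_density_def P4_kernel_def inner_d_commute[of d _ "?r z"] by measurable
      qed measurable
      also have "\<dots> = (b / sphere_moment d m) * (tilt_eigenvalue d m * sphere_moment d m * P4 d (inner_d d (?r x) (?r z)))"
        by (simp add: Hecke_P4[OF d nr nr] tilt_eigenvalue_def)
      finally show ?thesis using c by (simp add: P4_kernel_def)
    qed
    show "0 \<le> tilt_eigenvalue d m" using m by (simp add: tilt_eigenvalue_def)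
    have "4 * real m * (real m - 1) \<le> (real d + 2 * real m) * (real d + 2 * real m + 2)"
    proof -
      have "(2 * real m) * (2 * (real m - 1)) \<le> (real d + 2 * real m) * (real d + 2 * real m + 2)"
        using m by (intro mult_mono) auto
      then show ?thesis by (simp add: mult.assoc right_diff_distrib)
    qed
    then show "tilt_eigenvalue d m \<le> 1" using d0 by (simp add: tilt_eigenvalue_def divide_simps)
  qed
qed

lemma measure_kernel_graph:
  assumes d: "d \<ge> 3" and b: "0 < b" "b \<le> 1 / 4"
  shows "prob_space (kernel_graph n d (\<lambda>t. b * P4 d t))"
    and "sets (kernel_graph n d (\<lambda>t. b * P4 d t)) = UNIV"
    and "measure (kernel_graph n d (\<lambda>t. b * P4 d t)) B =
      (\<Sum>A\<in>Pow (vertex_pairs n) \<inter> B.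
         planted_kernel.likelihood (unif_sphere d) (\<lambda>x y. b * P4_kernel d x y) n A / 2 ^ card (vertex_pairs n))"
proof -
  interpret planted_kernel "unif_sphere d" "\<lambda>x y. b * P4_kernel d x y" "tilt_density d 1"
    "b\<^sup>2 / harmonic_dim d" "tilt_eigenvalue d 1" "1 / sphere_moment d 1" b
    by (rule planted_kernel_P4[OF assms order_refl])
  let ?E = "vertex_pairs n" and ?P = "PiM {1..n} (\<lambda>_. unif_sphere d)"
  interpret Pi: prob_space ?P by (intro prob_space_PiM prob_space_axioms)
  define p where "p X = (\<lambda>(i, j). (1 + b * P4 d (inner_d d (X i) (X j))) / 2)" for X :: "nat \<Rightarrow> nat \<Rightarrow> real"
  have K: "kernel_graph n d (\<lambda>t. b * P4 d t) = ?P \<bind> (\<lambda>X. measure_pmf (indep_edges n (p X)))"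
    by (simp add: kernel_graph_def p_def)
  have meas: "(\<lambda>X. measure_pmf (indep_edges n (p X))) \<in> measurable ?P (subprob_algebra (count_space UNIV))"
  proof (rule indep_edges_kernel_measurable)
    fix e assume e: "e \<in> ?E"
    obtain i j where ij: "e = (i, j)" by fastforce
    have [measurable]: "(\<lambda>X. X i) \<in> measurable ?P (unif_sphere d)" "(\<lambda>X. X j) \<in> measurable ?P (unif_sphere d)"
      using vertex_pairsD[of i j n] e ij by auto
    show "(\<lambda>X. p X e) \<in> borel_measurable ?P" unfolding p_def ij prod.case by measurable
  qed
  have ne: "space ?P \<noteq> {}" by (rule Pi.not_empty)
  show "sets (kernel_graph n d (\<lambda>t. b * P4 d t)) = UNIV"
    unfolding K using sets_bind_measurable[OF meas ne] by simp
  show "prob_space (kernel_graph n d (\<lambda>t. b * P4 d t))"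
    unfolding K by (rule Pi.prob_space_bind[OF _ meas]) (simp add: measure_pmf.prob_space_axioms)
  have ae: "AE X in ?P. measure (measure_pmf (indep_edges n (p X))) B
      = (\<Sum>A\<in>Pow ?E \<inter> B. edge_weight ?E (edge_kernel X) A / 2 ^ card ?E)"
  proof -
    have "AE X in ?P. \<forall>i\<in>{1..n}. sphere_retract d (X i) = X i"
    proof (rule AE_finite_allI)
      fix i assume "i \<in> {1..n}"
      then show "AE X in ?P. sphere_retract d (X i) = X i"
        using d by (intro AE_PiM_component[where M="\<lambda>_. unif_sphere d" and P="\<lambda>x. sphere_retract d x = x"] AE_sphere_retract prob_space_axioms) auto
    qed simp
    then show ?thesis
    proof eventually_elim
      case (elim X)
      have "pmf (indep_edges n (p X)) A = edge_weight ?E (edge_kernel X) A / 2 ^ card ?E" if "A \<subseteq> ?E" for A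
      proof (rule pmf_indep_edges_weight[OF that])
        fix e assume e: "e \<in> ?E"
        obtain i j where ij: "e = (i, j)" by fastforce
        show "p X e = (1 + edge_kernel X e) / 2"
        proof -
          have "edge_kernel X e = b * P4_kernel d (X i) (X j)" by (simp only: edge_kernel_def ij prod.case)
          then show ?thesis using vertex_pairsD[of i j n] e elim by (simp add: p_def ij P4_kernel_def)
        qed
        show "\<bar>edge_kernel X e\<bar> \<le> 1" using edge_kernel_bound[of X e] beta_le by linarith
      qed
      then show ?case by (simp add: measure_indep_edges)
    qed
  qed
  have "measure (kernel_graph n d (\<lambda>t. b * P4 d t)) B = (\<integral>X. measure (measure_pmf (indep_edges n (p X))) B \<partial>?P)"
    unfolding K by (rule Pi.measure_bind[OF meas]) simp
  also have "\<dots> = (\<integral>X. (\<Sum>A\<in>Pow ?E \<inter> B. edge_weight ?E (edge_kernel X) A / 2 ^ card ?E) \<partial>?P)"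
  proof (rule integral_cong_AE[OF _ _ ae])
    show "(\<lambda>X. measure (measure_pmf (indep_edges n (p X))) B) \<in> borel_measurable ?P"
      by (rule measurable_compose[OF meas measurable_measure_subprob_algebra]) simp
    show "(\<lambda>X. \<Sum>A\<in>Pow ?E \<inter> B. edge_weight ?E (edge_kernel X) A / 2 ^ card ?E) \<in> borel_measurable ?P"
      by (intro borel_measurable_sum borel_measurable_divide edge_weight_kernel_measurable) simp
  qed
  also have "\<dots> = (\<Sum>A\<in>Pow ?E \<inter> B. likelihood n A / 2 ^ card ?E)"
    unfolding likelihood_def
    by (subst Bochner_Integration.integral_sum) (auto intro!: edge_weight_kernel_integrable)
  finally show "measure (kernel_graph n d (\<lambda>t. b * P4 d t)) B = (\<Sum>A\<in>Pow ?E \<inter> B. likelihood n A / 2 ^ card ?E)" .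
qed

text \<open>
  The proportionality factor \<open>50\<close> only has to make the square of the eigenvalue exceed \<open>3/4\<close>
  by a margin; the bound gives \<open>361/400 \<ge> 3/4 + 1/8\<close>.
\<close>

lemma tilt_eigenvalue_ge:
  assumes d: "d \<ge> 3"
  shows "tilt_eigenvalue d (50 * d) \<ge> 19 / 20"
proof -
  have "19 / 20 * ((101 * real d) * (101 * real d + 2)) \<le> 4 * (50 * real d) * (50 * real d - 1)"
  proof -
    have "0 \<le> real d * (6181 * real d - 7838)" using d by (intro mult_nonneg_nonneg) auto
    then show ?thesis by (simp add: algebra_simps)
  qed
  moreover have "tilt_eigenvalue d (50 * d) = 4 * (50 * real d) * (50 * real d - 1) / ((101 * real d) * (101 * real d + 2))"
    by (simp add: tilt_eigenvalue_def)
  moreover have "(101 * real d) * (101 * real d + 2) > 0" using d by simp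
  ultimately show ?thesis by (simp only: pos_le_divide_eq)
qed

text \<open>
  The choice \<open>m = 50 d\<close> gives the entropy cost \<open>51 d\<close> per point, against which the gain of all pairs
  amounts to at least \<open>g d / 64\<close> per point; hence the threshold \<open>51 * 64 = 3264\<close>.
\<close>

lemma TV_lower_bound_explicit:
  assumes d: "d \<ge> 3" and n: "n \<ge> 2" and g: "0 < g"
    and size: "g * real d \<le> real n / (16 * harmonic_dim d)"
  shows "1 - 2048 / ((real n - 1) * g) - exp (real n * real d * (51 - g / 64))
     \<le> TV (kernel_graph n d (\<lambda>t. 1 / 4 * P4 d t)) (erdos_renyi_half n)"
proof -
  let ?m = "50 * d"
  have m: "?m \<ge> 1" using d by simp
  have b: "0 < (1 / 4 :: real)" "1 / 4 \<le> (1 / 4 :: real)" by auto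
  interpret planted_kernel "unif_sphere d" "\<lambda>x y. 1 / 4 * P4_kernel d x y" "tilt_density d ?m"
    "(1 / 4)\<^sup>2 / harmonic_dim d" "tilt_eigenvalue d ?m" "1 / sphere_moment d ?m" "1 / 4"
    by (rule planted_kernel_P4[OF d b m])
  define h where "h = (1 / 4)\<^sup>2 / harmonic_dim d"
  define E where "E = real (card (vertex_pairs n))"
  have h: "h > 0" using harmonic_dim_pos[OF d] by (simp add: h_def)
  have E: "E > 0" using n by (simp add: E_def card_vertex_pairs)
  have Eh: "(real n - 1) * (g * real d) / 2 \<le> E * h"
  proof -
    have "h = 1 / (16 * harmonic_dim d)" by (simp add: h_def power2_eq_square)
    then have "E * h = (real n - 1) / 2 * (real n / (16 * harmonic_dim d))"
      by (simp add: E_def card_vertex_pairs)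
    moreover have "(real n - 1) / 2 * (g * real d) \<le> (real n - 1) / 2 * (real n / (16 * harmonic_dim d))"
      using size n by (intro mult_left_mono) auto
    ultimately show ?thesis by simp
  qed
  have rho2: "(tilt_eigenvalue d ?m)\<^sup>2 - 3 / 4 \<ge> 1 / 8"
    using power_mono[OF tilt_eigenvalue_ge[OF d], of 2] by (simp add: power2_eq_square)
  have gain_ge: "h / 8 \<le> gain"
    using mult_right_mono[OF rho2, of h] h by (simp add: gain_def h_def)
  then have gain: "gain > 0" using h by linarith
  have nd: "1 * 1 \<le> real d" "real n \<ge> 2" using d n by auto
  have pos: "(real n - 1) * g > 0" using nd g by simp
  have t1: "16 * h / (E * gain\<^sup>2) \<le> 2048 / ((real n - 1) * g)"
  proof -
    have "16 * h / (E * gain\<^sup>2) \<le> 16 * h / (E * (h / 8)\<^sup>2)"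
      using h E gain_ge by (intro divide_left_mono mult_left_mono power_mono) auto
    also have "\<dots> = 1024 / (E * h)" using h E by (simp add: field_simps power2_eq_square)
    also have "\<dots> \<le> 1024 / ((real n - 1) * g / 2)"
    proof (rule divide_left_mono)
      have "(real n - 1) * g * 1 \<le> (real n - 1) * g * real d" using pos nd by (intro mult_left_mono) auto
      then show "(real n - 1) * g / 2 \<le> E * h" using Eh by (simp add: mult.assoc)
    qed (use pos E h in auto)
    finally show ?thesis by simp
  qed
  have t2: "(1 / sphere_moment d ?m) ^ n * exp (- (E * gain / 2)) \<le> exp (real n * real d * (51 - g / 64))"
  proof -
    have "(1 / sphere_moment d ?m) ^ n \<le> (2 ^ (d + ?m)) ^ n"
      using inverse_sphere_moment_le[of d ?m] sphere_moment_pos[of d ?m] d by (intro power_mono) auto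
    also have "\<dots> = 2 ^ (51 * d * n)" by (simp add: power_mult[symmetric])
    also have "\<dots> \<le> exp 1 ^ (51 * d * n)"
      using exp_ge_add_one_self[of 1] by (intro power_mono) auto
    also have "\<dots> = exp (real n * real d * 51)" by (simp add: exp_of_nat_mult[symmetric] mult_ac)
    finally have 1: "(1 / sphere_moment d ?m) ^ n \<le> exp (real n * real d * 51)" .
    have "real n * real d * (g / 64) \<le> E * gain / 2"
    proof -
      have "real n * (g * real d / 64) \<le> (2 * (real n - 1)) * (g * real d / 64)"
        using nd g by (intro mult_right_mono) auto
      also have "\<dots> = ((real n - 1) * (g * real d) / 2) / 16" by simp
      also have "\<dots> \<le> (E * h) / 16" using Eh by (rule divide_right_mono) simp
      also have "\<dots> \<le> E * gain / 2" using mult_left_mono[OF gain_ge, of E] E by simp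
      finally show ?thesis by (simp add: mult_ac)
    qed
    then have 2: "exp (- (E * gain / 2)) \<le> exp (- (real n * real d * (g / 64)))" by simp
    have "(1 / sphere_moment d ?m) ^ n * exp (- (E * gain / 2))
        \<le> exp (real n * real d * 51) * exp (- (real n * real d * (g / 64)))"
      using 1 2 by (intro mult_mono) auto
    also have "\<dots> = exp (real n * real d * (51 - g / 64))"
      by (simp add: exp_add[symmetric] algebra_simps)
    finally show ?thesis .
  qed
  note graph = measure_kernel_graph[OF d b]
  have "1 - 16 * h / (E * gain\<^sup>2) - (1 / sphere_moment d ?m) ^ n * exp (- (E * gain / 2))
      \<le> TV (kernel_graph n d (\<lambda>t. 1 / 4 * P4 d t)) (erdos_renyi_half n)"
    unfolding h_def E_def
    by (rule TV_lower_bound[OF graph gain]) (use E in \<open>simp add: E_def\<close>)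
  then show ?thesis using t1 t2 by linarith
qed

lemma rescaled_trace_3:
  fixes u N D :: real
  assumes "N > 0" 
  shows "(u * (16 * N * D)) ^ 3 * (N * (1 / 4 / N) ^ 3)\<^sup>2 = u ^ 3 * (D ^ 3 / N)"
proof -
  have "(u * (16 * N * D)) ^ 3 = u ^ 3 * D ^ 3 * (4096 * N ^ 3)" by (simp add: power_mult_distrib)
  moreover have "(N * (1 / 4 / N) ^ 3)\<^sup>2 = 1 / (4096 * N ^ 3 * N)"
    using assms by (simp add: power_divide power2_eq_square power3_eq_cube)
  ultimately show ?thesis using assms by simp
qed

lemma rescaled_trace_4:
  fixes u N D :: real
  assumes "N > 0" 
  shows "(u * (16 * N * D)) ^ 4 * (N * (1 / 4 / N) ^ 4)\<^sup>2 = u ^ 4 * (D ^ 4 / N\<^sup>2)"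
proof -
  have "(u * (16 * N * D)) ^ 4 = u ^ 4 * D ^ 4 * (65536 * N ^ 4)" by (simp add: power_mult_distrib)
  moreover have "(N * (1 / 4 / N) ^ 4)\<^sup>2 = 1 / (65536 * N ^ 4 * N\<^sup>2)"
    using assms by (simp add: power_divide power2_eq_square power4_eq_xxxx)
  ultimately show ?thesis using assms by simp
qed

lemma rescaled_trace_2:
  fixes u N D :: real
  assumes "N > 0" "D > 0"
  shows "(u * (16 * N * D)) * (N * (1 / 4 / N)\<^sup>2) / D = u"
  using assms by (simp add: power_divide power2_eq_square)

theorem propositionB1:
  shows "\<exists>g0::real. g0 > 0 \<and> (\<forall>g>g0.
    \<exists>(b::real) (d :: nat \<Rightarrow> nat) (n :: nat \<Rightarrow> nat) (k :: nat \<Rightarrow> real \<Rightarrow> real).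
      0 < b \<and> b < 1 \<and>
      (\<forall>m. d m \<ge> 3) \<and> (\<forall>m t. k m t = b * P4 (d m) t) \<and>
      filterlim d at_top sequentially \<and> filterlim n at_top sequentially \<and>
      (\<lambda>m. real (n m) ^ 3 * (tr_pow (d m) (k m) 3)\<^sup>2) \<longlonglongrightarrow> 0 \<and>
      (\<lambda>m. real (n m) ^ 4 * (tr_pow (d m) (k m) 4)\<^sup>2) \<longlonglongrightarrow> 0 \<and>
      (\<lambda>m. real (n m) * tr_pow (d m) (k m) 2 / real (d m)) \<longlonglongrightarrow> g \<and>
      (\<lambda>m. TV (kernel_graph (n m) (d m) (k m)) (erdos_renyi_half (n m))) \<longlonglongrightarrow> 1)"
proof (rule exI[of _ 3264], intro conjI allI impI)
  fix g :: real assume g: "g > 3264"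
  define d :: "nat \<Rightarrow> nat" where "d m = m + 3" for m
  define k :: "nat \<Rightarrow> real \<Rightarrow> real" where "k m t = 1 / 4 * P4 (d m) t" for m t
  define N where "N m = harmonic_dim (d m)" for m
  define n :: "nat \<Rightarrow> nat" where "n m = nat \<lceil>16 * g * real (d m) * N m\<rceil>" for m
  define F where "F x = 1 - 2048 / ((x - 1) * g) - exp (x * (51 - g / 64))" for x
  \<comment> \<open>With \<open>b = 1/4\<close> this is \<open>n h / d\<close>.\<close>
  define u where "u m = real (n m) / (16 * N m * real (d m))" for m
  have d3: "d m \<ge> 3" for m by (simp add: d_def)
  have N: "N m > 0" for m unfolding N_def by (rule harmonic_dim_pos[OF d3])
  have dp: "real (d m) > 0" for m by (simp add: d_def)
  have N_eq: "N m = (real m + 3) * (real m + 2) * (real m + 4) * (real m + 9) / 24" for m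
    by (simp add: N_def harmonic_dim_def d_def algebra_simps)
  have tr: "tr_pow (d m) (k m) r = N m * (1 / 4 / N m) ^ r" if "r \<ge> 1" for m r
    unfolding k_def[abs_def] N_def by (rule tr_pow_P4[OF d3 _ that]) simp
  have t2: "tr_pow (d m) (k m) 2 = N m * (1 / 4 / N m)\<^sup>2"
    and t3: "tr_pow (d m) (k m) 3 = N m * (1 / 4 / N m) ^ 3"
    and t4: "tr_pow (d m) (k m) 4 = N m * (1 / 4 / N m) ^ 4" for m
    by (rule tr, simp)+
  have nx: "16 * g * real (d m) * N m \<le> real (n m)" "real (n m) \<le> 16 * g * real (d m) * N m + 1" for m
  proof -
    have "0 \<le> 16 * g * real (d m) * N m" using g N[of m] by simp
    then show "16 * g * real (d m) * N m \<le> real (n m)" "real (n m) \<le> 16 * g * real (d m) * N m + 1"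
      unfolding n_def by linarith+
  qed
  have nm: "real m + 2 \<le> real (n m)" for m
  proof -
    have "real m + 2 \<le> real (d m) * 1" by (simp add: d_def)
    also have "\<dots> \<le> real (d m) * (16 * g * N m)"
    proof (rule mult_left_mono)
      have "(real m + 3) * (real m + 2) * (real m + 4) * (real m + 9) \<ge> 3 * 2 * 4 * 9"
        by (intro mult_mono) auto
      then have "N m \<ge> 1" by (simp add: N_eq)
      then have "1 * 1 \<le> (16 * g) * N m" using g by (intro mult_mono) auto
      then show "1 \<le> 16 * g * N m" by simp
    qed simp
    also have "\<dots> \<le> real (n m)" using nx(1)[of m] by (simp add: mult_ac)
    finally show ?thesis .
  qed
  have n_top: "filterlim (\<lambda>m. real (n m)) at_top sequentially"
  proof (rule filterlim_at_top_mono)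
    show "filterlim (\<lambda>m. real m + 2) at_top sequentially" by real_asymp
    show "\<forall>\<^sub>F m in sequentially. real m + 2 \<le> real (n m)" using nm by simp
  qed
  have u_lim: "u \<longlonglongrightarrow> g"
  proof (rule tendsto_sandwich[of "\<lambda>_. g" u sequentially "\<lambda>m. g + 1 / (16 * N m * real (d m))"])
    have "g \<le> u m" "u m \<le> g + 1 / (16 * N m * real (d m))" for m
      using nx[of m] N[of m] dp[of m] by (simp_all add: u_def field_simps)
    then show "\<forall>\<^sub>F m in sequentially. g \<le> u m" "\<forall>\<^sub>F m in sequentially. u m \<le> g + 1 / (16 * N m * real (d m))"
      by simp_all
    show "(\<lambda>m. g + 1 / (16 * N m * real (d m))) \<longlonglongrightarrow> g"
      unfolding N_eq d_def of_nat_add of_nat_numeral by real_asymp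
  qed simp
  have n_u: "real (n m) = u m * (16 * N m * real (d m))" for m
    using N[of m] dp[of m] by (simp add: u_def)
  show "\<exists>(b::real) (d :: nat \<Rightarrow> nat) (n :: nat \<Rightarrow> nat) (k :: nat \<Rightarrow> real \<Rightarrow> real).
      0 < b \<and> b < 1 \<and>
      (\<forall>m. d m \<ge> 3) \<and> (\<forall>m t. k m t = b * P4 (d m) t) \<and>
      filterlim d at_top sequentially \<and> filterlim n at_top sequentially \<and>
      (\<lambda>m. real (n m) ^ 3 * (tr_pow (d m) (k m) 3)\<^sup>2) \<longlonglongrightarrow> 0 \<and>
      (\<lambda>m. real (n m) ^ 4 * (tr_pow (d m) (k m) 4)\<^sup>2) \<longlonglongrightarrow> 0 \<and>
      (\<lambda>m. real (n m) * tr_pow (d m) (k m) 2 / real (d m)) \<longlonglongrightarrow> g \<and>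
      (\<lambda>m. TV (kernel_graph (n m) (d m) (k m)) (erdos_renyi_half (n m))) \<longlonglongrightarrow> 1"
  proof (rule exI[of _ "1 / 4"], rule exI[of _ d], rule exI[of _ n], rule exI[of _ k], intro conjI allI)
    show "3 \<le> d m" for m by (rule d3)
    show "k m t = 1 / 4 * P4 (d m) t" for m t by (simp add: k_def)
    show "filterlim d at_top sequentially"
    proof -
      have "filterlim (\<lambda>m. m + 3) at_top sequentially" by (rule filterlim_add_const_nat_at_top)
      then show ?thesis unfolding d_def[symmetric] .
    qed
    show "filterlim n at_top sequentially"
      using n_top by (simp add: filterlim_sequentially_iff_filterlim_real)
    show "(\<lambda>m. real (n m) ^ 3 * (tr_pow (d m) (k m) 3)\<^sup>2) \<longlonglongrightarrow> 0"
    proof -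
      have "real (n m) ^ 3 * (tr_pow (d m) (k m) 3)\<^sup>2 = u m ^ 3 * (real (d m) ^ 3 / N m)" for m
        unfolding t3 n_u by (rule rescaled_trace_3[OF N])
      moreover have "(\<lambda>m. u m ^ 3 * (real (d m) ^ 3 / N m)) \<longlonglongrightarrow> g ^ 3 * 0"
      proof (intro tendsto_mult tendsto_power u_lim)
        show "(\<lambda>m. real (d m) ^ 3 / N m) \<longlonglongrightarrow> 0"
          unfolding N_eq d_def of_nat_add of_nat_numeral by real_asymp
      qed
      ultimately show ?thesis by simp
    qed
    show "(\<lambda>m. real (n m) ^ 4 * (tr_pow (d m) (k m) 4)\<^sup>2) \<longlonglongrightarrow> 0"
    proof -
      have "real (n m) ^ 4 * (tr_pow (d m) (k m) 4)\<^sup>2 = u m ^ 4 * (real (d m) ^ 4 / (N m)\<^sup>2)" for m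
        unfolding t4 n_u by (rule rescaled_trace_4[OF N])
      moreover have "(\<lambda>m. u m ^ 4 * (real (d m) ^ 4 / (N m)\<^sup>2)) \<longlonglongrightarrow> g ^ 4 * 0"
      proof (intro tendsto_mult tendsto_power u_lim)
        show "(\<lambda>m. real (d m) ^ 4 / (N m)\<^sup>2) \<longlonglongrightarrow> 0"
          unfolding N_eq d_def of_nat_add of_nat_numeral by real_asymp
      qed
      ultimately show ?thesis by simp
    qed
    show "(\<lambda>m. real (n m) * tr_pow (d m) (k m) 2 / real (d m)) \<longlonglongrightarrow> g"
    proof -
      have "real (n m) * tr_pow (d m) (k m) 2 / real (d m) = u m" for m
        unfolding t2 n_u by (rule rescaled_trace_2[OF N dp])
      then show ?thesis using u_lim by simp
    qed
    show "(\<lambda>m. TV (kernel_graph (n m) (d m) (k m)) (erdos_renyi_half (n m))) \<longlonglongrightarrow> 1"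
    proof (rule tendsto_sandwich)
      have k_eq: "k m = (\<lambda>t. 1 / 4 * P4 (d m) t)" for m by (simp add: k_def fun_eq_iff)
      show "\<forall>\<^sub>F m in sequentially. F (real (n m)) \<le> TV (kernel_graph (n m) (d m) (k m)) (erdos_renyi_half (n m))"
      proof (intro always_eventually allI)
        fix m
        have "g * real (d m) \<le> real (n m) / (16 * harmonic_dim (d m))"
          using nx(1)[of m] N[of m] by (simp add: N_def field_simps)
        moreover have "n m \<ge> 2" using nm[of m] by linarith
        ultimately have TV: "1 - 2048 / ((real (n m) - 1) * g) - exp (real (n m) * real (d m) * (51 - g / 64))
            \<le> TV (kernel_graph (n m) (d m) (k m)) (erdos_renyi_half (n m))"
          unfolding k_eq using g by (intro TV_lower_bound_explicit d3) auto
        have "real (n m) * real (d m) * (51 - g / 64) \<le> real (n m) * 1 * (51 - g / 64)"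
          using g by (intro mult_right_mono_neg mult_left_mono) (auto simp: d_def)
        then show "F (real (n m)) \<le> TV (kernel_graph (n m) (d m) (k m)) (erdos_renyi_half (n m))"
          using TV unfolding F_def by (smt (verit) exp_le_cancel_iff mult_1_right)
      qed
      show "\<forall>\<^sub>F m in sequentially. TV (kernel_graph (n m) (d m) (k m)) (erdos_renyi_half (n m)) \<le> 1"
      proof (intro always_eventually allI TV_le_1)
        show "prob_space (kernel_graph (n m) (d m) (k m))" for m
          unfolding k_eq by (rule measure_kernel_graph(1)[OF d3]) auto
        show "prob_space (erdos_renyi_half (n m))" for m
          by (simp add: erdos_renyi_half_def measure_pmf.prob_space_axioms)
      qed
      have "(F \<longlongrightarrow> 1) at_top"
      proof -
        define c where "c = g / 64 - 51"
        have c: "c > 0" using g by (simp add: c_def)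
        have "((\<lambda>x. 1 - 2048 / ((x - 1) * g) - exp (- (x * c))) \<longlongrightarrow> 1) at_top"
          using g c by real_asymp
        moreover have "F x = 1 - 2048 / ((x - 1) * g) - exp (- (x * c))" for x
          by (simp add: F_def c_def algebra_simps)
        ultimately show ?thesis by presburger
      qed
      then show "(\<lambda>m. F (real (n m))) \<longlonglongrightarrow> 1" using n_top by (rule filterlim_compose)
    qed simp
  qed auto
qed simp

end
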